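(* Let $X$ be a quasi-projective variety, let $\Phi\colon X\dashrightarrow X$ be a rational self-map, and let $f\colon X\dashrightarrow \mathbb{P}^1$ be a non-constant rational function, all defined over $\overline{\mathbb{Q}}$. Then for any $x\in X_{\Phi,f}(\overline{\mathbb{Q}})$, either the set $f(\mathcal{O}_\Phi(x))$ is finite, or \[ \limsup_{n\to\infty} \frac{h(f(\Phi^n(x)))}{\log n}>0. \]
   Context: $h(\cdot)$ denotes the absolute logarithmic Weil height on $\mathbb{P}^1(\overline{\mathbb{Q}})$. For a rational map $g$, $I_g$ denotes its indeterminacy locus. $X_\Phi(\overline{\mathbb{Q}})$ is the set of $x\in X(\overline{\mathbb{Q}})$ such that $\Phi^n(x)\notin I_\Phi$ for all $n\in\mathbb{N}=\{0,1,2,\dots\}$; for such $x$, $\mathcal{O}_\Phi(x)=\{\Phi^n(x):n\in\mathbb{N}\}$ is its forward orbit. $X_{\Phi,f}(\overline{\mathbb{Q}})$ is the set of $x\in X_\Phi(\overline{\mathbb{Q}})$ with $I_f\cap \mathcal{O}_\Phi(x)=\varnothing$. *)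

theory Defs
  imports
    "HOL-Analysis.Analysis"
    "HOL-Library.Poly_Mapping"
    "HOL-Algebra.Generated_Fields"
    "HOL-Algebra.Algebraic_Closure_Type"
begin

type_synonym qbar = "rat alg_closure"


section \<open>Projective space and the Zariski topology\<close>

text \<open>
  Varieties are identified with their sets of closed points, which are lines through the origin
  with the origin removed. The index type \<open>'n\<close> has one element for each of the
  homogeneous coordinates, so that \<open>'a ^ 'n\<close> gives projective space of dimension
  \<open>CARD('n) - 1\<close>.
\<close>

type_synonym ('a, 'n) ppoint = "('a ^ 'n) set"

definition proj_rel :: "(('a::field ^ 'n::finite) \<times> ('a ^ 'n)) set" where
  "proj_rel = {(x, y). x \<noteq> 0 \<and> y \<noteq> 0 \<and> (\<exists>c. y = c *s x)}"

definition proj_space :: "('a::field, 'n::finite) ppoint set" where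
  "proj_space = {x. x \<noteq> 0} // proj_rel"

definition proj_point :: "'a::field ^ 'n::finite \<Rightarrow> ('a, 'n) ppoint" where
  "proj_point x = proj_rel `` {x}"

type_synonym ('a, 'n) mpol = "('n \<Rightarrow>\<^sub>0 nat) \<Rightarrow>\<^sub>0 'a"

definition mpol_eval :: "('a::comm_semiring_1, 'n::finite) mpol \<Rightarrow> 'a ^ 'n \<Rightarrow> 'a" where
  "mpol_eval p x = (\<Sum>m\<in>Poly_Mapping.keys p.
     Poly_Mapping.lookup p m * (\<Prod>i\<in>UNIV. (x $ i) ^ Poly_Mapping.lookup m i))"

definition homogeneous :: "nat \<Rightarrow> ('a::zero, 'n::finite) mpol \<Rightarrow> bool" where
  "homogeneous d p \<longleftrightarrow>
     (\<forall>m\<in>Poly_Mapping.keys p. (\<Sum>i\<in>UNIV. Poly_Mapping.lookup m i) = d)"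

definition zariski_closed :: "('a::field, 'n::finite) ppoint set \<Rightarrow> bool" where
  "zariski_closed Z \<longleftrightarrow>
     (\<exists>S. (\<forall>p\<in>S. \<exists>d. homogeneous d p) \<and>
          Z = {P \<in> proj_space. \<forall>p\<in>S. \<forall>x\<in>P. mpol_eval p x = 0})"

definition zariski_open_in ::
    "('a::field, 'n::finite) ppoint set \<Rightarrow> ('a, 'n) ppoint set \<Rightarrow> bool" where
  "zariski_open_in V U \<longleftrightarrow> (\<exists>Z. zariski_closed Z \<and> U = V - Z)"

definition zariski_irreducible :: "('a::field, 'n::finite) ppoint set \<Rightarrow> bool" where
  "zariski_irreducible V \<longleftrightarrow> V \<noteq> {} \<and>
     (\<forall>A B. zariski_closed A \<longrightarrow> zariski_closed B \<longrightarrow> V \<subseteq> A \<union> B \<longrightarrow> V \<subseteq> A \<or> V \<subseteq> B)"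

definition projective_variety :: "('a::field, 'n::finite) ppoint set \<Rightarrow> bool" where
  "projective_variety Z \<longleftrightarrow> zariski_closed Z \<and> zariski_irreducible Z"

definition quasi_projective_variety :: "('a::field, 'n::finite) ppoint set \<Rightarrow> bool" where
  "quasi_projective_variety V \<longleftrightarrow>
     V \<noteq> {} \<and> (\<exists>Z. projective_variety Z \<and> zariski_open_in Z V)"


section \<open>Morphisms and rational maps\<close>

text \<open>
  A morphism is locally given by homogeneous forms of a common degree without common zero.
  It is encoded as a partial map whose domain is exactly its source.
\<close>

definition morphism ::
    "('a::field, 'n::finite) ppoint set \<Rightarrow> ('a, 'm::finite) ppoint set \<Rightarrow>
     (('a, 'n) ppoint \<rightharpoonup> ('a, 'm) ppoint) \<Rightarrow> bool" where
  "morphism U Y \<phi> \<longleftrightarrow> dom \<phi> = U \<and> ran \<phi> \<subseteq> Y \<and>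
     (\<forall>P\<in>U. \<exists>V d F. zariski_open_in U V \<and> P \<in> V \<and> (\<forall>j::'m. homogeneous d (F j)) \<and>
        (\<forall>Q\<in>V. \<forall>x\<in>Q. (\<chi> j. mpol_eval (F j) x) \<noteq> 0 \<and>
                        \<phi> Q = Some (proj_point (\<chi> j. mpol_eval (F j) x))))"

text \<open>
  A rational map from a variety \<open>V\<close> to \<open>Y\<close> is an equivalence class of morphisms to \<open>Y\<close> defined
  on nonempty open subsets of \<open>V\<close>, two of them being equivalent if they agree wherever both are
  defined. Points at which the map extends to the closure of \<open>Y\<close> with value outside \<open>Y\<close>
  therefore belong to the indeterminacy locus.
\<close>

definition rational_map_reps ::
    "('a::field, 'n::finite) ppoint set \<Rightarrow> ('a, 'm::finite) ppoint set \<Rightarrow>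
     (('a, 'n) ppoint \<rightharpoonup> ('a, 'm) ppoint) set" where
  "rational_map_reps V Y = {\<phi>. \<exists>U. zariski_open_in V U \<and> U \<noteq> {} \<and> morphism U Y \<phi>}"

definition rational_map_rel ::
    "('a::field, 'n::finite) ppoint set \<Rightarrow> ('a, 'm::finite) ppoint set \<Rightarrow>
     ((('a, 'n) ppoint \<rightharpoonup> ('a, 'm) ppoint) \<times> (('a, 'n) ppoint \<rightharpoonup> ('a, 'm) ppoint)) set" where
  "rational_map_rel V Y =
     {(\<phi>, \<psi>). \<phi> \<in> rational_map_reps V Y \<and> \<psi> \<in> rational_map_reps V Y \<and>
               (\<forall>P \<in> dom \<phi> \<inter> dom \<psi>. \<phi> P = \<psi> P)}"

type_synonym ('a, 'n, 'm) rat_map = "(('a, 'n) ppoint \<rightharpoonup> ('a, 'm) ppoint) set"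

definition rational_maps ::
    "('a::field, 'n::finite) ppoint set \<Rightarrow> ('a, 'm::finite) ppoint set \<Rightarrow>
     ('a, 'n, 'm) rat_map set" where
  "rational_maps V Y = rational_map_reps V Y // rational_map_rel V Y"

definition indeterminacy ::
    "('a, 'n) ppoint set \<Rightarrow> ('a, 'n, 'm) rat_map \<Rightarrow> ('a, 'n) ppoint set" where
  "indeterminacy V g = V - (\<Union>\<phi>\<in>g. dom \<phi>)"

definition rat_app :: "('a, 'n, 'm) rat_map \<Rightarrow> ('a, 'n) ppoint \<Rightarrow> ('a, 'm) ppoint" where
  "rat_app g P = (THE Q. \<exists>\<phi>\<in>g. \<phi> P = Some Q)"

definition nonconstant_on :: "('a, 'n) ppoint set \<Rightarrow> ('a, 'n, 'm) rat_map \<Rightarrow> bool" where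
  "nonconstant_on V g \<longleftrightarrow> \<not> (\<exists>Q. \<forall>P \<in> V - indeterminacy V g. rat_app g P = Q)"


section \<open>Orbits\<close>

definition orbit_defined ::
    "('a, 'n) ppoint set \<Rightarrow> ('a, 'n, 'n) rat_map \<Rightarrow> ('a, 'n) ppoint set" where
  "orbit_defined V \<Phi> = {x \<in> V. \<forall>n. (rat_app \<Phi> ^^ n) x \<notin> indeterminacy V \<Phi>}"

definition forward_orbit ::
    "('a, 'n, 'n) rat_map \<Rightarrow> ('a, 'n) ppoint \<Rightarrow> ('a, 'n) ppoint set" where
  "forward_orbit \<Phi> x = range (\<lambda>n. (rat_app \<Phi> ^^ n) x)"

definition orbit_defined_for ::
    "('a, 'n) ppoint set \<Rightarrow> ('a, 'n, 'n) rat_map \<Rightarrow> ('a, 'n, 'm) rat_map \<Rightarrow>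
     ('a, 'n) ppoint set" where
  "orbit_defined_for V \<Phi> f =
     {x \<in> orbit_defined V \<Phi>. indeterminacy V f \<inter> forward_orbit \<Phi> x = {}}"


section \<open>The absolute logarithmic Weil height\<close>

definition absolute_value_on :: "'a::field set \<Rightarrow> ('a \<Rightarrow> real) \<Rightarrow> bool" where
  "absolute_value_on K v \<longleftrightarrow>
     (\<forall>x\<in>K. 0 \<le> v x \<and> (v x = 0 \<longleftrightarrow> x = 0)) \<and>
     (\<forall>x\<in>K. \<forall>y\<in>K. v (x * y) = v x * v y \<and> v (x + y) \<le> v x + v y)"

definition padic_abs :: "nat \<Rightarrow> rat \<Rightarrow> real" where
  "padic_abs p q = (if q = 0 then 0 else
     real p powi (int (multiplicity (int p) (snd (quotient_of q)))
                  - int (multiplicity (int p) (fst (quotient_of q)))))"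

text \<open>
  The places of a number field are represented by the absolute values extending the usual or a
  \<open>p\<close>-adic absolute value of the rationals. Extensionality outside \<open>K\<close> ensures that
  each place is counted once.
\<close>

definition places :: "qbar set \<Rightarrow> (qbar \<Rightarrow> real) set" where
  "places K = {v \<in> extensional K. absolute_value_on K v \<and>
     ((\<forall>q::rat. v (of_rat q) = of_rat \<bar>q\<bar>) \<or>
      (\<exists>p. Factorial_Ring.prime p \<and> (\<forall>q::rat. v (of_rat q) = padic_abs p q)))}"

definition cauchy_seqs :: "qbar set \<Rightarrow> (qbar \<Rightarrow> real) \<Rightarrow> (nat \<Rightarrow> qbar) set" where
  "cauchy_seqs K v = {s. range s \<subseteq> K \<and>
     (\<forall>e>0. \<exists>M. \<forall>m\<ge>M. \<forall>n\<ge>M. v (s m - s n) < e)}"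

text \<open>
  The local degree is the degree of the completion of \<open>K\<close> at \<open>v\<close> over the completion of the
  rationals, i.e. the least cardinality of a spanning set. Elements of the completions are
  represented by Cauchy sequences, which are equal in the completion if their difference is a
  null sequence.
\<close>

definition local_degree :: "qbar set \<Rightarrow> (qbar \<Rightarrow> real) \<Rightarrow> nat" where
  "local_degree K v = (LEAST d. \<exists>e. (\<forall>i<d. e i \<in> cauchy_seqs K v) \<and>
     (\<forall>s \<in> cauchy_seqs K v. \<exists>c. (\<forall>i<d. c i \<in> cauchy_seqs (range of_rat) v) \<and>
        (\<lambda>n. v (s n - (\<Sum>i<d. c i n * e i n))) \<longlonglongrightarrow> 0))"

definition degree_over_rat :: "qbar set \<Rightarrow> nat" where
  "degree_over_rat K = vector_space.dim (\<lambda>(q::rat) x. of_rat q * x) K"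

definition height_over :: "qbar set \<Rightarrow> qbar ^ 'n::finite \<Rightarrow> real" where
  "height_over K x =
     (\<Sum>\<^sub>\<infinity>v\<in>places K. real (local_degree K v) * ln (Max (range (\<lambda>i. v (x $ i)))))
       / real (degree_over_rat K)"

text \<open>
  The value of \<open>height_over\<close> depends neither on the homogeneous coordinates, by the product
  formula, nor on the number field containing them. Coordinates of which one equals 1 are used,
  together with the field they generate, which is the field of definition of the point.
\<close>

definition weil_height :: "(qbar, 'n::finite) ppoint \<Rightarrow> real" where
  "weil_height P = (let x = (SOME x. x \<in> P \<and> (\<exists>i. x $ i = 1))
     in height_over (generate_field ring_of_type_algebra (range (\<lambda>i. x $ i))) x)"

end

theory Submission
  imports
    Defs
    "HOL-Library.Function_Algebras"
    "HOL-Real_Asymp.Real_Asymp"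
    "Jordan_Normal_Form.Char_Poly"
begin

text \<open>
  Write \<open>a n\<close> for the value of \<open>f\<close> at the \<open>n\<close>-th point of the orbit. The pairs \<open>(m, n)\<close> with
  \<open>a (m + i) = a (n + i)\<close> form a Zariski closed subset of (orbit) x (orbit), so by the Hilbert basis
  theorem there is a \<open>k\<close> such that agreement for all \<open>i < k\<close> forces agreement for all \<open>i\<close>: the
  sequence \<open>a\<close> is determined by any of its windows of length \<open>k\<close>. Quasi-compactness of the orbit also
  shows that all \<open>a n\<close> are defined over one number field. The number of points of height at most
  \<open>B\<close> over a fixed number field is at most exponential in \<open>B\<close>, hence if the upper limit is not positive,
  only \<open>M\<close> to the power \<open>o(1)\<close> values occur among the first \<open>M\<close> terms. By the pigeonhole principle two
  windows coincide, \<open>a\<close> is eventually periodic, and its range is finite.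

  For the counting, the characteristic polynomial \<open>P\<close> of an element \<open>\<alpha>\<close> of a number field of degree \<open>D\<close> is
  determined by its values at \<open>0, ..., D - 1\<close>, which are norms of \<open>j - \<alpha>\<close>. At each place \<open>w\<close> of the
  rationals the norm is bounded through the spectral radius by \<open>v (j - \<alpha>) ^ D\<close> for some \<open>v\<close> above \<open>w\<close>.
  Multiplying over all \<open>w\<close> bounds the numerators and denominators of the values exponentially in the
  height. Only the inequality that local degrees are at least 1 enters.
\<close>

section \<open>Noetherian rings of functions\<close>

text \<open>On the orbit an iterate of the map has no global formula, only charts that change from
  point to point. Closedness is therefore expressed by functions on pairs of indices: off the closed
  set some function is nonzero that vanishes on it. One ring, generated by the constants and chosen
  homogeneous coordinates, contains these functions for all charts and all iterates at once. In the
  counting, factoring a norm over all places above \<open>w\<close> would call for completions and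
  the extension theory of absolute values. An inequality takes its place: the norm is at most the
  \<open>D\<close>-th power of the spectral radius, and an absolute value attaining this radius at a
  given nonzero element is found by Zorn's lemma as a minimal power-multiplicative seminorm. One
  place above each rational place is enough, because all terms of the height are nonnegative for
  coordinates 1 and \<alpha>. The field over which a height is computed varies with the point, while
  norms are taken from one common field \<open>L\<close>; places are restricted from
  \<open>L\<close> to the smaller field.\<close>

definition unital_subring :: "'r::comm_ring_1 set \<Rightarrow> bool" where
  "unital_subring S \<longleftrightarrow> 1 \<in> S \<and> (\<forall>x\<in>S. \<forall>y\<in>S. x - y \<in> S \<and> x * y \<in> S)"

lemma unital_subringD:
  assumes "unital_subring S"
  shows "1 \<in> S" "0 \<in> S"
    and "x \<in> S \<Longrightarrow> y \<in> S \<Longrightarrow> x - y \<in> S"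
    and "x \<in> S \<Longrightarrow> y \<in> S \<Longrightarrow> x * y \<in> S"
    and "x \<in> S \<Longrightarrow> y \<in> S \<Longrightarrow> x + y \<in> S"
    and "x \<in> S \<Longrightarrow> - x \<in> S"
proof -
  have d: "x - y \<in> S" if "x \<in> S" "y \<in> S" for x y
    using assms that by (auto simp: unital_subring_def)
  show one: "1 \<in> S" and "x \<in> S \<Longrightarrow> y \<in> S \<Longrightarrow> x * y \<in> S"
    using assms by (auto simp: unital_subring_def)
  show zero: "0 \<in> S" using d[OF one one] by simp
  show "x \<in> S \<Longrightarrow> y \<in> S \<Longrightarrow> x - y \<in> S" by (rule d)
  have m: "- x \<in> S" if "x \<in> S" for x using d[OF zero that] by simp
  show "x \<in> S \<Longrightarrow> - x \<in> S" by (rule m)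
  show "x \<in> S \<Longrightarrow> y \<in> S \<Longrightarrow> x + y \<in> S" using d[OF _ m, of x y] by simp
qed

lemma unital_subring_sum:
  assumes "unital_subring S" "\<And>i. i \<in> A \<Longrightarrow> g i \<in> S"
  shows "sum g A \<in> S"
  using assms(2) by (induction A rule: infinite_finite_induct) (auto intro: unital_subringD[OF assms(1)])

lemma unital_subring_prod:
  assumes "unital_subring S" "\<And>i. i \<in> A \<Longrightarrow> g i \<in> S"
  shows "prod g A \<in> S"
  using assms(2) by (induction A rule: infinite_finite_induct) (auto intro: unital_subringD[OF assms(1)])

lemma unital_subring_power:
  assumes "unital_subring S" "a \<in> S"
  shows "a ^ k \<in> S"
  by (induction k) (auto intro: unital_subringD[OF assms(1)] assms(2))

text \<open>Closure rules in place of explicit linear combinations: evaluation, vanishing at a point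
  and change of generators all transfer by a four-case induction.\<close>

inductive_set ideal_span :: "'r::comm_ring_1 set \<Rightarrow> 'r set \<Rightarrow> 'r set"
  for S F where
    zero: "0 \<in> ideal_span S F"
  | base: "a \<in> F \<Longrightarrow> a \<in> ideal_span S F"
  | add: "a \<in> ideal_span S F \<Longrightarrow> b \<in> ideal_span S F \<Longrightarrow> a + b \<in> ideal_span S F"
  | mult: "c \<in> S \<Longrightarrow> a \<in> ideal_span S F \<Longrightarrow> c * a \<in> ideal_span S F"

lemma ideal_span_trans:
  assumes "a \<in> ideal_span S F" "F \<subseteq> ideal_span S G"
  shows "a \<in> ideal_span S G"
  using assms(1) by induction (use assms(2) in \<open>auto intro: ideal_span.intros\<close>)

lemma ideal_span_mono: "F \<subseteq> G \<Longrightarrow> ideal_span S F \<subseteq> ideal_span S G"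
  by (auto intro: ideal_span_trans ideal_span.base)

lemma ideal_span_finite_support:
  assumes "a \<in> ideal_span S F"
  shows "\<exists>F0\<subseteq>F. finite F0 \<and> a \<in> ideal_span S F0"
  using assms
proof induction
  case zero
  show ?case by (rule exI[of _ "{}"]) (auto intro: ideal_span.zero)
next
  case (base a)
  then show ?case by (intro exI[of _ "{a}"]) (auto intro: ideal_span.base)
next
  case (add a b)
  then obtain F1 F2 where "F1 \<subseteq> F" "finite F1" "a \<in> ideal_span S F1"
    "F2 \<subseteq> F" "finite F2" "b \<in> ideal_span S F2" by blast
  then show ?case
    using ideal_span_mono[of F1 "F1 \<union> F2" S] ideal_span_mono[of F2 "F1 \<union> F2" S]
    by (intro exI[of _ "F1 \<union> F2"]) (auto intro!: ideal_span.add)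
next
  case (mult c a)
  then show ?case by (blast intro: ideal_span.mult)
qed

lemma ideal_span_finite_support_set:
  assumes "finite G" "G \<subseteq> ideal_span S F"
  shows "\<exists>F0\<subseteq>F. finite F0 \<and> G \<subseteq> ideal_span S F0"
  using assms
proof (induction G rule: finite_induct)
  case empty
  show ?case by (rule exI[of _ "{}"]) auto
next
  case (insert g G)
  then obtain F1 where 1: "F1 \<subseteq> F" "finite F1" "G \<subseteq> ideal_span S F1" by auto
  from insert.prems have "g \<in> ideal_span S F" by simp
  from ideal_span_finite_support[OF this] obtain F2
    where 2: "F2 \<subseteq> F" "finite F2" "g \<in> ideal_span S F2" by auto
  show ?case
    using 1 2 ideal_span_mono[of F1 "F1 \<union> F2" S] ideal_span_mono[of F2 "F1 \<union> F2" S]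
    by (intro exI[of _ "F1 \<union> F2"]) auto
qed

lemma ideal_span_uminus:
  assumes "unital_subring S" "a \<in> ideal_span S F"
  shows "- a \<in> ideal_span S F"
  using ideal_span.mult[OF unital_subringD(6)[OF assms(1) unital_subringD(1)[OF assms(1)]] assms(2)]
  by simp

text \<open>The finite generating set is required to lie in \<open>F\<close> itself. In this form a
  family of equations is cut down to a finite subfamily of the same equations.\<close>

definition noetherian :: "'r::comm_ring_1 set \<Rightarrow> bool" where
  "noetherian S \<longleftrightarrow> (\<forall>F\<subseteq>S. \<exists>F0\<subseteq>F. finite F0 \<and> F \<subseteq> ideal_span S F0)"

lemma noetherianE:
  assumes "noetherian S" "F \<subseteq> S"
  obtains F0 where "F0 \<subseteq> F" "finite F0" "F \<subseteq> ideal_span S F0"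
  using assms(1)[unfolded noetherian_def, rule_format, OF assms(2)] that by metis

definition polys_over :: "'r::comm_ring_1 set \<Rightarrow> 'r poly set" where
  "polys_over S = {p. \<forall>i. Polynomial.coeff p i \<in> S}"

lemma unital_subring_polys_over:
  assumes "unital_subring S"
  shows "unital_subring (polys_over S)"
  unfolding unital_subring_def polys_over_def
  using unital_subringD[OF assms]
  by (auto simp: coeff_mult coeff_1 intro!: unital_subring_sum[OF assms])

text \<open>Hilbert's argument by leading coefficients: every element of the ideal \<open>I\<close>
  can be lowered in degree by subtracting a combination of finitely many witnesses, one for each
  generator of the coefficient ideals up to a degree \<open>n\<close> beyond which these no longer
  grow.\<close>

theorem hilbert_basis_polys_over:
  assumes S: "unital_subring S" and N: "noetherian S"
  shows "noetherian (polys_over S)"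
  unfolding noetherian_def
proof (intro allI impI)
  let ?P = "polys_over S"
  fix F assume F: "F \<subseteq> ?P"
  have P: "unital_subring ?P" by (rule unital_subring_polys_over[OF S])
  define I where "I = ideal_span ?P F"
  have IP: "I \<subseteq> ?P"
  proof
    fix a assume "a \<in> I"
    then show "a \<in> ?P" unfolding I_def
      by induction (use F unital_subringD[OF P] in auto)
  qed
  have monomP: "Polynomial.monom 1 k \<in> ?P" for k
    using unital_subringD[OF S] by (auto simp: polys_over_def)
  \<comment> \<open>Allowing degrees below \<open>d\<close> keeps \<open>L d\<close> an ideal when
    leading terms cancel; multiplication by a power of the variable makes the ideals increase with
    \<open>d\<close>.\<close>
  define L where "L d = {Polynomial.coeff a d |a. a \<in> I \<and> Polynomial.degree a \<le> d}" for d
  have LS: "L d \<subseteq> S" for d using IP by (auto simp: L_def polys_over_def)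
  have Lmono: "L d \<subseteq> L e" if "d \<le> e" for d e
  proof
    fix c assume "c \<in> L d"
    then obtain a where a: "a \<in> I" "Polynomial.degree a \<le> d" "c = Polynomial.coeff a d" by (auto simp: L_def)
    have "Polynomial.monom 1 (e - d) * a \<in> I"
      using a(1) monomP by (auto simp: I_def intro: ideal_span.mult)
    moreover have "Polynomial.degree (Polynomial.monom 1 (e - d) * a) \<le> e"
      using degree_mult_le[of "Polynomial.monom 1 (e - d)" a] degree_monom_le[of "1::'a" "e - d"] a(2) that
      by linarith
    moreover have "Polynomial.coeff (Polynomial.monom 1 (e - d) * a) e = c"
      using that a(3) by (simp add: coeff_monom_mult)
    ultimately show "c \<in> L e" unfolding L_def by blast
  qed
  have "\<forall>d. \<exists>G\<subseteq>L d. finite G \<and> L d \<subseteq> ideal_span S G"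
    using N LS by (auto simp: noetherian_def)
  then obtain G where G: "\<And>d. G d \<subseteq> L d" "\<And>d. finite (G d)" "\<And>d. L d \<subseteq> ideal_span S (G d)"
    by metis
  have "(\<Union>d. L d) \<subseteq> S" using LS by auto
  then obtain H where H: "H \<subseteq> (\<Union>d. L d)" "finite H" "(\<Union>d. L d) \<subseteq> ideal_span S H"
    using noetherianE[OF N] by metis
  have "\<forall>h\<in>H. \<exists>d. h \<in> L d" using H by auto
  then obtain dd where dd: "\<And>h. h \<in> H \<Longrightarrow> h \<in> L (dd h)" by metis
  define n where "n = Max (insert 0 (dd ` H))"
  have Hn: "H \<subseteq> L n"
  proof
    fix h assume h: "h \<in> H"
    have "dd h \<le> n" unfolding n_def using H(2) h by (intro Max_ge) auto
    then show "h \<in> L n" using dd[OF h] Lmono by blast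
  qed
  \<comment> \<open>At \<open>n\<close> the generators \<open>H\<close> of the union of all
    \<open>L d\<close> are used, so that all degrees above \<open>n\<close> are served by the same
    finite set.\<close>
  define G' where "G' d = (if d = n then H else G d)" for d
  have G'L: "G' d \<subseteq> L d" "finite (G' d)" for d
    using G Hn H by (auto simp: G'_def)
  have "\<forall>d. \<forall>c\<in>L d. \<exists>a. a \<in> I \<and> Polynomial.degree a \<le> d \<and> Polynomial.coeff a d = c" by (auto simp: L_def)
  then obtain w where w: "\<And>d c. c \<in> L d \<Longrightarrow> w d c \<in> I \<and> Polynomial.degree (w d c) \<le> d \<and> Polynomial.coeff (w d c) d = c"
    by metis
  define B where "B = (\<Union>d\<le>n. w d ` G' d)"
  have finB: "finite B" unfolding B_def using G'L by auto
  have BI: "B \<subseteq> I" unfolding B_def using G'L w by blast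
  \<comment> \<open>A coefficient in the span of \<open>G' d\<close> is realised in any degree
    \<open>e\<close> from \<open>d\<close> on by shifting the witnesses; this supplies the term to
    subtract.\<close>
  have lift: "\<exists>h\<in>ideal_span ?P B. Polynomial.degree h \<le> e \<and> Polynomial.coeff h e = c"
    if c: "c \<in> ideal_span S (G' d)" and d: "d \<le> n" "d \<le> e" for c d e
    using c
  proof induction
    case zero
    show ?case by (intro bexI[of _ 0]) (auto intro: ideal_span.zero)
  next
    case (base a)
    have a: "w d a \<in> B" unfolding B_def using base d by auto
    have aL: "a \<in> L d" using base G'L by auto
    let ?h = "Polynomial.monom 1 (e - d) * w d a"
    have "?h \<in> ideal_span ?P B" using a monomP by (auto intro: ideal_span.intros)
    moreover have "Polynomial.degree ?h \<le> e"
      using degree_mult_le[of "Polynomial.monom 1 (e - d)" "w d a"] degree_monom_le[of "1::'a" "e - d"]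
        w[OF aL] d by linarith
    moreover have "Polynomial.coeff ?h e = a"
      using w[OF aL] d by (simp add: coeff_monom_mult)
    ultimately show ?case by blast
  next
    case (add a b)
    then obtain h k where "h \<in> ideal_span ?P B" "Polynomial.degree h \<le> e" "Polynomial.coeff h e = a"
      "k \<in> ideal_span ?P B" "Polynomial.degree k \<le> e" "Polynomial.coeff k e = b" by auto
    then show ?case
      by (intro bexI[of _ "h + k"]) (auto intro: ideal_span.add degree_add_le)
  next
    case (mult c a)
    then obtain h where h: "h \<in> ideal_span ?P B" "Polynomial.degree h \<le> e" "Polynomial.coeff h e = a" by auto
    have "[:c:] \<in> ?P" using mult(1) unital_subringD[OF S]
      by (auto simp: polys_over_def coeff_pCons split: nat.split)
    then have "[:c:] * h \<in> ideal_span ?P B" using h by (blast intro: ideal_span.mult)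
    then show ?case
      using h degree_smult_le[of c h] by (intro bexI[of _ "[:c:] * h"]) auto
  qed
  have main: "a \<in> I \<Longrightarrow> a \<in> ideal_span ?P B" for a
  proof (induction "Polynomial.degree a" arbitrary: a rule: less_induct)
    case less
    let ?e = "Polynomial.degree a"
    have "Polynomial.coeff a ?e \<in> ideal_span S (G' (min ?e n))"
    proof (cases "?e < n")
      case True
      have "Polynomial.coeff a ?e \<in> L ?e" using less.prems by (auto simp: L_def)
      then show ?thesis using True G(3) by (auto simp: G'_def min_def)
    next
      case False
      have "Polynomial.coeff a ?e \<in> L ?e" using less.prems by (auto simp: L_def)
      then show ?thesis using False H(3) by (auto simp: G'_def min_def)
    qed
    from lift[OF this, of ?e] obtain h where
      h: "h \<in> ideal_span ?P B" "Polynomial.degree h \<le> ?e" "Polynomial.coeff h ?e = Polynomial.coeff a ?e" by auto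
    have hI: "h \<in> I" using ideal_span_trans[OF h(1)] BI unfolding I_def by blast
    have sub: "a - h \<in> I"
      using less.prems hI ideal_span_uminus[OF P] ideal_span.add[of a ?P F "-h"] by (auto simp: I_def)
    have "a - h \<in> ideal_span ?P B"
    proof (cases "Polynomial.degree (a - h) < ?e")
      case True
      then show ?thesis using less.hyps sub by blast
    next
      case False
      have "Polynomial.degree (a - h) \<le> ?e" using h(2) by (intro degree_diff_le) auto
      with False have "Polynomial.degree (a - h) = ?e" by simp
      moreover have "Polynomial.coeff (a - h) ?e = 0" using h(3) by simp
      ultimately have "a - h = 0" by (metis leading_coeff_0_iff)
      then show ?thesis by (simp add: ideal_span.zero)
    qed
    from ideal_span.add[OF this h(1)] show ?case by simp
  qed
  \<comment> \<open>\<open>B\<close> lies in the ideal but need not lie in \<open>F\<close>; each of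
    its finitely many members involves finitely many elements of \<open>F\<close>.\<close>
  obtain F0 where F0: "F0 \<subseteq> F" "finite F0" "B \<subseteq> ideal_span ?P F0"
    using ideal_span_finite_support_set[OF finB, of ?P F] BI unfolding I_def by blast
  have "F \<subseteq> ideal_span ?P F0"
  proof
    fix a assume "a \<in> F"
    then have "a \<in> ideal_span ?P B" using main by (auto simp: I_def intro: ideal_span.base)
    then show "a \<in> ideal_span ?P F0" using ideal_span_trans F0(3) by blast
  qed
  with F0 show "\<exists>F0\<subseteq>F. finite F0 \<and> F \<subseteq> ideal_span ?P F0" by blast
qed

section \<open>Finitely generated rings of functions\<close>

definition adjoin :: "'r::comm_ring_1 set \<Rightarrow> 'r \<Rightarrow> 'r set" where
  "adjoin S t = (\<lambda>p. poly p t) ` polys_over S"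

lemma unital_subring_adjoin:
  assumes "unital_subring S"
  shows "unital_subring (adjoin S t)"
proof -
  note P = unital_subringD[OF unital_subring_polys_over[OF assms]]
  show ?thesis unfolding unital_subring_def adjoin_def
  proof (intro conjI ballI)
    show "1 \<in> (\<lambda>p. poly p t) ` polys_over S" by (rule image_eqI[OF _ P(1)]) simp
  next
    fix x y assume "x \<in> (\<lambda>p. poly p t) ` polys_over S" "y \<in> (\<lambda>p. poly p t) ` polys_over S"
    then obtain p q where pq: "p \<in> polys_over S" "q \<in> polys_over S" "x = poly p t" "y = poly q t"
      by auto
    show "x - y \<in> (\<lambda>p. poly p t) ` polys_over S"
      by (rule image_eqI[OF _ P(3)[OF pq(1,2)]]) (simp add: pq)
    show "x * y \<in> (\<lambda>p. poly p t) ` polys_over S"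
      by (rule image_eqI[OF _ P(4)[OF pq(1,2)]]) (simp add: pq)
  qed
qed

lemma adjoin_incl:
  assumes "unital_subring S"
  shows "S \<subseteq> adjoin S t" "t \<in> adjoin S t"
proof -
  note D = unital_subringD[OF assms]
  show "S \<subseteq> adjoin S t"
  proof
    fix s assume "s \<in> S"
    then have "[:s:] \<in> polys_over S" using D by (auto simp: polys_over_def coeff_pCons split: nat.split)
    then show "s \<in> adjoin S t" unfolding adjoin_def by (rule image_eqI[rotated]) simp
  qed
  have "[:0, 1:] \<in> polys_over S" using D by (auto simp: polys_over_def coeff_pCons split: nat.split)
  then show "t \<in> adjoin S t" unfolding adjoin_def by (rule image_eqI[rotated]) simp
qed

lemma noetherian_adjoin:
  assumes "unital_subring S" "noetherian S"
  shows "noetherian (adjoin S t)"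
  unfolding noetherian_def
proof (intro allI impI)
  fix F assume "F \<subseteq> adjoin S t"
  then obtain F' where F': "F' \<subseteq> polys_over S" "F = (\<lambda>p. poly p t) ` F'"
    unfolding adjoin_def by (meson subset_image_iff)
  obtain F0 where F0: "F0 \<subseteq> F'" "finite F0" "F' \<subseteq> ideal_span (polys_over S) F0"
    using noetherianE[OF hilbert_basis_polys_over[OF assms] F'(1)] .
  have "poly p t \<in> ideal_span (adjoin S t) ((\<lambda>p. poly p t) ` F0)"
    if "p \<in> ideal_span (polys_over S) F0" for p
    using that by induction (auto simp: adjoin_def intro: ideal_span.intros)
  then show "\<exists>F0\<subseteq>F. finite F0 \<and> F \<subseteq> ideal_span (adjoin S t) F0"
    using F0 F'(2) by (intro exI[of _ "(\<lambda>p. poly p t) ` F0"]) auto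
qed

definition const_funs :: "('x \<Rightarrow> 'a::field) set" where
  "const_funs = range (\<lambda>c _. c)"

lemma unital_subring_const_funs: "unital_subring const_funs"
  unfolding unital_subring_def const_funs_def
  by (auto simp: fun_eq_iff image_iff)

text \<open>The constant functions form a field: one nonzero member generates all the
  others.\<close>

lemma noetherian_const_funs: "noetherian (const_funs :: ('x \<Rightarrow> 'a::field) set)"
  unfolding noetherian_def
proof (intro allI impI)
  fix F :: "('x \<Rightarrow> 'a) set" assume F: "F \<subseteq> const_funs"
  show "\<exists>F0\<subseteq>F. finite F0 \<and> F \<subseteq> ideal_span const_funs F0"
  proof (cases "F \<subseteq> {0}")
    case True
    then show ?thesis by (intro exI[of _ "{}"]) (auto intro: ideal_span.zero)
  next
    case False
    then obtain c where c: "(\<lambda>_. c) \<in> F" "c \<noteq> 0"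
      using F unfolding const_funs_def by (auto simp: zero_fun_def)
    have "b \<in> ideal_span const_funs {\<lambda>_. c}" if "b \<in> F" for b
    proof -
      obtain b' where b: "b = (\<lambda>_. b')" using F \<open>b \<in> F\<close> unfolding const_funs_def by blast
      have "(\<lambda>_. b' / c) * (\<lambda>_. c) \<in> ideal_span (const_funs :: ('x \<Rightarrow> 'a) set) {\<lambda>_. c}"
        by (intro ideal_span.mult ideal_span.base) (auto simp: const_funs_def)
      also have "(\<lambda>_::'x. b' / c) * (\<lambda>_. c) = b" using c(2) b by (auto simp: fun_eq_iff)
      finally show ?thesis .
    qed
    then show ?thesis using c by (intro exI[of _ "{\<lambda>_. c}"]) auto
  qed
qed

text \<open>Starting from a field, the basis theorem is applied to each adjoined function; repeated
  adjunction stands in for a polynomial ring in several variables.\<close>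

lemma noetherian_function_ring:
  assumes "finite (T :: ('x \<Rightarrow> 'a::field) set)"
  shows "\<exists>A. unital_subring A \<and> noetherian A \<and> const_funs \<subseteq> A \<and> T \<subseteq> A"
  using assms
proof (induction T rule: finite_induct)
  case empty
  then show ?case using unital_subring_const_funs noetherian_const_funs by blast
next
  case (insert t T)
  then obtain A where "unital_subring A" "noetherian A" "const_funs \<subseteq> A" "T \<subseteq> A" by blast
  then show ?case
    using unital_subring_adjoin[of A t] noetherian_adjoin[of A t] adjoin_incl[of A t]
    by (intro exI[of _ "adjoin A t"]) auto
qed

text \<open>Functions in the ideal generated by \<open>T0\<close> vanish wherever \<open>T0\<close>
  does. This is the form in which quasi-compactness is applied to orbits.\<close>

lemma noetherian_finite_zero_set:
  assumes "noetherian (A :: ('x \<Rightarrow> 'a::field) set)" "T \<subseteq> A"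
  obtains T0 where "T0 \<subseteq> T" "finite T0" "\<And>z. (\<forall>g\<in>T0. g z = 0) \<Longrightarrow> (\<forall>g\<in>T. g z = 0)"
proof -
  obtain T0 where T0: "T0 \<subseteq> T" "finite T0" "T \<subseteq> ideal_span A T0"
    using noetherianE[OF assms] .
  have vanish: "g z = 0" if "g \<in> ideal_span A T0" "\<forall>g\<in>T0. g z = 0" for g z
    using that(1) by induction (use that(2) in auto)
  show ?thesis by (rule that[OF T0(1,2)]) (use vanish T0(3) in blast)
qed


section \<open>Rational maps on quasi-projective varieties\<close>

lemma mpol_eval_superset:
  assumes "finite A" "Poly_Mapping.keys p \<subseteq> A"
  shows "mpol_eval p x = (\<Sum>m\<in>A. Poly_Mapping.lookup p m * (\<Prod>i\<in>UNIV. (x $ i) ^ Poly_Mapping.lookup m i))"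
  unfolding mpol_eval_def
  by (rule sum.mono_neutral_left) (use assms in \<open>auto simp: in_keys_iff\<close>)

lemma mpol_eval_0 [simp]: "mpol_eval 0 x = 0"
  by (simp add: mpol_eval_def)

lemma mpol_eval_add: "mpol_eval (p + q) x = mpol_eval p x + mpol_eval q x"
proof -
  let ?A = "Poly_Mapping.keys p \<union> Poly_Mapping.keys q"
  have "mpol_eval r x = (\<Sum>m\<in>?A. Poly_Mapping.lookup r m * (\<Prod>i\<in>UNIV. (x $ i) ^ Poly_Mapping.lookup m i))"
    if "r \<in> {p, q, p + q}" for r
    using that by (intro mpol_eval_superset) (auto dest: subsetD[OF Poly_Mapping.keys_add])
  then show ?thesis by (simp add: lookup_add algebra_simps sum.distrib)
qed

lemma mpol_eval_diff:
  fixes p q :: "('a::comm_ring_1, 'n::finite) mpol"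
  shows "mpol_eval (p - q) x = mpol_eval p x - mpol_eval q x"
  using mpol_eval_add[of "p - q" q x] by simp

lemma mpol_eval_sum: "mpol_eval (sum g A) x = (\<Sum>i\<in>A. mpol_eval (g i) x)"
  by (induction A rule: infinite_finite_induct) (auto simp: mpol_eval_add)

lemma mpol_eval_single:
  "mpol_eval (Poly_Mapping.single m c) x = c * (\<Prod>i\<in>UNIV. (x $ i) ^ Poly_Mapping.lookup m i)"
  by (subst mpol_eval_superset[of "{m}"]) auto

lemma poly_mapping_as_sum_single:
  "p = (\<Sum>m\<in>Poly_Mapping.keys p. Poly_Mapping.single m (Poly_Mapping.lookup p m))"
  by (rule poly_mapping_eqI)
    (auto simp: lookup_sum lookup_single when_def in_keys_iff sum.delta)

lemma mpol_eval_mult: "mpol_eval (p * q) x = mpol_eval p x * mpol_eval q x"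
proof -
  have 1: "mpol_eval (Poly_Mapping.single m c * Poly_Mapping.single n d) x =
      mpol_eval (Poly_Mapping.single m c) x * mpol_eval (Poly_Mapping.single n d) x" for m n c d
    by (simp add: mult_single mpol_eval_single lookup_add power_add prod.distrib algebra_simps)
  show ?thesis
    by (subst (1 2) poly_mapping_as_sum_single, subst (3) poly_mapping_as_sum_single[of p],
        subst (3) poly_mapping_as_sum_single[of q])
       (simp add: sum_product mpol_eval_sum 1)
qed

lemma homogeneous_mult:
  assumes "homogeneous d p" "homogeneous e q"
  shows "homogeneous (d + e) (p * q)"
  unfolding homogeneous_def
proof
  fix m assume "m \<in> Poly_Mapping.keys (p * q)"
  then obtain a b where "m = a + b" "a \<in> Poly_Mapping.keys p" "b \<in> Poly_Mapping.keys q"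
    using keys_mult[of p q] by blast
  then show "(\<Sum>i\<in>UNIV. Poly_Mapping.lookup m i) = d + e"
    using assms by (simp add: homogeneous_def lookup_add sum.distrib)
qed

lemma homogeneous_diff:
  fixes p q :: "('a::comm_ring_1, 'n::finite) mpol"
  assumes "homogeneous d p" "homogeneous d q"
  shows "homogeneous d (p - q)"
  unfolding homogeneous_def
proof
  fix m assume "m \<in> Poly_Mapping.keys (p - q)"
  then have "m \<in> Poly_Mapping.keys p \<or> m \<in> Poly_Mapping.keys q"
    by (auto simp: in_keys_iff lookup_minus)
  then show "(\<Sum>i\<in>UNIV. Poly_Mapping.lookup m i) = d"
    using assms by (auto simp: homogeneous_def)
qed

lemma mpol_eval_scale:
  fixes x :: "'a::field ^ 'n::finite"
  assumes "homogeneous d p"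
  shows "mpol_eval p (c *s x) = c ^ d * mpol_eval p x"
proof -
  have "(\<Prod>i\<in>UNIV. ((c *s x) $ i) ^ Poly_Mapping.lookup m i) =
      c ^ d * (\<Prod>i\<in>UNIV. (x $ i) ^ Poly_Mapping.lookup m i)" if "m \<in> Poly_Mapping.keys p" for m
    using assms that by (simp add: power_mult_distrib prod.distrib power_sum[symmetric] homogeneous_def)
  then show ?thesis unfolding mpol_eval_def sum_distrib_left
    by (intro sum.cong) (auto simp: algebra_simps)
qed

section \<open>Points and homogeneous coordinates\<close>

lemma proj_rel_sym:
  assumes "y = c *s x" "x \<noteq> 0" "y \<noteq> (0::'a::field ^ 'n::finite)"
  shows "c \<noteq> 0" "x = inverse c *s y"
proof -
  show "c \<noteq> 0" using assms by auto
  then show "x = inverse c *s y" using assms(1) by (simp add: Finite_Cartesian_Product.vec_eq_iff)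
qed

lemma equiv_proj_rel: "equiv {x. x \<noteq> 0} (proj_rel :: (('a::field ^ 'n::finite) \<times> ('a ^ 'n)) set)"
proof (rule equivI)
  show "proj_rel \<subseteq> {x::'a^'n. x \<noteq> 0} \<times> {x. x \<noteq> 0}" by (auto simp: proj_rel_def)
  show "refl_on {x. x \<noteq> 0} (proj_rel :: (('a ^ 'n) \<times> ('a ^ 'n)) set)"
    unfolding refl_on_def proj_rel_def by (auto intro!: exI[of _ 1])
  show "sym (proj_rel :: (('a ^ 'n) \<times> ('a ^ 'n)) set)"
    unfolding proj_rel_def by (intro symI) (use proj_rel_sym(2) in blast)
  show "trans (proj_rel :: (('a ^ 'n) \<times> ('a ^ 'n)) set)"
    unfolding proj_rel_def by (intro transI) (auto simp: vector_smult_assoc)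
qed

lemma proj_point_in_space: "x \<noteq> 0 \<Longrightarrow> proj_point x \<in> proj_space"
  unfolding proj_space_def proj_point_def by (simp add: quotientI)

lemma proj_point_self: "x \<noteq> 0 \<Longrightarrow> x \<in> proj_point x"
  unfolding proj_point_def using equiv_class_self[OF equiv_proj_rel] by blast

lemma proj_space_rep:
  assumes "P \<in> proj_space" "x \<in> P"
  shows "x \<noteq> 0" "P = proj_point x"
proof -
  obtain y where y: "P = proj_rel `` {y}" "y \<noteq> 0"
    using assms(1) unfolding proj_space_def by (elim quotientE) auto
  then have yx: "(y, x) \<in> proj_rel" using assms(2) by auto
  then show "x \<noteq> 0" by (auto simp: proj_rel_def)
  show "P = proj_point x"
    using y(1) equiv_class_eq[OF equiv_proj_rel yx] by (simp add: proj_point_def)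
qed

lemma proj_space_nonempty: "P \<in> proj_space \<Longrightarrow> \<exists>x. x \<in> P"
  unfolding proj_space_def using equiv_class_self[OF equiv_proj_rel] by (elim quotientE) blast

lemma proj_space_scale:
  assumes "P \<in> proj_space" "x \<in> P" "y \<in> P"
  shows "\<exists>c. c \<noteq> 0 \<and> y = c *s x"
proof -
  have "P = proj_point x" "x \<noteq> 0" "y \<noteq> 0" using proj_space_rep assms by auto
  then obtain c where "y = c *s x" using assms(3) by (auto simp: proj_point_def proj_rel_def)
  then show ?thesis using \<open>y \<noteq> 0\<close> by auto
qed

lemma homogeneous_nonzero_rep_indep:
  assumes "homogeneous d p" "P \<in> proj_space" "x \<in> P" "y \<in> P" "mpol_eval p x \<noteq> 0"
  shows "mpol_eval p y \<noteq> 0"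
  using proj_space_scale[OF assms(2,3,4)] mpol_eval_scale[OF assms(1)] assms(5) by auto

text \<open>The 2x2 minors express proportionality without division, so that coincidence of points
  becomes a polynomial condition on homogeneous coordinates.\<close>

lemma proj_point_eq_iff:
  fixes u w :: "'a::field ^ 'm::finite"
  assumes "u \<noteq> 0" "w \<noteq> 0"
  shows "proj_point u = proj_point w \<longleftrightarrow> (\<forall>i j. u $ i * w $ j = u $ j * w $ i)"
proof
  assume "proj_point u = proj_point w"
  then have "w \<in> proj_point u" using proj_point_self assms by auto
  then obtain c where "w = c *s u" by (auto simp: proj_point_def proj_rel_def)
  then show "\<forall>i j. u $ i * w $ j = u $ j * w $ i" by simp
next
  assume *: "\<forall>i j. u $ i * w $ j = u $ j * w $ i"
  obtain i where i: "u $ i \<noteq> 0" using assms(1) by (auto simp: Finite_Cartesian_Product.vec_eq_iff)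
  define c where "c = (w $ i) / (u $ i)"
  have "w $ j = c * u $ j" for j
    using *[rule_format, of i j] i by (simp add: c_def field_simps)
  then have "\<exists>c. w = c *s u" by (intro exI[of _ c]) (simp add: Finite_Cartesian_Product.vec_eq_iff)
  then have "(u, w) \<in> proj_rel" using assms by (simp add: proj_rel_def)
  then show "proj_point u = proj_point w"
    unfolding proj_point_def by (rule equiv_class_eq[OF equiv_proj_rel])
qed

text \<open>Products of equations cut out the union. A point outside both sets may be witnessed by
  two different coordinate vectors; homogeneity moves both witnesses to the same vector.\<close>

lemma zariski_closed_Un:
  fixes A B :: "('a::field, 'n::finite) ppoint set"
  assumes "zariski_closed A" "zariski_closed B"
  shows "zariski_closed (A \<union> B)"
proof -
  obtain S where S: "\<forall>p\<in>S. \<exists>d. homogeneous d p"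
    "A = {P \<in> proj_space. \<forall>p\<in>S. \<forall>x\<in>P. mpol_eval p x = 0}"
    using assms(1) unfolding zariski_closed_def by blast
  obtain T where T: "\<forall>p\<in>T. \<exists>d. homogeneous d p"
    "B = {P \<in> proj_space. \<forall>p\<in>T. \<forall>x\<in>P. mpol_eval p x = 0}"
    using assms(2) unfolding zariski_closed_def by blast
  let ?U = "{p * q |p q. p \<in> S \<and> q \<in> T}"
  have "\<forall>r\<in>?U. \<exists>d. homogeneous d r" using S(1) T(1) homogeneous_mult by blast
  moreover have "A \<union> B = {P \<in> proj_space. \<forall>r\<in>?U. \<forall>x\<in>P. mpol_eval r x = 0}" (is "_ = ?C")
  proof
    show "A \<union> B \<subseteq> ?C" unfolding S(2) T(2) by (auto simp: mpol_eval_mult)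
    show "?C \<subseteq> A \<union> B"
    proof
      fix P assume P: "P \<in> ?C"
      show "P \<in> A \<union> B"
      proof (rule ccontr)
        assume "P \<notin> A \<union> B"
        then obtain p q x y where *: "p \<in> S" "x \<in> P" "mpol_eval p x \<noteq> 0"
          "q \<in> T" "y \<in> P" "mpol_eval q y \<noteq> 0"
          using P unfolding S(2) T(2) by blast
        then have "mpol_eval q x \<noteq> 0"
          using T(1) homogeneous_nonzero_rep_indep P by blast
        then have "mpol_eval (p * q) x \<noteq> 0" using * by (simp add: mpol_eval_mult)
        moreover have "p * q \<in> ?U" using * by blast
        ultimately show False using P * by blast
      qed
    qed
  qed
  ultimately show ?thesis unfolding zariski_closed_def by blast
qed

lemma zariski_closed_hypersurface:
  "homogeneous d p \<Longrightarrow> zariski_closed {P \<in> proj_space. \<forall>x\<in>P. mpol_eval p x = 0}"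
  unfolding zariski_closed_def by (rule exI[of _ "{p}"]) auto

text \<open>Principal open sets form a basis of the topology: one form is enough to test membership
  in a neighbourhood.\<close>

lemma not_in_zariski_closed:
  assumes "zariski_closed Z" "P \<in> proj_space" "P \<notin> Z"
  obtains d p where "homogeneous d p" "\<And>x. x \<in> P \<Longrightarrow> mpol_eval p x \<noteq> 0"
    "\<And>Q x. x \<in> Q \<Longrightarrow> mpol_eval p x \<noteq> 0 \<Longrightarrow> Q \<notin> Z"
proof -
  obtain S where S: "\<forall>p\<in>S. \<exists>d. homogeneous d p"
    "Z = {P \<in> proj_space. \<forall>p\<in>S. \<forall>x\<in>P. mpol_eval p x = 0}"
    using assms(1) unfolding zariski_closed_def by blast
  then obtain p x where p: "p \<in> S" "x \<in> P" "mpol_eval p x \<noteq> 0" using assms by blast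
  obtain d where d: "homogeneous d p" using S p by blast
  show ?thesis
  proof (rule that[OF d])
    show "mpol_eval p y \<noteq> 0" if "y \<in> P" for y
      using homogeneous_nonzero_rep_indep[OF d assms(2) p(2) that p(3)] .
    show "Q \<notin> Z" if "x \<in> Q" "mpol_eval p x \<noteq> 0" for Q x
      using that p(1) unfolding S(2) by blast
  qed
qed

section \<open>Irreducibility and charts of rational maps\<close>

lemma quasi_projective_subset:
  assumes "quasi_projective_variety V"
  shows "V \<subseteq> proj_space"
proof -
  obtain Z Z' where "zariski_closed Z" "V = Z - Z'"
    using assms unfolding quasi_projective_variety_def projective_variety_def zariski_open_in_def
    by blast
  then show ?thesis unfolding zariski_closed_def by blast
qed

text \<open>Irreducibility passes from the closed set \<open>Z\<close> to its open part: the removed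
  set \<open>Z'\<close> is absorbed into one of the two closed sets, and
  \<open>Z \<subseteq> Z'\<close> is excluded because \<open>V\<close> is nonempty.\<close>

lemma quasi_projective_irreducible:
  assumes V: "quasi_projective_variety V" and AB: "zariski_closed A" "zariski_closed B" "V \<subseteq> A \<union> B"
  shows "V \<subseteq> A \<or> V \<subseteq> B"
proof -
  obtain Z Z' where Z: "projective_variety Z" "zariski_closed Z'" "V = Z - Z'" "V \<noteq> {}"
    using V unfolding quasi_projective_variety_def zariski_open_in_def by blast
  have irr: "Z \<subseteq> C \<or> Z \<subseteq> D" if "zariski_closed C" "zariski_closed D" "Z \<subseteq> C \<union> D" for C D
    using Z(1) that unfolding projective_variety_def zariski_irreducible_def by blast
  have "Z \<subseteq> A \<union> (B \<union> Z')" using AB(3) Z(3) by blast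
  then have "Z \<subseteq> A \<or> Z \<subseteq> B \<union> Z'" using irr AB zariski_closed_Un[OF AB(2) Z(2)] by blast
  then show ?thesis using irr[OF AB(2) Z(2)] Z by blast
qed

text \<open>\<open>morphism\<close> gives a chart that is open in the domain of
  \<open>\<phi>\<close>, itself open in \<open>V\<close>; uniting the two complements gives a chart
  described by one closed set relative to \<open>V\<close>.\<close>

lemma morphism_local:
  fixes V :: "('a::field, 'n::finite) ppoint set" and \<phi> :: "('a, 'n) ppoint \<rightharpoonup> ('a, 'm::finite) ppoint"
  assumes "\<phi> \<in> rational_map_reps V Y" "P \<in> dom \<phi>"
  obtains Z d F where "zariski_closed Z" "P \<notin> Z" "V - Z \<subseteq> dom \<phi>" "\<And>j. homogeneous d (F j)"
    "\<And>Q x. Q \<in> V - Z \<Longrightarrow> x \<in> Q \<Longrightarrow> (\<chi> j. mpol_eval (F j) x) \<noteq> 0 \<and>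
        \<phi> Q = Some (proj_point (\<chi> j. mpol_eval (F j) x))"
proof -
  obtain U where U: "zariski_open_in V U" "morphism U Y \<phi>"
    using assms(1) unfolding rational_map_reps_def by blast
  have PU: "P \<in> U" using U(2) assms(2) unfolding morphism_def by blast
  then obtain W d F where W: "zariski_open_in U W" "P \<in> W" "\<forall>j. homogeneous d (F j)"
    "\<forall>Q\<in>W. \<forall>x\<in>Q. (\<chi> j. mpol_eval (F j) x) \<noteq> 0 \<and> \<phi> Q = Some (proj_point (\<chi> j. mpol_eval (F j) x))"
    using U(2) unfolding morphism_def by blast
  obtain A B where AB: "zariski_closed A" "U = V - A" "zariski_closed B" "W = U - B"
    using U(1) W(1) unfolding zariski_open_in_def by blast
  have "V - (A \<union> B) = W" using AB by blast
  show ?thesis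
  proof (rule that[OF zariski_closed_Un[OF AB(1,3)]])
    show "P \<notin> A \<union> B" using W(2) AB by blast
    show "V - (A \<union> B) \<subseteq> dom \<phi>" using AB U(2) unfolding morphism_def by blast
    show "homogeneous d (F j)" for j using W(3) by blast
    show "(\<chi> j. mpol_eval (F j) x) \<noteq> 0 \<and> \<phi> Q = Some (proj_point (\<chi> j. mpol_eval (F j) x))"
      if "Q \<in> V - (A \<union> B)" "x \<in> Q" for Q x
      using that W(4) \<open>V - (A \<union> B) = W\<close> by blast
  qed
qed

lemma rational_map_rep_dom:
  assumes "\<phi> \<in> rational_map_reps V Y"
  obtains A where "zariski_closed A" "dom \<phi> = V - A" "dom \<phi> \<noteq> {}" "ran \<phi> \<subseteq> Y"
proof -
  obtain U where U: "zariski_open_in V U" "U \<noteq> {}" "morphism U Y \<phi>"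
    using assms unfolding rational_map_reps_def by blast
  obtain A where "zariski_closed A" "U = V - A" using U(1) unfolding zariski_open_in_def by blast
  then show ?thesis using that U(2,3) unfolding morphism_def by simp
qed

text \<open>Two representatives agreeing with a third one agree everywhere, because the locus where they
  differ is open and irreducibility makes it meet the domain of the third.\<close>

lemma rational_map_reps_agree:
  fixes V :: "('a::field, 'n::finite) ppoint set" and g :: "('a, 'n, 'm::finite) rat_map"
  assumes V: "quasi_projective_variety V" and g: "g \<in> rational_maps V Y"
    and "\<phi> \<in> g" "\<psi> \<in> g" "P \<in> dom \<phi>" "P \<in> dom \<psi>"
  shows "\<phi> P = \<psi> P"
proof (rule ccontr)
  assume neq: "\<phi> P \<noteq> \<psi> P"
  obtain \<phi>0 where g_eq: "g = rational_map_rel V Y `` {\<phi>0}" "\<phi>0 \<in> rational_map_reps V Y"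
    using g unfolding rational_maps_def by (elim quotientE)
  have r: "\<phi> \<in> rational_map_reps V Y" "\<psi> \<in> rational_map_reps V Y"
    "\<And>Q. Q \<in> dom \<phi>0 \<Longrightarrow> Q \<in> dom \<phi> \<Longrightarrow> \<phi>0 Q = \<phi> Q" "\<And>Q. Q \<in> dom \<phi>0 \<Longrightarrow> Q \<in> dom \<psi> \<Longrightarrow> \<phi>0 Q = \<psi> Q"
    using assms(3,4) unfolding g_eq rational_map_rel_def by auto
  obtain A d F where A: "zariski_closed A" "P \<notin> A" "V - A \<subseteq> dom \<phi>" "\<And>j. homogeneous d (F j)"
    "\<And>Q x. Q \<in> V - A \<Longrightarrow> x \<in> Q \<Longrightarrow> (\<chi> j. mpol_eval (F j) x) \<noteq> 0 \<and>
        \<phi> Q = Some (proj_point (\<chi> j. mpol_eval (F j) x))"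
    using morphism_local[OF r(1) assms(5)] by metis
  obtain B e G where B: "zariski_closed B" "P \<notin> B" "V - B \<subseteq> dom \<psi>" "\<And>j. homogeneous e (G j)"
    "\<And>Q x. Q \<in> V - B \<Longrightarrow> x \<in> Q \<Longrightarrow> (\<chi> j. mpol_eval (G j) x) \<noteq> 0 \<and>
        \<psi> Q = Some (proj_point (\<chi> j. mpol_eval (G j) x))"
    using morphism_local[OF r(2) assms(6)] by metis
  obtain C where C: "zariski_closed C" "dom \<phi>0 = V - C" "dom \<phi>0 \<noteq> {}"
    using rational_map_rep_dom[OF g_eq(2)] by metis
  obtain A' where "dom \<phi> = V - A'" by (rule rational_map_rep_dom[OF r(1)])
  then have PV: "P \<in> V" using assms(5) by blast
  then have PS: "P \<in> proj_space" using quasi_projective_subset[OF V] by blast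
  then obtain x where x: "x \<in> P" using proj_space_nonempty by blast
  have PAB: "P \<in> V - A" "P \<in> V - B" using PV A B by auto
  let ?F = "\<lambda>x. \<chi> j. mpol_eval (F j) x" and ?G = "\<lambda>x. \<chi> j. mpol_eval (G j) x"
  have "proj_point (?F x) \<noteq> proj_point (?G x)"
    using A(5)[OF PAB(1) x] B(5)[OF PAB(2) x] neq by auto
  then obtain i j where ij: "?F x $ i * ?G x $ j \<noteq> ?F x $ j * ?G x $ i"
    using proj_point_eq_iff A(5)[OF PAB(1) x] B(5)[OF PAB(2) x] by blast
  \<comment> \<open>A minor that separates the two values at \<open>P\<close>. It vanishes wherever
    both charts meet the domain of \<open>\<phi>0\<close>, because there both maps equal
    \<open>\<phi>0\<close>.\<close>
  define M where "M = F i * G j - F j * G i"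
  have M: "homogeneous (d + e) M" "mpol_eval M y = ?F y $ i * ?G y $ j - ?F y $ j * ?G y $ i" for y
    unfolding M_def using A(4) B(4)
    by (auto intro!: homogeneous_diff homogeneous_mult simp: mpol_eval_diff mpol_eval_mult)
  let ?D = "{P \<in> proj_space. \<forall>x\<in>P. mpol_eval M x = 0}"
  have D: "zariski_closed ?D" by (rule zariski_closed_hypersurface[OF M(1)])
  have "V \<subseteq> C \<union> (A \<union> B \<union> ?D)"
  proof
    fix Q assume Q: "Q \<in> V"
    show "Q \<in> C \<union> (A \<union> B \<union> ?D)"
    proof (cases "Q \<in> A \<union> B \<union> C")
      case False
      then have QQ: "Q \<in> V - A" "Q \<in> V - B" "Q \<in> dom \<phi>0" using Q C by auto
      have "\<phi>0 Q = \<phi> Q" using r(3)[OF QQ(3)] A(3) QQ(1) by blast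
      moreover have "\<phi>0 Q = \<psi> Q" using r(4)[OF QQ(3)] B(3) QQ(2) by blast
      ultimately have "\<phi> Q = \<psi> Q" by simp
      then have "mpol_eval M y = 0" if "y \<in> Q" for y
        using A(5)[OF QQ(1) that] B(5)[OF QQ(2) that] proj_point_eq_iff[of "?F y" "?G y"]
        unfolding M(2) by auto
      then show ?thesis using Q quasi_projective_subset[OF V] by blast
    qed auto
  qed
  from quasi_projective_irreducible[OF V C(1) zariski_closed_Un[OF zariski_closed_Un[OF A(1) B(1)] D] this]
  have "V \<subseteq> C \<or> V \<subseteq> A \<union> B \<union> ?D" .
  moreover have "\<not> V \<subseteq> C" using C by blast
  moreover have "mpol_eval M x \<noteq> 0" using ij unfolding M(2) by simp
  then have "P \<notin> A \<union> B \<union> ?D" using A(2) B(2) x by blast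
  ultimately show False using PV by blast
qed

text \<open>Agreement of representatives gives the definite description in \<open>rat_app\<close> a
  meaning, whichever representative is used.\<close>

lemma rat_app_eq:
  fixes V :: "('a::field, 'n::finite) ppoint set" and g :: "('a, 'n, 'm::finite) rat_map"
  assumes V: "quasi_projective_variety V" and g: "g \<in> rational_maps V Y"
    and \<phi>: "\<phi> \<in> g" "\<phi> P = Some R"
  shows "rat_app g P = R"
  unfolding rat_app_def
proof (rule the_equality)
  show "\<exists>\<phi>\<in>g. \<phi> P = Some R" using \<phi> by blast
  fix R' assume "\<exists>\<phi>\<in>g. \<phi> P = Some R'"
  then obtain \<psi> where \<psi>: "\<psi> \<in> g" "\<psi> P = Some R'" by blast
  then show "R' = R" using rational_map_reps_agree[OF V g \<phi>(1) \<psi>(1), of P] \<phi>(2) by auto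
qed

text \<open>Refines a chart to the locus where a single form \<open>q\<close> is nonzero, so that
  staying in the chart is itself a polynomial condition; the same \<open>F\<close> describes
  \<open>g\<close> on all of that locus.\<close>

lemma rat_app_local:
  fixes V :: "('a::field, 'n::finite) ppoint set" and g :: "('a, 'n, 'm::finite) rat_map"
  assumes V: "quasi_projective_variety V" and g: "g \<in> rational_maps V Y"
    and P: "P \<in> V" "P \<notin> indeterminacy V g"
  obtains e q d F where "homogeneous e q" "\<And>x. x \<in> P \<Longrightarrow> mpol_eval q x \<noteq> 0"
    "\<And>j. homogeneous d (F j)"
    "\<And>Q x. Q \<in> V \<Longrightarrow> x \<in> Q \<Longrightarrow> mpol_eval q x \<noteq> 0 \<Longrightarrow>
       (\<chi> j. mpol_eval (F j) x) \<noteq> 0 \<and> rat_app g Q = proj_point (\<chi> j. mpol_eval (F j) x)"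
proof -
  obtain \<phi> where \<phi>: "\<phi> \<in> g" "P \<in> dom \<phi>" using P unfolding indeterminacy_def by blast
  have rep: "\<phi> \<in> rational_map_reps V Y"
    using g \<phi>(1) unfolding rational_maps_def by (elim quotientE) (auto simp: rational_map_rel_def)
  obtain Z d F where Z: "zariski_closed Z" "P \<notin> Z" "V - Z \<subseteq> dom \<phi>" "\<And>j. homogeneous d (F j)"
    "\<And>Q x. Q \<in> V - Z \<Longrightarrow> x \<in> Q \<Longrightarrow> (\<chi> j. mpol_eval (F j) x) \<noteq> 0 \<and>
        \<phi> Q = Some (proj_point (\<chi> j. mpol_eval (F j) x))"
    using morphism_local[OF rep \<phi>(2)] by metis
  have PS: "P \<in> proj_space" using P quasi_projective_subset[OF V] by blast
  obtain e q where q: "homogeneous e q" "\<And>x. x \<in> P \<Longrightarrow> mpol_eval q x \<noteq> 0"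
    "\<And>Q x. x \<in> Q \<Longrightarrow> mpol_eval q x \<noteq> 0 \<Longrightarrow> Q \<notin> Z"
    using not_in_zariski_closed[OF Z(1) PS Z(2)] by metis
  show ?thesis
  proof (rule that[OF q(1,2) Z(4)])
    fix Q x assume "Q \<in> V" "x \<in> Q" "mpol_eval q x \<noteq> 0"
    then have Q: "Q \<in> V - Z" using q(3) by blast
    show "(\<chi> j. mpol_eval (F j) x) \<noteq> 0 \<and> rat_app g Q = proj_point (\<chi> j. mpol_eval (F j) x)"
      using Z(5)[OF Q \<open>x \<in> Q\<close>] rat_app_eq[OF V g \<phi>(1)] by blast
  qed
qed

lemma rat_app_in_target:
  fixes V :: "('a::field, 'n::finite) ppoint set" and g :: "('a, 'n, 'm::finite) rat_map"
  assumes V: "quasi_projective_variety V" and g: "g \<in> rational_maps V Y"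
    and P: "P \<in> V" "P \<notin> indeterminacy V g"
  shows "rat_app g P \<in> Y"
proof -
  obtain \<phi> where \<phi>: "\<phi> \<in> g" "P \<in> dom \<phi>" using P unfolding indeterminacy_def by blast
  have rep: "\<phi> \<in> rational_map_reps V Y"
    using g \<phi>(1) unfolding rational_maps_def by (elim quotientE) (auto simp: rational_map_rel_def)
  obtain R where R: "\<phi> P = Some R" using \<phi> by blast
  have "rat_app g P = R" by (rule rat_app_eq[OF V g \<phi>(1) R])
  moreover have "ran \<phi> \<subseteq> Y" by (rule rational_map_rep_dom[OF rep])
  ultimately show ?thesis using R by (auto simp: ran_def)
qed


section \<open>Orbits of rational maps\<close>

text \<open>The hypothesis on \<open>E\<close> says that each \<open>E i\<close> is closed for the
  topology defined by \<open>A\<close>. The functions vanishing on some finite intersection of the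
  \<open>E i\<close> are controlled by finitely many among them, and these involve only finitely
  many indices.\<close>

lemma noetherian_chain_stabilizes:
  fixes A :: "('z \<Rightarrow> 'a::field) set"
  assumes A: "noetherian A"
    and E: "\<And>i z. z \<notin> E i \<Longrightarrow> \<exists>h\<in>A. h z \<noteq> 0 \<and> (\<forall>z'\<in>E i. h z' = 0)"
  shows "\<exists>k::nat. \<forall>z. (\<forall>i<k. z \<in> E i) \<longrightarrow> (\<forall>i. z \<in> E i)"
proof -
  define T where "T = {h \<in> A. \<exists>k. \<forall>z. (\<forall>i<k. z \<in> E i) \<longrightarrow> h z = 0}"
  have "T \<subseteq> A" by (auto simp: T_def)
  then obtain T0 where T0: "T0 \<subseteq> T" "finite T0" "\<And>z. (\<forall>g\<in>T0. g z = 0) \<Longrightarrow> (\<forall>g\<in>T. g z = 0)"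
    using noetherian_finite_zero_set[OF A] by metis
  have "\<forall>h\<in>T0. \<exists>k. \<forall>z. (\<forall>i<k. z \<in> E i) \<longrightarrow> h z = 0" using T0(1) by (auto simp: T_def)
  then obtain kk where kk: "\<And>h z. h \<in> T0 \<Longrightarrow> (\<forall>i<kk h. z \<in> E i) \<Longrightarrow> h z = 0" by metis
  define k where "k = Max (insert 0 (kk ` T0))"
  have kle: "kk h \<le> k" if "h \<in> T0" for h
    unfolding k_def using T0(2) that by (intro Max_ge) auto
  show ?thesis
  proof (intro exI[of _ k] allI impI)
    fix z j assume z: "\<forall>i<k. z \<in> E i"
    have "\<forall>g\<in>T0. g z = 0"
    proof
      fix g assume g: "g \<in> T0"
      show "g z = 0" using kk[OF g] kle[OF g] z by (meson order_less_le_trans)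
    qed
    then have T: "\<forall>g\<in>T. g z = 0" by (rule T0(3))
    show "z \<in> E j"
    proof (rule ccontr)
      assume "z \<notin> E j"
      then obtain h where h: "h \<in> A" "h z \<noteq> 0" "\<forall>z'\<in>E j. h z' = 0" using E by blast
      \<comment> \<open>\<open>Suc j\<close> and not \<open>j\<close>: the finite intersection has
        to include \<open>E j\<close> itself.\<close>
      have "\<forall>z. (\<forall>i<Suc j. z \<in> E i) \<longrightarrow> h z = 0" using h(3) by auto
      then have "h \<in> T" unfolding T_def using h(1) by blast
      with T h(2) show False by blast
    qed
  qed
qed

section \<open>Substitution of functions into polynomials\<close>

lemma fun_subring_closed:
  fixes S :: "('z \<Rightarrow> 'a::field) set"
  assumes S: "unital_subring S" and C: "const_funs \<subseteq> S"
  shows "(\<lambda>_. c) \<in> S"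
    and "g \<in> S \<Longrightarrow> h \<in> S \<Longrightarrow> (\<lambda>z. g z * h z) \<in> S"
    and "g \<in> S \<Longrightarrow> h \<in> S \<Longrightarrow> (\<lambda>z. g z - h z) \<in> S"
    and "g \<in> S \<Longrightarrow> h \<in> S \<Longrightarrow> (\<lambda>z. g z + h z) \<in> S"
  using C unital_subringD[OF S]
  by (auto simp: const_funs_def plus_fun_def times_fun_def fun_diff_def)

lemma fun_subring_mpol_eval:
  fixes S :: "('z \<Rightarrow> 'a::field) set" and q :: "('a, 'n::finite) mpol"
  assumes S: "unital_subring S" "const_funs \<subseteq> S" and G: "\<And>k. G k \<in> S"
  shows "(\<lambda>z. mpol_eval q (\<chi> k. G k z)) \<in> S"
proof -
  note cl = fun_subring_closed[OF S]
  have pow: "(\<lambda>z. G k z ^ e) \<in> S" for k e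
    by (induction e) (auto intro: cl G)
  have prod: "(\<lambda>z. \<Prod>k\<in>B. G k z ^ e k) \<in> S" for e and B :: "'n set"
    by (induction B rule: infinite_finite_induct) (auto intro: cl pow)
  have "(\<lambda>z. \<Sum>m\<in>B. Poly_Mapping.lookup q m * (\<Prod>k\<in>UNIV. G k z ^ Poly_Mapping.lookup m k)) \<in> S" for B
    by (induction B rule: infinite_finite_induct) (auto intro!: cl prod)
  then show ?thesis unfolding mpol_eval_def by simp
qed

lemma subring_mpol_eval:
  fixes z :: "'a::comm_ring_1 ^ 'n::finite"
  assumes K: "unital_subring K" and q: "\<And>m. Poly_Mapping.lookup q m \<in> K" and z: "\<And>i. z $ i \<in> K"
  shows "mpol_eval q z \<in> K"
  unfolding mpol_eval_def
  by (intro unital_subring_sum[OF K] unital_subringD(4)[OF K] unital_subring_prod[OF K]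
      unital_subring_power[OF K] q z)

locale rational_orbit =
  fixes V :: "('a::field, 'n::finite) ppoint set"
    and \<Phi> :: "('a, 'n, 'n) rat_map"
    and Orb :: "nat \<Rightarrow> ('a, 'n) ppoint"
  assumes V: "quasi_projective_variety V"
    and \<Phi>: "\<Phi> \<in> rational_maps V V"
    and Orb_in: "Orb n \<in> V"
    and Orb_defined: "Orb n \<notin> indeterminacy V \<Phi>"
    and Orb_Suc: "Orb (Suc n) = rat_app \<Phi> (Orb n)"
begin

lemma Orb_proj: "Orb n \<in> proj_space"
  using Orb_in quasi_projective_subset[OF V] by blast

text \<open>Coordinates depend on this arbitrary choice, so functions built from them live on the
  indices \<open>n\<close>. This gives a ring of genuine functions although forms have no values at
  projective points.\<close>

definition rep :: "nat \<Rightarrow> 'a ^ 'n" where "rep n = (SOME y. y \<in> Orb n)"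

lemma rep_in: "rep n \<in> Orb n"
  unfolding rep_def using proj_space_nonempty[OF Orb_proj] by (rule someI_ex)

lemma Orb_eq_rep: "Orb n = proj_point (rep n)" and rep_nonzero: "rep n \<noteq> 0"
  using proj_space_rep[OF Orb_proj rep_in] by auto

text \<open>A pair of indices stands for a point of (orbit) x (orbit); the two families are the
  coordinates of the two factors.\<close>

definition coord_fst :: "'n \<Rightarrow> nat \<times> nat \<Rightarrow> 'a" where "coord_fst i = (\<lambda>z. rep (fst z) $ i)"
definition coord_snd :: "'n \<Rightarrow> nat \<times> nat \<Rightarrow> 'a" where "coord_snd i = (\<lambda>z. rep (snd z) $ i)"

lemma coordinate_ring:
  obtains A where "unital_subring A" "noetherian A" "const_funs \<subseteq> A"
    "\<And>i. coord_fst i \<in> A" "\<And>i. coord_snd i \<in> A"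
proof -
  have "finite (range coord_fst \<union> range coord_snd)" by simp
  from noetherian_function_ring[OF this] obtain A where "unital_subring A" "noetherian A"
    "const_funs \<subseteq> A" "range coord_fst \<union> range coord_snd \<subseteq> A" by blast
  then show ?thesis by (intro that[of A]) auto
qed

text \<open>Functions of one index whose pullbacks along both projections lie in \<open>A\<close>.
  Charts are constructed once in this ring and then used in either factor.\<close>

definition coord_funs :: "(nat \<times> nat \<Rightarrow> 'a) set \<Rightarrow> (nat \<Rightarrow> 'a) set" where
  "coord_funs A = {p. (\<lambda>z. p (fst z)) \<in> A \<and> (\<lambda>z. p (snd z)) \<in> A}"

lemma coord_funs_subring:
  assumes "unital_subring A" "const_funs \<subseteq> A"
  shows "unital_subring (coord_funs A)" "const_funs \<subseteq> coord_funs A"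
proof -
  note cl = fun_subring_closed[OF assms]
  show "unital_subring (coord_funs A)"
    unfolding unital_subring_def coord_funs_def using cl by (auto simp: one_fun_def)
  show "const_funs \<subseteq> coord_funs A"
    unfolding coord_funs_def const_funs_def using cl by auto
qed

text \<open>If near index \<open>m\<close> the \<open>i\<close>-th shift of the orbit has
  coordinates \<open>G\<close>, substituting \<open>G\<close> into a chart of \<open>g\<close> at
  \<open>Orb (m + i)\<close> gives coordinates of the image. The new \<open>p'\<close> multiplies
  the old chart condition by \<open>q\<close> evaluated at \<open>G\<close>. It serves for
  \<open>\<Phi>\<close> in the induction on \<open>i\<close> and for the final application of
  \<open>f\<close>.\<close>

lemma rat_app_local_coord:
  fixes g :: "('a, 'n, 'm::finite) rat_map"
  assumes g: "g \<in> rational_maps V Y" "\<And>n. Orb n \<notin> indeterminacy V g"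
    and A: "unital_subring B" "const_funs \<subseteq> B"
    and p: "p \<in> B" "\<And>k. G k \<in> B" "p m \<noteq> 0"
    and pG: "\<And>m'. p m' \<noteq> 0 \<Longrightarrow> (\<chi> k. G k m') \<noteq> 0 \<and> Orb (m' + i) = proj_point (\<chi> k. G k m')"
  shows "\<exists>p'\<in>B. \<exists>G'. (\<forall>k. G' k \<in> B) \<and> p' m \<noteq> 0 \<and>
    (\<forall>m'. p' m' \<noteq> 0 \<longrightarrow> (\<chi> k. G' k m') \<noteq> 0 \<and> rat_app g (Orb (m' + i)) = proj_point (\<chi> k. G' k m'))"
proof -
  obtain e q d F where q: "homogeneous e q" "\<And>x. x \<in> Orb (m + i) \<Longrightarrow> mpol_eval q x \<noteq> 0"
    "\<And>j. homogeneous d (F j)"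
    "\<And>Q x. Q \<in> V \<Longrightarrow> x \<in> Q \<Longrightarrow> mpol_eval q x \<noteq> 0 \<Longrightarrow>
       (\<chi> j. mpol_eval (F j) x) \<noteq> 0 \<and> rat_app g Q = proj_point (\<chi> j. mpol_eval (F j) x)"
    using rat_app_local[OF V g(1) Orb_in[of "m + i"] g(2)] by metis
  define p' where "p' = (\<lambda>m. p m * mpol_eval q (\<chi> k. G k m))"
  define G' where "G' = (\<lambda>j m. mpol_eval (F j) (\<chi> k. G k m))"
  have mem: "(\<chi> k. G k m') \<in> Orb (m' + i)" if "p m' \<noteq> 0" for m'
    using pG[OF that] proj_point_self by auto
  have "p' \<in> B" unfolding p'_def
    by (intro fun_subring_closed(2)[OF A] p fun_subring_mpol_eval[OF A])
  moreover have "\<forall>k. G' k \<in> B" unfolding G'_def by (intro allI fun_subring_mpol_eval[OF A] p)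
  moreover have "p' m \<noteq> 0" unfolding p'_def using p(3) q(2)[OF mem[OF p(3)]] by simp
  moreover have "(\<chi> k. G' k m') \<noteq> 0 \<and> rat_app g (Orb (m' + i)) = proj_point (\<chi> k. G' k m')"
    if "p' m' \<noteq> 0" for m'
    using that q(4)[OF Orb_in mem, of m'] by (simp add: p'_def G'_def)
  ultimately show ?thesis by blast
qed

text \<open>All functions stay in the one ring \<open>B\<close> for every \<open>i\<close> and
  \<open>m\<close>, although chart and degree of the formula change with both. This uniformity lets
  the Noetherian property act on all shifts at once.\<close>

lemma orbit_local_coord:
  assumes A: "unital_subring B" "const_funs \<subseteq> B" "\<And>k. (\<lambda>m. rep m $ k) \<in> B"
  shows "\<exists>p\<in>B. \<exists>G. (\<forall>k. G k \<in> B) \<and> p m \<noteq> 0 \<and>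
    (\<forall>m'. p m' \<noteq> 0 \<longrightarrow> (\<chi> k. G k m') \<noteq> 0 \<and> Orb (m' + i) = proj_point (\<chi> k. G k m'))"
proof (induction i)
  case 0
  show ?case
    using fun_subring_closed(1)[OF A(1,2), of 1] A(3) rep_nonzero Orb_eq_rep
    by (intro bexI[of _ "\<lambda>_. 1"] exI[of _ "\<lambda>k m. rep m $ k"]) auto
next
  case (Suc i)
  then obtain p G where "p \<in> B" "\<And>k. G k \<in> B" "p m \<noteq> 0"
    "\<And>m'. p m' \<noteq> 0 \<Longrightarrow> (\<chi> k. G k m') \<noteq> 0 \<and> Orb (m' + i) = proj_point (\<chi> k. G k m')" by blast
  from rat_app_local_coord[OF \<Phi> Orb_defined A(1,2) this] show ?case
    by (simp add: Orb_Suc)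
qed

text \<open>Each \<open>E i\<close> is closed: a pair outside it is separated from it by a minor of
  the local coordinates of the two values. The number \<open>k\<close> is where the intersections of
  the \<open>E i\<close> stabilise.\<close>

lemma orbit_values_determined:
  fixes f :: "('a, 'n, 'm::finite) rat_map"
  assumes f: "f \<in> rational_maps V Y" "\<And>n. Orb n \<notin> indeterminacy V f"
  shows "\<exists>k. \<forall>m n. (\<forall>i<k. rat_app f (Orb (m + i)) = rat_app f (Orb (n + i))) \<longrightarrow>
    (\<forall>i. rat_app f (Orb (m + i)) = rat_app f (Orb (n + i)))"
proof -
  obtain A where A: "unital_subring A" "noetherian A" "const_funs \<subseteq> A"
    "\<And>i. coord_fst i \<in> A" "\<And>i. coord_snd i \<in> A" using coordinate_ring by metis
  let ?B = "coord_funs A"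
  note B = coord_funs_subring[OF A(1,3)]
  have Brep: "(\<lambda>m. rep m $ k) \<in> ?B" for k
    using A(4,5)[of k] unfolding coord_funs_def coord_fst_def coord_snd_def by simp
  define E where "E i = {(m, n). rat_app f (Orb (m + i)) = rat_app f (Orb (n + i))}" for i
  have local: "\<exists>p\<in>?B. \<exists>G. (\<forall>k. G k \<in> ?B) \<and> p m \<noteq> 0 \<and>
    (\<forall>m'. p m' \<noteq> 0 \<longrightarrow> (\<chi> k. G k m') \<noteq> 0 \<and> rat_app f (Orb (m' + i)) = proj_point (\<chi> k. G k m'))" for m i
  proof -
    obtain p G where "p \<in> ?B" "\<And>k. G k \<in> ?B" "p m \<noteq> 0"
      "\<And>m'. p m' \<noteq> 0 \<Longrightarrow> (\<chi> k. G k m') \<noteq> 0 \<and> Orb (m' + i) = proj_point (\<chi> k. G k m')"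
      using orbit_local_coord[OF B Brep, of m i] by blast
    from rat_app_local_coord[OF f B this] show ?thesis .
  qed
  have "\<exists>k. \<forall>z. (\<forall>i<k. z \<in> E i) \<longrightarrow> (\<forall>i. z \<in> E i)"
  proof (rule noetherian_chain_stabilizes[OF A(2)])
    fix i and z :: "nat \<times> nat" assume z: "z \<notin> E i"
    obtain m n where mn: "z = (m, n)" by fastforce
    obtain p G where p: "p \<in> ?B" "\<And>k. G k \<in> ?B" "p m \<noteq> 0"
      "\<And>m'. p m' \<noteq> 0 \<Longrightarrow> (\<chi> k. G k m') \<noteq> 0 \<and> rat_app f (Orb (m' + i)) = proj_point (\<chi> k. G k m')"
      using local[of m i] by blast
    obtain q H where q: "q \<in> ?B" "\<And>k. H k \<in> ?B" "q n \<noteq> 0"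
      "\<And>m'. q m' \<noteq> 0 \<Longrightarrow> (\<chi> k. H k m') \<noteq> 0 \<and> rat_app f (Orb (m' + i)) = proj_point (\<chi> k. H k m')"
      using local[of n i] by blast
    have "proj_point (\<chi> k. G k m) \<noteq> proj_point (\<chi> k. H k n)"
      using z p(4)[OF p(3)] q(4)[OF q(3)] unfolding mn E_def by auto
    then obtain k l where kl: "G k m * H l n \<noteq> G l m * H k n"
      using proj_point_eq_iff[of "\<chi> k. G k m" "\<chi> k. H k n"] p(4)[OF p(3)] q(4)[OF q(3)] by auto
    \<comment> \<open>The factors \<open>p\<close> and \<open>q\<close> extend the minor by zero
      outside the charts, where \<open>G\<close> and \<open>H\<close> carry no information; thus
      \<open>h\<close> vanishes on all of \<open>E i\<close>.\<close>
    define h where "h = (\<lambda>z. (p (fst z) * q (snd z)) *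
      (G k (fst z) * H l (snd z) - G l (fst z) * H k (snd z)))"
    have "h \<in> A" unfolding h_def
      using p(1,2) q(1,2) by (intro fun_subring_closed[OF A(1,3)]) (auto simp: coord_funs_def)
    moreover have "h z \<noteq> 0" using kl p(3) q(3) unfolding h_def mn by simp
    moreover have "h z' = 0" if z': "z' \<in> E i" for z'
    proof (cases "p (fst z') = 0 \<or> q (snd z') = 0")
      case False
      then have pp: "p (fst z') \<noteq> 0" and qq: "q (snd z') \<noteq> 0" by auto
      have "proj_point (\<chi> k. G k (fst z')) = proj_point (\<chi> k. H k (snd z'))"
        using z' p(4)[OF pp] q(4)[OF qq] unfolding E_def by auto
      then have "G k (fst z') * H l (snd z') = G l (fst z') * H k (snd z')"
        using proj_point_eq_iff[of "\<chi> k. G k (fst z')" "\<chi> k. H k (snd z')"] p(4)[OF pp] q(4)[OF qq]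
        by auto
      then show ?thesis by (simp add: h_def)
    qed (auto simp: h_def)
    ultimately show "\<exists>h\<in>A. h z \<noteq> 0 \<and> (\<forall>z'\<in>E i. h z' = 0)" by blast
  qed
  then obtain k where k: "\<And>z. (\<forall>i<k. z \<in> E i) \<Longrightarrow> (\<forall>i. z \<in> E i)" by blast
  have "\<forall>m n. (\<forall>i<k. (m, n) \<in> E i) \<longrightarrow> (\<forall>i. (m, n) \<in> E i)" using k by blast
  then show ?thesis unfolding E_def mem_Collect_eq case_prod_conv by (rule exI)
qed

text \<open>The chart conditions have no common zero on the orbit, since \<open>q n\<close> is
  nonzero at \<open>Orb n\<close>; finitely many of them already have none, and \<open>C\<close>
  collects the coefficients of the corresponding \<open>F n\<close>. Stating the result for every
  coordinate vector over \<open>K\<close> allows iteration along the orbit.\<close>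

lemma finitely_many_coefficients:
  fixes g :: "('a, 'n, 'm::finite) rat_map"
  assumes g: "g \<in> rational_maps V Y" "\<And>n. Orb n \<notin> indeterminacy V g"
  shows "\<exists>C. finite C \<and> (\<forall>K. unital_subring K \<longrightarrow> C \<subseteq> K \<longrightarrow>
    (\<forall>m z. z \<in> Orb m \<longrightarrow> (\<forall>i. z $ i \<in> K) \<longrightarrow>
      (\<exists>w. (\<forall>j. w $ j \<in> K) \<and> w \<noteq> 0 \<and> rat_app g (Orb m) = proj_point w)))"
proof -
  have "\<exists>q F. (\<exists>e. homogeneous e q) \<and> (\<forall>x\<in>Orb n. mpol_eval q x \<noteq> 0) \<and>
    (\<forall>Q x. Q \<in> V \<longrightarrow> x \<in> Q \<longrightarrow> mpol_eval q x \<noteq> 0 \<longrightarrow>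
       (\<chi> j. mpol_eval (F j) x) \<noteq> 0 \<and> rat_app g Q = proj_point (\<chi> j. mpol_eval (F j) x))" for n
    using rat_app_local[OF V g(1) Orb_in g(2), of n] by metis
  then obtain q F where qF: "\<And>n. \<exists>e. homogeneous e (q n)" "\<And>n x. x \<in> Orb n \<Longrightarrow> mpol_eval (q n) x \<noteq> 0"
    "\<And>n Q x. Q \<in> V \<Longrightarrow> x \<in> Q \<Longrightarrow> mpol_eval (q n) x \<noteq> 0 \<Longrightarrow>
       (\<chi> j. mpol_eval (F n j) x) \<noteq> 0 \<and> rat_app g Q = proj_point (\<chi> j. mpol_eval (F n j) x)"
    by metis
  obtain A where A: "unital_subring A" "noetherian A" "const_funs \<subseteq> A"
    "\<And>i. coord_fst i \<in> A" "\<And>i. coord_snd i \<in> A" using coordinate_ring by metis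
  define t where "t n = (\<lambda>z::nat \<times> nat. mpol_eval (q n) (rep (fst z)))" for n
  have "t n \<in> A" for n
    using fun_subring_mpol_eval[OF A(1,3), of coord_fst "q n"] A(4)
    by (simp add: t_def coord_fst_def)
  then have "range t \<subseteq> A" by auto
  then obtain T0 where T0: "T0 \<subseteq> range t" "finite T0"
    "\<And>z. (\<forall>g\<in>T0. g z = 0) \<Longrightarrow> (\<forall>g\<in>range t. g z = 0)"
    using noetherian_finite_zero_set[OF A(2)] by metis
  obtain N where N: "finite N" "T0 = t ` N" using T0(1,2) by (meson finite_subset_image)
  have cover: "\<exists>n\<in>N. mpol_eval (q n) (rep m) \<noteq> 0" for m
  proof (rule ccontr)
    assume "\<not> (\<exists>n\<in>N. mpol_eval (q n) (rep m) \<noteq> 0)"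
    \<comment> \<open>The ring consists of functions on pairs, but \<open>t n\<close> reads only the
      first entry, so a diagonal pair serves.\<close>
    then have "\<forall>g\<in>T0. g (m, m) = 0" unfolding N(2) by (auto simp: t_def)
    then have "t m (m, m) = 0" using T0(3) by blast
    then show False using qF(2)[OF rep_in, of m] by (simp add: t_def)
  qed
  define C where "C = (\<Union>n\<in>N. \<Union>j. Poly_Mapping.range (F n j))"
  have "finite C" unfolding C_def using N(1) by auto
  moreover have "\<exists>w. (\<forall>j. w $ j \<in> K) \<and> w \<noteq> 0 \<and> rat_app g (Orb m) = proj_point w"
    if K: "unital_subring K" "C \<subseteq> K" and z: "z \<in> Orb m" "\<And>i. z $ i \<in> K" for K m and z :: "'a ^ 'n"
  proof -
    obtain n where n: "n \<in> N" "mpol_eval (q n) (rep m) \<noteq> 0" using cover by blast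
    obtain e where e: "homogeneous e (q n)" using qF(1) by blast
    have "mpol_eval (q n) z \<noteq> 0"
      using homogeneous_nonzero_rep_indep[OF e Orb_proj rep_in z(1) n(2)] .
    note w = qF(3)[OF Orb_in z(1) this]
    have "Poly_Mapping.lookup (F n j) l \<in> K" for j l
    proof (cases "Poly_Mapping.lookup (F n j) l = 0")
      case True
      then show ?thesis using unital_subringD(2)[OF K(1)] by simp
    next
      case False
      then have "Poly_Mapping.lookup (F n j) l \<in> Poly_Mapping.range (F n j)"
        by (simp add: in_keys_iff)
      then show ?thesis using K(2) n(1) unfolding C_def by blast
    qed
    then have "mpol_eval (F n j) z \<in> K" for j by (intro subring_mpol_eval[OF K(1)] z(2))
    then show ?thesis using w by (intro exI[of _ "\<chi> j. mpol_eval (F n j) z"]) simp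
  qed
  ultimately show ?thesis by blast
qed

text \<open>\<open>C\<close> contains coordinates of the first point and the coefficients of
  finitely many charts of \<open>\<Phi>\<close> and \<open>f\<close>. Induction along the orbit
  gives every point coordinates in \<open>K\<close>, and one application of \<open>f\<close> does so
  for the values.\<close>

lemma orbit_field_of_definition:
  fixes f :: "('a, 'n, 'm::finite) rat_map"
  assumes f: "f \<in> rational_maps V Y" "\<And>n. Orb n \<notin> indeterminacy V f"
  shows "\<exists>C. finite C \<and> (\<forall>K. unital_subring K \<longrightarrow> C \<subseteq> K \<longrightarrow>
    (\<forall>m. \<exists>w. (\<forall>j. w $ j \<in> K) \<and> w \<noteq> 0 \<and> rat_app f (Orb m) = proj_point w))"
proof -
  obtain C1 where C1: "finite C1" "\<forall>K. unital_subring K \<longrightarrow> C1 \<subseteq> K \<longrightarrow>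
    (\<forall>m z. z \<in> Orb m \<longrightarrow> (\<forall>i. z $ i \<in> K) \<longrightarrow>
      (\<exists>w. (\<forall>j. w $ j \<in> K) \<and> w \<noteq> 0 \<and> rat_app \<Phi> (Orb m) = proj_point w))"
    using finitely_many_coefficients[OF \<Phi> Orb_defined] by (elim exE conjE)
  obtain C2 where C2: "finite C2" "\<forall>K. unital_subring K \<longrightarrow> C2 \<subseteq> K \<longrightarrow>
    (\<forall>m z. z \<in> Orb m \<longrightarrow> (\<forall>i. z $ i \<in> K) \<longrightarrow>
      (\<exists>w. (\<forall>j. w $ j \<in> K) \<and> w \<noteq> 0 \<and> rat_app f (Orb m) = proj_point w))"
    using finitely_many_coefficients[OF f] by (elim exE conjE)
  define C where "C = C1 \<union> C2 \<union> range (\<lambda>i. rep 0 $ i)"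
  have "finite C" unfolding C_def using C1 C2 by simp
  moreover have "\<exists>w. (\<forall>j. w $ j \<in> K) \<and> w \<noteq> 0 \<and> rat_app f (Orb m) = proj_point w"
    if K: "unital_subring K" "C \<subseteq> K" for K m
  proof -
    have K': "C1 \<subseteq> K" "C2 \<subseteq> K" "\<And>i. rep 0 $ i \<in> K" using K(2) unfolding C_def by auto
    have "\<exists>z\<in>Orb m. \<forall>i. z $ i \<in> K"
    proof (induction m)
      case 0
      show ?case using rep_in K'(3) by blast
    next
      case (Suc m)
      then obtain z :: "'a ^ 'n" where z: "z \<in> Orb m" "\<forall>i. z $ i \<in> K" by blast
      obtain w :: "'a ^ 'n" where "\<forall>j. w $ j \<in> K" "w \<noteq> 0" "rat_app \<Phi> (Orb m) = proj_point w"
        using C1(2)[THEN spec, THEN mp, OF K(1), THEN mp, OF K'(1)] z by blast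
      then show ?case using proj_point_self unfolding Orb_Suc by metis
    qed
    then show ?thesis using C2(2)[THEN spec, THEN mp, OF K(1), THEN mp, OF K'(2)] by blast
  qed
  ultimately show ?thesis by blast
qed

end

lemma rational_orbit_iterates:
  assumes V: "quasi_projective_variety V" and \<Phi>: "\<Phi> \<in> rational_maps V V" and x: "x \<in> orbit_defined V \<Phi>"
  shows "rational_orbit V \<Phi> (\<lambda>n. (rat_app \<Phi> ^^ n) x)"
proof
  have ndef: "(rat_app \<Phi> ^^ n) x \<notin> indeterminacy V \<Phi>" for n using x unfolding orbit_defined_def by blast
  show "(rat_app \<Phi> ^^ n) x \<in> V" for n
  proof (induction n)
    case 0
    show ?case using x unfolding orbit_defined_def by simp
  next
    case (Suc n)
    then show ?case using rat_app_in_target[OF V \<Phi> Suc ndef] by simp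
  qed
qed (use V \<Phi> x in \<open>auto simp: orbit_defined_def\<close>)


section \<open>Absolute values below power-multiplicative seminorms\<close>

definition closed_subfield :: "'a::field set \<Rightarrow> bool" where
  "closed_subfield K \<longleftrightarrow> unital_subring K \<and> (\<forall>x\<in>K. inverse x \<in> K)"

text \<open>Submultiplicative, with equality on the powers of one element, as for a spectral norm;
  equality on all products is what the minimal ones gain.\<close>

definition pm_seminorm :: "'a::comm_ring_1 set \<Rightarrow> ('a \<Rightarrow> real) \<Rightarrow> bool" where
  "pm_seminorm K \<nu> \<longleftrightarrow> \<nu> 0 = 0 \<and> \<nu> 1 = 1 \<and> (\<forall>x\<in>K. 0 \<le> \<nu> x) \<and>
     (\<forall>x\<in>K. \<forall>y\<in>K. \<nu> (x + y) \<le> \<nu> x + \<nu> y \<and> \<nu> (x * y) \<le> \<nu> x * \<nu> y) \<and>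
     (\<forall>x\<in>K. \<forall>k. \<nu> (x ^ k) = \<nu> x ^ k)"

text \<open>The spectral radius, usually the limit of the \<open>n\<close>-th roots of
  \<open>N (x ^ n)\<close>, written as the least exponential growth rate. In this form constant
  factors in bounds for \<open>N\<close> disappear without a limit of roots.\<close>

definition spectral :: "('a::comm_ring_1 \<Rightarrow> real) \<Rightarrow> 'a \<Rightarrow> real" where
  "spectral N x = Inf {r. 0 \<le> r \<and> (\<exists>C. \<forall>n. N (x ^ n) \<le> C * r ^ n)}"

section \<open>The spectral seminorm\<close>

lemma le_mult_from_above:
  fixes a b L :: real
  assumes "0 \<le> a" "0 \<le> b" and L: "\<And>s t. a < s \<Longrightarrow> b < t \<Longrightarrow> L \<le> s * t"
  shows "L \<le> a * b"
proof (rule tendsto_lowerbound)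
  show "((\<lambda>e. (a + e) * (b + e)) \<longlongrightarrow> a * b) (at_right 0)"
    by (auto intro!: tendsto_eq_intros)
  show "\<forall>\<^sub>F e in at_right 0. L \<le> (a + e) * (b + e)"
    using eventually_at_right_less by (rule eventually_mono) (auto intro!: L)
qed auto

text \<open>The power trick: a factor independent of \<open>n\<close> cannot matter in a comparison
  of exponentials.\<close>

lemma power_growth_le:
  fixes a b C :: real
  assumes "0 \<le> a" "0 < b" "\<And>n. a ^ n \<le> C * b ^ n"
  shows "a \<le> b"
proof (rule ccontr)
  assume "\<not> a \<le> b"
  then have "1 < a / b" using assms by (simp add: field_simps)
  then obtain n where "C < (a / b) ^ n" using real_arch_pow by blast
  then have "C * b ^ n < a ^ n" using assms(2) by (simp add: field_simps)
  then show False using assms(3)[of n] by simp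
qed

text \<open>The constant \<open>C0\<close> accommodates the coordinate norm of a number field in an
  arbitrary basis, where submultiplicativity holds up to a bound on the structure constants.\<close>

locale quasi_norm =
  fixes K :: "'a::comm_ring_1 set" and N :: "'a \<Rightarrow> real" and C0 :: real
  assumes K: "unital_subring K"
    and N0: "N 0 = 0" and N1: "0 < N 1"
    and N_nonneg: "x \<in> K \<Longrightarrow> 0 \<le> N x"
    and N_add: "x \<in> K \<Longrightarrow> y \<in> K \<Longrightarrow> N (x + y) \<le> N x + N y"
    and N_mult: "x \<in> K \<Longrightarrow> y \<in> K \<Longrightarrow> N (x * y) \<le> C0 * N x * N y"
begin

lemma N_nat:
  assumes x: "x \<in> K"
  shows "N (of_nat k * x) \<le> of_nat k * N x"
proof (induction k)
  case (Suc k)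
  have "of_nat k \<in> K" by (induction k) (auto intro: unital_subringD[OF K])
  then have "of_nat k * x \<in> K" using x by (rule unital_subringD(4)[OF K])
  from N_add[OF x this] show ?case using Suc by (simp add: distrib_right)
qed (simp add: N0)

lemma K_power: "x \<in> K \<Longrightarrow> x ^ n \<in> K"
  by (rule unital_subring_power[OF K])

lemma C0_pos: "0 < C0"
proof -
  have "1 \<in> K" using unital_subringD[OF K] by blast
  then have "N 1 \<le> C0 * N 1 * N 1" using N_mult[of 1 1] by simp
  then show ?thesis using N1 by (metis less_le_trans mult.assoc mult_pos_pos zero_less_mult_pos2)
qed

text \<open>The infimum of the empty set would be a meaningless value; the rate
  \<open>C0 * N x\<close> always belongs to the set.\<close>

lemma spectral_set_nonempty:
  assumes "x \<in> K"
  shows "\<exists>r\<ge>0. \<exists>C. \<forall>n. N (x ^ n) \<le> C * r ^ n"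
proof (intro exI conjI allI)
  show "0 \<le> C0 * N x" using C0_pos N_nonneg[OF assms] by simp
  show "N (x ^ n) \<le> N 1 * (C0 * N x) ^ n" for n
  proof (induction n)
    case (Suc n)
    have "N (x ^ Suc n) \<le> C0 * N x * N (x ^ n)" using N_mult[OF assms K_power[OF assms]] by simp
    also have "\<dots> \<le> C0 * N x * (N 1 * (C0 * N x) ^ n)"
      using Suc C0_pos N_nonneg[OF assms] by (intro mult_left_mono) auto
    finally show ?case by (simp add: algebra_simps)
  qed simp
qed

lemma spectral_bdd: "bdd_below {r. 0 \<le> r \<and> (\<exists>C. \<forall>n. N (x ^ n) \<le> C * r ^ n)}"
  by (rule bdd_belowI[of _ 0]) auto

lemma spectral_nonneg: "x \<in> K \<Longrightarrow> 0 \<le> spectral N x"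
  unfolding spectral_def using spectral_set_nonempty by (intro cInf_greatest) auto

lemma spectral_le: "0 \<le> r \<Longrightarrow> (\<And>n. N (x ^ n) \<le> C * r ^ n) \<Longrightarrow> spectral N x \<le> r"
  unfolding spectral_def by (intro cInf_lower spectral_bdd) auto

lemma spectral_less:
  assumes "x \<in> K" "spectral N x < s"
  obtains C where "0 < C" "\<And>n. N (x ^ n) \<le> C * s ^ n"
proof -
  obtain r C where r: "0 \<le> r" "r < s" "\<And>n. N (x ^ n) \<le> C * r ^ n"
    using assms(2) spectral_set_nonempty[OF assms(1)] unfolding spectral_def
    by (subst (asm) cInf_less_iff) (auto intro: spectral_bdd)
  have "N (x ^ n) \<le> (\<bar>C\<bar> + 1) * s ^ n" for n
  proof -
    have "C * r ^ n \<le> (\<bar>C\<bar> + 1) * r ^ n" using r by (intro mult_right_mono) auto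
    also have "\<dots> \<le> (\<bar>C\<bar> + 1) * s ^ n" using r by (intro mult_left_mono power_mono) auto
    finally show ?thesis using r(3)[of n] by simp
  qed
  then show ?thesis using that[of "\<bar>C\<bar> + 1"] by auto
qed

lemma spectral_mult:
  assumes x: "x \<in> K" and y: "y \<in> K"
  shows "spectral N (x * y) \<le> spectral N x * spectral N y"
proof (rule le_mult_from_above[OF spectral_nonneg[OF x] spectral_nonneg[OF y]])
  fix s t assume s: "spectral N x < s" and t: "spectral N y < t"
  obtain C1 where C1: "0 < C1" "\<And>n. N (x ^ n) \<le> C1 * s ^ n" using spectral_less[OF x s] by metis
  obtain C2 where C2: "0 < C2" "\<And>n. N (y ^ n) \<le> C2 * t ^ n" using spectral_less[OF y t] by metis
  have st: "0 < s" "0 < t" using s t spectral_nonneg x y by (meson le_less_trans)+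
  show "spectral N (x * y) \<le> s * t"
  proof (rule spectral_le)
    fix n
    have "N ((x * y) ^ n) \<le> C0 * N (x ^ n) * N (y ^ n)"
      using N_mult[OF K_power[OF x] K_power[OF y]] by (simp add: power_mult_distrib)
    also have "\<dots> = C0 * (N (x ^ n) * N (y ^ n))" by simp
    also have "\<dots> \<le> C0 * ((C1 * s ^ n) * (C2 * t ^ n))"
      using C0_pos C1 C2 st by (intro mult_left_mono mult_mono) (auto intro: N_nonneg K_power y)
    finally show "N ((x * y) ^ n) \<le> (C0 * C1 * C2) * (s * t) ^ n"
      by (simp add: power_mult_distrib algebra_simps)
  qed (use st in auto)
qed

lemma N_sum:
  assumes "\<And>i. i \<in> A \<Longrightarrow> g i \<in> K"
  shows "N (sum g A) \<le> (\<Sum>i\<in>A. N (g i))"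
  using assms
proof (induction A rule: infinite_finite_induct)
  case (insert a A)
  then show ?case using N_add[of "g a" "sum g A"] unital_subring_sum[OF K, of A g] by auto
qed (auto simp: N0)

text \<open>Commutativity gives the binomial expansion; the bounds \<open>C1 * s ^ k\<close> and
  \<open>C2 * t ^ (n - k)\<close> for its factors sum to a multiple of
  \<open>(s + t) ^ n\<close>.\<close>

lemma spectral_add:
  assumes x: "x \<in> K" and y: "y \<in> K"
  shows "spectral N (x + y) \<le> spectral N x + spectral N y"
proof (rule field_le_epsilon)
  fix e :: real assume e: "0 < e"
  define s where "s = spectral N x + e / 2"
  define t where "t = spectral N y + e / 2"
  have s: "spectral N x < s" and t: "spectral N y < t" using e by (auto simp: s_def t_def)
  obtain C1 where C1: "0 < C1" "\<And>n. N (x ^ n) \<le> C1 * s ^ n" using spectral_less[OF x s] by metis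
  obtain C2 where C2: "0 < C2" "\<And>n. N (y ^ n) \<le> C2 * t ^ n" using spectral_less[OF y t] by metis
  have st: "0 < s" "0 < t" using s t spectral_nonneg x y by (meson le_less_trans)+
  have "spectral N (x + y) \<le> s + t"
  proof (rule spectral_le)
    fix n
    have mem: "of_nat (n choose k) * (x ^ k * y ^ (n - k)) \<in> K" "x ^ k * y ^ (n - k) \<in> K" for k
    proof -
      show 1: "x ^ k * y ^ (n - k) \<in> K" using K_power x y unital_subringD(4)[OF K] by blast
      have "of_nat m \<in> K" for m
        by (induction m) (auto intro: unital_subringD[OF K])
      then show "of_nat (n choose k) * (x ^ k * y ^ (n - k)) \<in> K" using 1 unital_subringD(4)[OF K] by blast
    qed
    have "(x + y) ^ n = (\<Sum>k\<le>n. of_nat (n choose k) * (x ^ k * y ^ (n - k)))"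
      by (simp add: binomial_ring mult.assoc)
    then have "N ((x + y) ^ n) \<le> (\<Sum>k\<le>n. N (of_nat (n choose k) * (x ^ k * y ^ (n - k))))"
      using N_sum[of "{..n}"] mem by simp
    also have "\<dots> \<le> (\<Sum>k\<le>n. (C0 * C1 * C2) * (of_nat (n choose k) * s ^ k * t ^ (n - k)))"
    proof (rule sum_mono)
      fix k
      have "N (of_nat (n choose k) * (x ^ k * y ^ (n - k))) \<le> of_nat (n choose k) * N (x ^ k * y ^ (n - k))"
        by (rule N_nat[OF mem(2)])
      also have "\<dots> \<le> of_nat (n choose k) * (C0 * ((C1 * s ^ k) * (C2 * t ^ (n - k))))"
      proof (intro mult_left_mono)
        have "N (x ^ k * y ^ (n - k)) \<le> C0 * N (x ^ k) * N (y ^ (n - k))"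
          by (intro N_mult K_power x y)
        also have "\<dots> = C0 * (N (x ^ k) * N (y ^ (n - k)))" by simp
        also have "\<dots> \<le> C0 * ((C1 * s ^ k) * (C2 * t ^ (n - k)))"
          using C0_pos C1 C2 st by (intro mult_left_mono mult_mono) (auto intro: N_nonneg K_power y)
        finally show "N (x ^ k * y ^ (n - k)) \<le> C0 * ((C1 * s ^ k) * (C2 * t ^ (n - k)))" .
      qed auto
      finally show "N (of_nat (n choose k) * (x ^ k * y ^ (n - k))) \<le>
          (C0 * C1 * C2) * (of_nat (n choose k) * s ^ k * t ^ (n - k))" by (simp add: algebra_simps)
    qed
    also have "\<dots> = (C0 * C1 * C2) * (s + t) ^ n"
      by (simp add: binomial_ring sum_distrib_left)
    finally show "N ((x + y) ^ n) \<le> (C0 * C1 * C2) * (s + t) ^ n" .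
  qed (use st in auto)
  then show "spectral N (x + y) \<le> spectral N x + spectral N y + e" by (simp add: s_def t_def)
qed

lemma spectral_one: "spectral N 1 = 1"
proof (rule antisym)
  show "spectral N 1 \<le> 1" by (rule spectral_le[of _ _ "N 1"]) auto
  show "1 \<le> spectral N 1"
  proof (rule ccontr)
    assume "\<not> 1 \<le> spectral N 1"
    then have "spectral N 1 < 1" by simp
    from dense[OF this] obtain s where s: "spectral N 1 < s" "s < 1" by blast
    have one: "1 \<in> K" using unital_subringD[OF K] by blast
    obtain C where C: "0 < C" "\<And>n. N (1 ^ n) \<le> C * s ^ n" using spectral_less[OF one s(1)] by metis
    have "0 < s" using s(1) spectral_nonneg[OF one] by simp
    have "(\<lambda>n. C * s ^ n) \<longlonglongrightarrow> C * 0"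
      using s \<open>0 < s\<close> by (intro tendsto_mult tendsto_const LIMSEQ_power_zero) auto
    then have "N 1 \<le> C * 0" by (rule LIMSEQ_le_const) (use C in auto)
    then show False using N1 by simp
  qed
qed

lemma spectral_zero: "spectral N 0 = 0"
proof (rule antisym)
  have "N (0 ^ n) \<le> N 1 * 0 ^ n" for n using N0 by (cases n) auto
  then show "spectral N 0 \<le> 0" using spectral_le[of 0 0 "N 1"] by auto
  show "0 \<le> spectral N 0" using spectral_nonneg unital_subringD[OF K] by blast
qed

text \<open>One inequality is submultiplicativity. For the other, exponents are divided by
  \<open>k\<close> with remainder: the quotient is governed by the growth of the powers of
  \<open>x ^ k\<close>, and the finitely many remainders affect only the constant.\<close>

lemma spectral_power:
  assumes x: "x \<in> K"
  shows "spectral N (x ^ k) = spectral N x ^ k"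
proof (cases "k = 0")
  case False
  show ?thesis
  proof (rule antisym)
    show "spectral N (x ^ k) \<le> spectral N x ^ k"
    proof (induction k)
      case (Suc k)
      then show ?case
        using spectral_mult[OF x K_power[OF x], of k] spectral_nonneg[OF x]
        by (simp add: mult_left_mono order_trans)
    qed (simp add: spectral_one)
    show "spectral N x ^ k \<le> spectral N (x ^ k)"
    proof (rule dense_ge)
      fix s assume s: "spectral N (x ^ k) < s"
      obtain C where C: "0 < C" "\<And>n. N ((x ^ k) ^ n) \<le> C * s ^ n"
        using spectral_less[OF K_power[OF x] s] by metis
      have s0: "0 < s" using s spectral_nonneg[OF K_power[OF x], of k] by simp
      define t where "t = root k s"
      have t: "0 < t" "t ^ k = s" using s0 False by (auto simp: t_def)
      define M where "M = (\<Sum>r<k. N (x ^ r) / t ^ r)"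
      have M: "N (x ^ r) \<le> M * t ^ r" if "r < k" for r
      proof -
        have "N (x ^ r) / t ^ r \<le> M" unfolding M_def
          using that t N_nonneg[OF K_power[OF x]] by (intro member_le_sum) auto
        then show ?thesis using t by (simp add: field_simps)
      qed
      have "spectral N x \<le> t"
      proof (rule spectral_le)
        fix n
        have n: "n = k * (n div k) + n mod k" by simp
        have "x ^ n = (x ^ k) ^ (n div k) * x ^ (n mod k)"
          by (subst n) (simp only: power_add power_mult)
        then have "N (x ^ n) \<le> C0 * N ((x ^ k) ^ (n div k)) * N (x ^ (n mod k))"
          using N_mult K_power x by metis
        also have "\<dots> = C0 * (N ((x ^ k) ^ (n div k)) * N (x ^ (n mod k)))" by simp
        also have "\<dots> \<le> C0 * ((C * s ^ (n div k)) * (M * t ^ (n mod k)))"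
          using C0_pos C s0 M[of "n mod k"] False
          by (intro mult_left_mono mult_mono) (auto intro: N_nonneg K_power x)
        also have "\<dots> = (C0 * C * M) * (t ^ (k * (n div k)) * t ^ (n mod k))"
          using t(2) by (simp add: power_mult algebra_simps)
        also have "t ^ (k * (n div k)) * t ^ (n mod k) = t ^ n"
          by (simp only: power_add[symmetric] mult_div_mod_eq)
        finally show "N (x ^ n) \<le> (C0 * C * M) * t ^ n" .
      qed (use t in auto)
      then have "spectral N x ^ k \<le> t ^ k" using spectral_nonneg[OF x] by (rule power_mono)
      then show "spectral N x ^ k \<le> s" using t by simp
    qed
  qed
qed (simp add: spectral_one)

lemma pm_seminorm_spectral: "pm_seminorm K (spectral N)"
  unfolding pm_seminorm_def
  using spectral_zero spectral_one spectral_nonneg spectral_add spectral_mult spectral_power by blast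

end

section \<open>Smoothing and infima of seminorms\<close>

lemma pm_seminormD:
  assumes "pm_seminorm K \<nu>"
  shows "\<nu> 0 = 0" "\<nu> 1 = 1" "x \<in> K \<Longrightarrow> 0 \<le> \<nu> x"
    "x \<in> K \<Longrightarrow> y \<in> K \<Longrightarrow> \<nu> (x + y) \<le> \<nu> x + \<nu> y"
    "x \<in> K \<Longrightarrow> y \<in> K \<Longrightarrow> \<nu> (x * y) \<le> \<nu> x * \<nu> y"
    "x \<in> K \<Longrightarrow> \<nu> (x ^ k) = \<nu> x ^ k"
  using assms unfolding pm_seminorm_def by auto

lemma pm_seminorm_pos:
  assumes K: "closed_subfield K" and \<nu>: "pm_seminorm K \<nu>" and a: "a \<in> K" "a \<noteq> 0"
  shows "0 < \<nu> a"
proof -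
  have ia: "inverse a \<in> K" using K a by (auto simp: closed_subfield_def)
  have "1 \<le> \<nu> a * \<nu> (inverse a)"
    using pm_seminormD(2)[OF \<nu>] pm_seminormD(5)[OF \<nu> a(1) ia] a by simp
  then have "\<nu> a \<noteq> 0" by auto
  then show ?thesis using pm_seminormD(3)[OF \<nu> a(1)] by simp
qed

text \<open>The limit of \<open>\<nu> (a ^ n * x) / \<nu> a ^ n\<close> exists because the sequence
  decreases. Multiplying \<open>x\<close> by \<open>a\<close> shifts it by one index, which makes
  the limit multiplicative in the factor \<open>a\<close>.\<close>

lemma pm_seminorm_smoothing:
  assumes K: "closed_subfield K" and \<nu>: "pm_seminorm K \<nu>" and a: "a \<in> K" "a \<noteq> 0"
  obtains \<mu> where "pm_seminorm K \<mu>" "\<forall>x\<in>K. \<mu> x \<le> \<nu> x"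
    "\<forall>x\<in>K. \<mu> (a * x) = \<nu> a * \<mu> x" "\<forall>x. x \<notin> K \<longrightarrow> \<mu> x = 0"
proof -
  have R: "unital_subring K" using K by (simp add: closed_subfield_def)
  note D = unital_subringD[OF R]
  note S = pm_seminormD[OF \<nu>]
  have pos: "0 < \<nu> a" by (rule pm_seminorm_pos[OF K \<nu> a])
  have mem: "a ^ n * x \<in> K" if "x \<in> K" for n x
    using that unital_subring_power[OF R a(1)] D(4) by blast
  define u where "u x n = \<nu> (a ^ n * x) / \<nu> a ^ n" for x n
  have u_nonneg: "0 \<le> u x n" if "x \<in> K" for x n
    using S(3)[OF mem[OF that]] pos by (simp add: u_def)
  have u_dec: "decseq (u x)" if "x \<in> K" for x
  proof (rule decseq_SucI)
    fix n
    have "\<nu> (a ^ Suc n * x) \<le> \<nu> a * \<nu> (a ^ n * x)"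
      using S(5)[OF a(1) mem[OF that, of n]] by (simp add: mult.assoc)
    then show "u x (Suc n) \<le> u x n" using pos by (simp add: u_def field_simps)
  qed
  have "\<exists>l. u x \<longlonglongrightarrow> l" if "x \<in> K" for x
    using decseq_convergent[OF u_dec[OF that]] u_nonneg[OF that] by metis
  then obtain l where l: "\<And>x. x \<in> K \<Longrightarrow> u x \<longlonglongrightarrow> l x" by metis
  \<comment> \<open>A fixed value outside \<open>K\<close> makes the order on total functions depend
    on \<open>K\<close> alone, as needed when minimal seminorms are compared.\<close>
  define \<mu> where "\<mu> x = (if x \<in> K then l x else 0)" for x
  have lim: "u x \<longlonglongrightarrow> \<mu> x" if "x \<in> K" for x using l[OF that] that by (simp add: \<mu>_def)
  have eq: "\<mu> x = c" if "x \<in> K" "u x \<longlonglongrightarrow> c" for x c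
    using LIMSEQ_unique[OF lim[OF that(1)] that(2)] .
  have "pm_seminorm K \<mu>"
    unfolding pm_seminorm_def
  proof (intro conjI ballI allI)
    have "u 0 = (\<lambda>_. 0)" by (simp add: u_def fun_eq_iff S(1))
    then show "\<mu> 0 = 0" using D(2) by (intro eq) auto
    have "u 1 = (\<lambda>_. 1)" using pos by (simp add: u_def fun_eq_iff S(6)[OF a(1)])
    then show "\<mu> 1 = 1" using D(1) by (intro eq) auto
    show "0 \<le> \<mu> x" if "x \<in> K" for x
      by (rule LIMSEQ_le_const[OF lim[OF that]]) (use u_nonneg[OF that] in auto)
    show "\<mu> (x + y) \<le> \<mu> x + \<mu> y" if x: "x \<in> K" and y: "y \<in> K" for x y
    proof (rule LIMSEQ_le[OF lim[OF D(5)[OF x y]] tendsto_add[OF lim[OF x] lim[OF y]]])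
      show "\<exists>N. \<forall>n\<ge>N. u (x + y) n \<le> u x n + u y n"
        using S(4)[OF mem[OF x] mem[OF y]] pos
        by (auto simp: u_def distrib_left add_divide_distrib[symmetric] intro!: divide_right_mono)
    qed
    show "\<mu> (x * y) \<le> \<mu> x * \<mu> y" if x: "x \<in> K" and y: "y \<in> K" for x y
    proof (rule LIMSEQ_le[OF _ tendsto_mult[OF lim[OF x] lim[OF y]]])
      \<comment> \<open>Even indices, because \<open>a ^ (2 * n) * (x * y)\<close> splits evenly
        into \<open>a ^ n * x\<close> and \<open>a ^ n * y\<close>.\<close>
      show "(\<lambda>n. u (x * y) (2 * n)) \<longlonglongrightarrow> \<mu> (x * y)"
        using LIMSEQ_subseq_LIMSEQ[OF lim[OF D(4)[OF x y]], of "\<lambda>n. 2 * n"]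
        by (simp add: strict_mono_def comp_def)
      have "u (x * y) (2 * n) \<le> u x n * u y n" for n
      proof -
        have e: "a ^ (2 * n) * (x * y) = (a ^ n * x) * (a ^ n * y)"
          unfolding mult_2 power_add by (simp only: mult_ac)
        have "\<nu> (a ^ (2 * n) * (x * y)) \<le> \<nu> (a ^ n * x) * \<nu> (a ^ n * y)"
          unfolding e by (rule S(5)[OF mem[OF x] mem[OF y]])
        moreover have "u x n * u y n = \<nu> (a ^ n * x) * \<nu> (a ^ n * y) / \<nu> a ^ (2 * n)"
          unfolding u_def mult_2 power_add by simp
        ultimately show ?thesis using pos
          by (simp only: u_def[of "x * y"]) (intro divide_right_mono, simp_all)
      qed
      then show "\<exists>N. \<forall>n\<ge>N. u (x * y) (2 * n) \<le> u x n * u y n" by blast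
    qed
    show "\<mu> (x ^ k) = \<mu> x ^ k" if x: "x \<in> K" for x k
    proof (cases "k = 0")
      case True
      then show ?thesis using \<open>\<mu> 1 = 1\<close> by simp
    next
      case False
      have xk: "x ^ k \<in> K" by (rule unital_subring_power[OF R x])
      have "(\<lambda>n. u (x ^ k) (k * n)) \<longlonglongrightarrow> \<mu> (x ^ k)"
        using LIMSEQ_subseq_LIMSEQ[OF lim[OF xk], of "\<lambda>n. k * n"] False
        by (simp add: strict_mono_def comp_def)
      moreover have "u (x ^ k) (k * n) = u x n ^ k" for n
      proof -
        have "a ^ (k * n) * x ^ k = (a ^ n * x) ^ k"
          by (metis mult.commute power_mult power_mult_distrib)
        then have "u (x ^ k) (k * n) = \<nu> (a ^ n * x) ^ k / \<nu> a ^ (n * k)"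
          unfolding u_def S(6)[OF mem[OF x], symmetric] by (simp only: mult.commute)
        then show ?thesis by (simp only: u_def power_divide power_mult)
      qed
      ultimately have "(\<lambda>n. u x n ^ k) \<longlonglongrightarrow> \<mu> (x ^ k)" by simp
      then show ?thesis using LIMSEQ_unique tendsto_power[OF lim[OF x], of k] by blast
    qed
  qed
  moreover have "\<mu> x \<le> \<nu> x" if "x \<in> K" for x
  proof -
    have "\<mu> x \<le> u x 0"
      by (rule LIMSEQ_le_const2[OF lim[OF that]]) (use u_dec[OF that] in \<open>auto simp: decseq_def\<close>)
    then show ?thesis by (simp add: u_def)
  qed
  moreover have "\<mu> (a * x) = \<nu> a * \<mu> x" if x: "x \<in> K" for x
  proof (rule eq)
    show "a * x \<in> K" using D(4) a x by blast
    have "(\<lambda>n. \<nu> a * u x (Suc n)) \<longlonglongrightarrow> \<nu> a * \<mu> x"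
      by (intro tendsto_mult tendsto_const LIMSEQ_Suc lim x)
    moreover have "\<nu> a * u x (Suc n) = u (a * x) n" for n
    proof -
      have e: "a ^ Suc n * x = a ^ n * (a * x)" by (simp add: mult_ac)
      show ?thesis unfolding u_def e using pos by simp
    qed
    ultimately show "u (a * x) \<longlonglongrightarrow> \<nu> a * \<mu> x" by simp
  qed
  moreover have "\<mu> x = 0" if "x \<notin> K" for x using that by (simp add: \<mu>_def)
  ultimately show ?thesis using that by blast
qed

text \<open>An infimum of seminorms need not be subadditive or submultiplicative in general; in a
  chain, a single member is close to the infimum at \<open>x\<close> and at \<open>y\<close>
  simultaneously.\<close>

lemma pm_seminorm_INF:
  assumes K: "unital_subring K" and C: "C \<noteq> {}" "\<And>\<nu>. \<nu> \<in> C \<Longrightarrow> pm_seminorm K \<nu>"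
    and chain: "\<And>\<nu> \<mu>. \<nu> \<in> C \<Longrightarrow> \<mu> \<in> C \<Longrightarrow> (\<forall>x. \<nu> x \<le> \<mu> x) \<or> (\<forall>x. \<mu> x \<le> \<nu> x)"
  shows "pm_seminorm K (\<lambda>x. if x \<in> K then INF \<nu>\<in>C. \<nu> x else 0)" (is "pm_seminorm K ?u")
proof -
  note D = unital_subringD[OF K]
  have bdd: "bdd_below ((\<lambda>\<nu>. \<nu> x) ` C)" if "x \<in> K" for x
    using pm_seminormD(3)[OF C(2) that] by (intro bdd_belowI[of _ 0]) auto
  have lower: "?u x \<le> \<nu> x" if "x \<in> K" "\<nu> \<in> C" for x \<nu>
    using cINF_lower[OF bdd[OF that(1)] that(2)] that(1) by simp
  have nonneg: "0 \<le> ?u x" if "x \<in> K" for x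
    using C pm_seminormD(3)[OF C(2) that] that by (auto intro: cINF_greatest)
  have approx: "\<exists>\<nu>\<in>C. \<nu> x < s" if "x \<in> K" "?u x < s" for x s
    using that cINF_less_iff[OF C(1) bdd[OF that(1)]] by auto
  have approx2: "\<exists>\<nu>\<in>C. \<nu> x < s \<and> \<nu> y < t" if "x \<in> K" "?u x < s" "y \<in> K" "?u y < t" for x s y t
  proof -
    from approx[OF that(1,2)] obtain \<nu> where 1: "\<nu> \<in> C" "\<nu> x < s" ..
    from approx[OF that(3,4)] obtain \<mu> where 2: "\<mu> \<in> C" "\<mu> y < t" ..
    show ?thesis using chain[OF 1(1) 2(1)] 1 2 by (meson le_less_trans)
  qed
  show ?thesis unfolding pm_seminorm_def
  proof (intro conjI ballI allI)
    have "(\<lambda>\<nu>. \<nu> 0) ` C = {0}" "(\<lambda>\<nu>. \<nu> 1) ` C = {1}"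
      using C pm_seminormD(1,2)[OF C(2)] by force+
    then show "?u 0 = 0" "?u 1 = 1" using D(1,2) by auto
    show "0 \<le> ?u x" if "x \<in> K" for x by (rule nonneg[OF that])
    show "?u (x + y) \<le> ?u x + ?u y" if x: "x \<in> K" and y: "y \<in> K" for x y
    proof (rule field_le_epsilon)
      fix e :: real assume "0 < e"
      then obtain \<nu> where \<nu>: "\<nu> \<in> C" "\<nu> x < ?u x + e / 2" "\<nu> y < ?u y + e / 2"
        using approx2[OF x _ y, of "?u x + e / 2" "?u y + e / 2"] by auto
      have "?u (x + y) \<le> \<nu> (x + y)" by (rule lower[OF D(5)[OF x y] \<nu>(1)])
      also have "\<dots> \<le> \<nu> x + \<nu> y" by (rule pm_seminormD(4)[OF C(2)[OF \<nu>(1)] x y])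
      finally show "?u (x + y) \<le> ?u x + ?u y + e" using \<nu>(2,3) by linarith
    qed
    show "?u (x * y) \<le> ?u x * ?u y" if x: "x \<in> K" and y: "y \<in> K" for x y
    proof (rule le_mult_from_above[OF nonneg[OF x] nonneg[OF y]])
      fix s t assume "?u x < s" "?u y < t"
      then obtain \<nu> where \<nu>: "\<nu> \<in> C" "\<nu> x < s" "\<nu> y < t" using approx2[OF x _ y] by blast
      have "?u (x * y) \<le> \<nu> (x * y)" by (rule lower[OF D(4)[OF x y] \<nu>(1)])
      also have "\<dots> \<le> \<nu> x * \<nu> y" by (rule pm_seminormD(5)[OF C(2)[OF \<nu>(1)] x y])
      also have "\<dots> \<le> s * t"
        using \<nu> pm_seminormD(3)[OF C(2)[OF \<nu>(1)]] x y
        by (intro mult_mono) (auto intro: order_trans[OF _ less_imp_le])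
      finally show "?u (x * y) \<le> s * t" .
    qed
    show "?u (x ^ k) = ?u x ^ k" if x: "x \<in> K" for x k
    proof (cases "k = 0")
      case True
      have "?u 1 = 1" by fact
      then show ?thesis unfolding True power_0 .
    next
      case False
      have xk: "x ^ k \<in> K" by (rule unital_subring_power[OF K x])
      show ?thesis
      proof (rule antisym)
        show "?u x ^ k \<le> ?u (x ^ k)"
        proof -
          have "?u x ^ k \<le> \<nu> (x ^ k)" if "\<nu> \<in> C" for \<nu>
            using power_mono[OF lower[OF x that] nonneg[OF x], of k] pm_seminormD(6)[OF C(2)[OF that] x]
            by simp
          then show ?thesis using xk C(1) by (simp add: cINF_greatest)
        qed
        show "?u (x ^ k) \<le> ?u x ^ k"
        proof (rule tendsto_lowerbound)
          show "((\<lambda>e. (?u x + e) ^ k) \<longlongrightarrow> ?u x ^ k) (at_right 0)"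
            by (auto intro!: tendsto_eq_intros)
          show "\<forall>\<^sub>F e in at_right 0. ?u (x ^ k) \<le> (?u x + e) ^ k"
            using eventually_at_right_less
          proof (rule eventually_mono)
            fix e :: real assume "0 < e"
            then obtain \<nu> where \<nu>: "\<nu> \<in> C" "\<nu> x < ?u x + e" using approx[OF x, of "?u x + e"] by auto
            have "?u (x ^ k) \<le> \<nu> (x ^ k)" by (rule lower[OF xk \<nu>(1)])
            also have "\<dots> = \<nu> x ^ k" by (rule pm_seminormD(6)[OF C(2)[OF \<nu>(1)] x])
            also have "\<dots> \<le> (?u x + e) ^ k"
              using \<nu>(2) pm_seminormD(3)[OF C(2)[OF \<nu>(1)] x] by (intro power_mono) auto
            finally show "?u (x ^ k) \<le> (?u x + e) ^ k" .
          qed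
        qed auto
      qed
    qed
  qed
qed

text \<open>A minimal power-multiplicative seminorm on a field is multiplicative, because smoothing at any
  nonzero element cannot decrease it.\<close>

theorem absolute_value_below_pm_seminorm:
  fixes K :: "'a::field set"
  assumes K: "closed_subfield K" and \<nu>: "pm_seminorm K \<nu>" and b: "b \<in> K" "b \<noteq> 0"
  obtains v where "absolute_value_on K v" "\<forall>x\<in>K. v x \<le> \<nu> x" "v b = \<nu> b"
proof -
  have R: "unital_subring K" using K by (simp add: closed_subfield_def)
  note D = unital_subringD[OF R]
  \<comment> \<open>Smoothing at \<open>b\<close> comes before minimisation: it forces
    \<open>\<nu>' (inverse b)\<close> to be the reciprocal of \<open>\<nu> b\<close>, which later
    bounds \<open>v b\<close> from below.\<close>
  obtain \<nu>' where "pm_seminorm K \<nu>'" "\<forall>x\<in>K. \<nu>' x \<le> \<nu> x"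
    "\<forall>x\<in>K. \<nu>' (b * x) = \<nu> b * \<nu>' x" "\<forall>x. x \<notin> K \<longrightarrow> \<nu>' x = 0"
    by (rule pm_seminorm_smoothing[OF K \<nu> b])
  note \<nu>' = this(1) this(2)[rule_format] this(3)[rule_format] this(4)[rule_format]
  define A where "A = {\<mu>. pm_seminorm K \<mu> \<and> (\<forall>x. x \<notin> K \<longrightarrow> \<mu> x = 0) \<and> (\<forall>x. \<mu> x \<le> \<nu>' x)}"
  \<comment> \<open>The reversed order: a maximal element for \<open>P\<close> is a minimal
    seminorm.\<close>
  define P where "P = (\<lambda>\<mu> \<mu>' :: 'a \<Rightarrow> real. \<forall>x. \<mu>' x \<le> \<mu> x)"
  have "\<exists>m\<in>A. \<forall>\<mu>\<in>A. P m \<mu> \<longrightarrow> \<mu> = m"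
  proof (rule predicate_Zorn)
    show "partial_order_on A (relation_of P A)"
      unfolding partial_order_on_def preorder_on_def refl_on_def trans_def antisym_def relation_of_def P_def
      by (auto intro: order_trans antisym simp: fun_eq_iff)
    fix C assume C: "C \<in> Chains (relation_of P A)"
    then have CA: "C \<subseteq> A" and Cc: "\<And>\<mu> \<mu>'. \<mu> \<in> C \<Longrightarrow> \<mu>' \<in> C \<Longrightarrow> P \<mu> \<mu>' \<or> P \<mu>' \<mu>"
      by (auto simp: Chains_def relation_of_def)
    show "\<exists>u\<in>A. \<forall>a\<in>C. P a u"
    proof (cases "C = {}")
      case True
      then show ?thesis using \<nu>' by (intro bexI[of _ \<nu>']) (auto simp: A_def)
    next
      case False
      let ?u = "\<lambda>x. if x \<in> K then INF \<nu>\<in>C. \<nu> x else 0"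
      have pm: "pm_seminorm K ?u"
        using CA Cc False by (intro pm_seminorm_INF[OF R]) (auto simp: A_def P_def)
      have low: "?u x \<le> \<mu> x" if "\<mu> \<in> C" for \<mu> x
      proof (cases "x \<in> K")
        case True
        have "bdd_below ((\<lambda>\<nu>. \<nu> x) ` C)"
          using pm_seminormD(3)[OF _ True] CA by (intro bdd_belowI[of _ 0]) (auto simp: A_def)
        then show ?thesis using True cINF_lower[OF _ that] by auto
      next
        case False
        then show ?thesis using CA that by (auto simp: A_def)
      qed
      obtain \<mu> where "\<mu> \<in> C" using False by blast
      then have "\<mu> x \<le> \<nu>' x" for x using CA by (auto simp: A_def)
      then have "?u x \<le> \<nu>' x" for x using low[OF \<open>\<mu> \<in> C\<close>] by (rule order_trans[rotated])
      then have "?u \<in> A" using pm unfolding A_def by simp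
      then show ?thesis by (rule bexI[rotated]) (use low in \<open>auto simp: P_def\<close>)
    qed
  qed
  then obtain v where v: "v \<in> A" "\<And>\<mu>. \<mu> \<in> A \<Longrightarrow> P v \<mu> \<Longrightarrow> \<mu> = v" by blast
  have pm: "pm_seminorm K v" and vle: "\<And>x. v x \<le> \<nu>' x" and v0: "\<And>x. x \<notin> K \<Longrightarrow> v x = 0"
    using v(1) by (auto simp: A_def)
  note S = pm_seminormD[OF pm]
  have mult: "v (a * x) = v a * v x" if a: "a \<in> K" and x: "x \<in> K" for a x
  proof (cases "a = 0")
    case True
    then show ?thesis using S(1) by simp
  next
    case False
    obtain \<mu> where "pm_seminorm K \<mu>" "\<forall>x\<in>K. \<mu> x \<le> v x"
      "\<forall>x\<in>K. \<mu> (a * x) = v a * \<mu> x" "\<forall>x. x \<notin> K \<longrightarrow> \<mu> x = 0"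
      by (rule pm_seminorm_smoothing[OF K pm a False])
    note \<mu> = this(1) this(2)[rule_format] this(3)[rule_format] this(4)[rule_format]
    have le: "\<mu> y \<le> v y" for y using \<mu>(2,4) v0 by (cases "y \<in> K") auto
    have "\<mu> y \<le> \<nu>' y" for y by (rule order_trans[OF le vle])
    then have "\<mu> \<in> A" unfolding A_def using \<mu>(1,4) by auto
    moreover have "P v \<mu>" using le by (simp add: P_def)
    ultimately have "\<mu> = v" by (rule v(2))
    then show ?thesis using \<mu>(3)[OF x] by simp
  qed
  have vpos: "0 < v x" if "x \<in> K" "x \<noteq> 0" for x by (rule pm_seminorm_pos[OF K pm that])
  have abs: "absolute_value_on K v"
    unfolding absolute_value_on_def
  proof (intro conjI ballI)
    fix x assume x: "x \<in> K"
    show "0 \<le> v x" by (rule S(3)[OF x])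
    show "v x = 0 \<longleftrightarrow> x = 0" using S(1) vpos[OF x] by (metis less_irrefl)
  qed (use mult S(4) in auto)
  have "v b = \<nu> b"
  proof (rule antisym)
    show "v b \<le> \<nu> b" using vle[of b] \<nu>'(2)[OF b(1)] by linarith
    have ib: "inverse b \<in> K" using K b by (auto simp: closed_subfield_def)
    have "\<nu> b * \<nu>' (inverse b) = 1" using \<nu>'(3)[OF ib] pm_seminormD(2)[OF \<nu>'(1)] b by simp
    moreover have "v b * v (inverse b) = 1" using mult[OF b(1) ib] S(2) b by simp
    moreover have "v (inverse b) \<le> \<nu>' (inverse b)" by (rule vle)
    moreover have "0 < v b" "0 < v (inverse b)" using pm_seminorm_pos[OF K pm] b ib by auto
    ultimately have "\<nu> b * v (inverse b) \<le> v b * v (inverse b)"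
      using pm_seminorm_pos[OF K \<nu> b] by (metis less_imp_le mult_left_mono)
    then show "\<nu> b \<le> v b" using \<open>0 < v (inverse b)\<close> by simp
  qed
  moreover have "v x \<le> \<nu> x" if "x \<in> K" for x using vle[of x] \<nu>'(2)[OF that] by simp
  ultimately show ?thesis using that abs by blast
qed


section \<open>Number fields inside the algebraic closure of the rationals\<close>

text \<open>The type copies the closure built for rings with explicit carrier, whose algebraicity is
  known. The polynomial found there is pulled back along the representation; its coefficient list
  starts at the top degree, hence \<open>rev\<close>.\<close>

lemma alg_closure_algebraic:
  fixes x :: "'a::field alg_closure"
  shows "\<exists>p::'a poly. p \<noteq> 0 \<and> poly (map_poly to_ac p) x = 0"
proof -
  define K where "K \<equiv> (ring_of_type_algebra :: 'a ring)"
  define L where "L \<equiv> field.alg_closure K"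
  interpret K: field K
    unfolding K_def by rule
  interpret algebraic_closure L "range K.indexed_const"
  proof -
    have *: "carrier K = UNIV"
      by (auto simp: K_def ring_of_type_algebra_def)
    show "algebraic_closure L (range K.indexed_const)"
      unfolding * [symmetric] L_def by (rule K.alg_closureE)
  qed
  define y where "y = Rep_alg_closure x"
  have y: "y \<in> carrier L"
    using Rep_alg_closure[of x] unfolding y_def L_def K_def .
  have "subring (range K.indexed_const) L" by (rule subfieldE(1)[OF subfield_axioms])
  then obtain P where P: "P \<in> carrier (univ_poly L (range K.indexed_const))" "P \<noteq> []" "eval P y = \<zero>\<^bsub>L\<^esub>"
    using algebraicE[OF _ y algebraic_extension[OF y]] by blast
  have "set P \<subseteq> range K.indexed_const" "lead_coeff P \<noteq> \<zero>\<^bsub>L\<^esub>"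
    using P(1,2) unfolding univ_poly_carrier[symmetric] polynomial_def by auto
  then have "\<forall>c\<in>set P. \<exists>d. c = K.indexed_const d" by blast
  then obtain ys where ys: "P = map K.indexed_const ys"
    unfolding ex_map_conv[symmetric] ..
  have rep_to_ac: "Rep_alg_closure (to_ac c) = K.indexed_const c" for c
    unfolding K_def by (rule to_ac.rep_eq)
  have rep0: "Rep_alg_closure 0 = \<zero>\<^bsub>L\<^esub>" by (simp add: zero_alg_closure.rep_eq L_def K_def)
  have [simp]: "Rep_alg_closure z \<in> carrier L" for z
    using Rep_alg_closure[of z] by (simp only: L_def K_def)
  have [simp]: "Rep_alg_closure (z ^ n) = Rep_alg_closure z [^]\<^bsub>L\<^esub> n"
    for z :: "'a alg_closure" and n
    by (induction n)
       (auto simp: one_alg_closure.rep_eq times_alg_closure.rep_eq m_comm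
             simp flip: L_def K_def)
  have "eval (map Rep_alg_closure xs) y = Rep_alg_closure (poly (Poly (rev xs)) x)" for xs
    by (induction xs)
       (auto simp flip: K_def L_def simp: y_def
               zero_alg_closure.rep_eq plus_alg_closure.rep_eq
               times_alg_closure.rep_eq Poly_append poly_monom
               a_comm m_comm)
  from this[of "map to_ac ys"] have "Rep_alg_closure (poly (Poly (rev (map to_ac ys))) x) = Rep_alg_closure 0"
    using P(3) by (simp add: ys rep_to_ac comp_def rep0)
  then have root: "poly (Poly (rev (map to_ac ys))) x = 0" by (simp add: Rep_alg_closure_inject)
  define q where "q = Poly (rev ys)"
  have "map_poly to_ac q = Poly (rev (map to_ac ys))"
    unfolding q_def
    by (intro poly_eqI) (auto simp: coeff_map_poly nth_default_def rev_map)
  moreover have "q \<noteq> 0"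
  proof
    assume q: "q = 0"
    obtain z zs where zs: "ys = z # zs" using P(2) ys by (cases ys) auto
    have "Polynomial.coeff q (length zs) = z" unfolding q_def zs by (simp add: nth_default_append)
    then have "z = 0" using q by simp
    then have "K.indexed_const z = \<zero>\<^bsub>L\<^esub>" using rep_to_ac[of 0] rep0 by simp
    then show False using \<open>lead_coeff P \<noteq> \<zero>\<^bsub>L\<^esub>\<close> unfolding ys zs by simp
  qed
  ultimately show ?thesis using root by (intro exI[of _ q]) simp
qed

lemma to_ac_eq_of_rat: "to_ac (q::rat) = of_rat q"
proof (cases q)
  case (Fract a b)
  then have "q = of_int a / of_int b" by (simp add: Fract_of_int_quotient)
  then show ?thesis by (simp add: of_rat_divide)
qed

lemma qbar_algebraic: "\<exists>p::rat poly. p \<noteq> 0 \<and> poly (map_poly of_rat p) (x::qbar) = 0"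
proof -
  have "to_ac = (of_rat :: rat \<Rightarrow> qbar)" by (rule ext) (rule to_ac_eq_of_rat)
  then show ?thesis using alg_closure_algebraic[where ?'a = rat, of x] by simp
qed

text \<open>The scalar multiplication agrees literally with the one in
  \<open>degree_over_rat\<close>, so \<open>qv.dim\<close> is that degree.\<close>

interpretation qv: vector_space "\<lambda>(q::rat) (x::qbar). of_rat q * x"
  by unfold_locales (auto simp: algebra_simps of_rat_add of_rat_mult)

text \<open>Finite degree is expressed by containment in a finitely generated rational subspace, a
  condition that subfields inherit at once.\<close>

definition number_field :: "qbar set \<Rightarrow> bool" where
  "number_field K \<longleftrightarrow> closed_subfield K \<and> (\<exists>B. finite B \<and> K \<subseteq> qv.span B)"

lemma of_rat_in_subfield:
  assumes "closed_subfield K"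
  shows "(of_rat q :: 'a::field_char_0) \<in> K"
proof -
  have R: "unital_subring K" using assms by (simp add: closed_subfield_def)
  note D = unital_subringD[OF R]
  have nat: "of_nat n \<in> K" for n by (induction n) (auto intro: D)
  have int: "of_int n \<in> K" for n
    by (cases n rule: int_cases2) (auto intro: D nat)
  obtain a b where "q = of_int a / of_int b"
    by (cases q) (auto simp: Fract_of_int_quotient)
  then have "of_rat q = of_int a * (inverse (of_int b) :: 'a)"
    by (simp add: of_rat_divide field_simps)
  then show ?thesis using int D(4) assms by (auto simp: closed_subfield_def)
qed

lemma qv_span_mult:
  assumes "x \<in> qv.span A" "y \<in> qv.span B"
  shows "x * y \<in> qv.span {a * b |a b. a \<in> A \<and> b \<in> B}"
  using assms(1)
proof (induction rule: qv.span_induct_alt)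
  case base
  show ?case by (simp add: qv.span_zero)
next
  case (step c a x)
  have "a * y \<in> qv.span {a * b |a b. a \<in> A \<and> b \<in> B}"
    using assms(2)
  proof (induction rule: qv.span_induct_alt)
    case base
    show ?case by (simp add: qv.span_zero)
  next
    case (step d b y)
    have "a * b \<in> qv.span {a * b |a b. a \<in> A \<and> b \<in> B}"
      using \<open>a \<in> A\<close> step(1) by (intro qv.span_base) auto
    from qv.span_add[OF qv.span_scale[OF this, of d] step(2)] show ?case
      by (simp add: algebra_simps)
  qed
  from qv.span_add[OF qv.span_scale[OF this, of c] step(2)] show ?case
    by (simp add: algebra_simps)
qed

lemma qv_powers_span:
  fixes x :: qbar
  obtains m where "\<And>n. x ^ n \<in> qv.span ((\<lambda>i. x ^ i) ` {..<m})"
proof -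
  obtain p :: "rat poly" where p: "p \<noteq> 0" "poly (map_poly of_rat p) x = 0"
    using qbar_algebraic by blast
  define m where "m = Polynomial.degree p"
  let ?S = "qv.span ((\<lambda>i. x ^ i) ` {..<m})"
  have low: "x ^ i \<in> ?S" if "i < m" for i using that by (intro qv.span_base) auto
  define a where "a = Polynomial.coeff p m"
  have a: "a \<noteq> 0" using p(1) by (simp add: a_def m_def)
  have "(\<Sum>i\<le>m. of_rat (Polynomial.coeff p i) * x ^ i) = 0"
    using p(2) by (simp add: poly_altdef m_def coeff_map_poly degree_map_poly)
  then have e: "of_rat a * x ^ m + (\<Sum>i<m. of_rat (Polynomial.coeff p i) * x ^ i) = 0"
    by (simp add: lessThan_Suc_atMost[symmetric] a_def add.commute)
  have sumS: "(\<Sum>i<m. of_rat (Polynomial.coeff p i) * x ^ i) \<in> ?S"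
    by (intro qv.span_sum qv.span_scale low) auto
  have "of_rat a * x ^ m = - (\<Sum>i<m. of_rat (Polynomial.coeff p i) * x ^ i)"
    using e by (simp add: eq_neg_iff_add_eq_0)
  then have "of_rat a * x ^ m \<in> ?S" using qv.span_neg[OF sumS] by simp
  from qv.span_scale[OF this, of "inverse a"] have m: "x ^ m \<in> ?S"
    using a by (simp add: of_rat_inverse mult.assoc[symmetric])
  have mult: "x * y \<in> ?S" if "y \<in> ?S" for y
    using that
  proof (induction rule: qv.span_induct_alt)
    case base
    show ?case by (simp add: qv.span_zero)
  next
    case (step c z y)
    then obtain i where i: "z = x ^ i" "i < m" by auto
    have "x * z = x ^ Suc i" using i by simp
    also have "\<dots> \<in> ?S" using i low[of "Suc i"] m by (cases "Suc i = m") auto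
    finally have "of_rat c * (x * z) + x * y \<in> ?S" using step(2) by (intro qv.span_add qv.span_scale)
    then show ?case by (simp add: algebra_simps)
  qed
  have "x ^ n \<in> ?S" for n
  proof (induction n)
    case 0
    show ?case using low[of 0] m by (cases "m = 0") auto
  next
    case (Suc n)
    then show ?case using mult by simp
  qed
  then show ?thesis using that by blast
qed

text \<open>Adding one generator \<open>c\<close> at a time: the products of the old spanning set
  with the first \<open>m\<close> powers of \<open>c\<close> span a space that is again closed under
  multiplication.\<close>

lemma finite_rank_subring:
  assumes "finite (C :: qbar set)"
  shows "\<exists>B. finite B \<and> unital_subring (qv.span B) \<and> C \<subseteq> qv.span B"
  using assms
proof (induction C rule: finite_induct)
  case empty
  have sub: "{a * b |a b. a \<in> {1} \<and> b \<in> {1}} = {1::qbar}" by auto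
  have "unital_subring (qv.span {1})"
    unfolding unital_subring_def
    using qv.span_base[of 1 "{1}"] qv.span_diff qv_span_mult[of _ "{1}" _ "{1}"] unfolding sub by auto
  then show ?case by blast
next
  case (insert c C)
  then obtain B where B: "finite B" "unital_subring (qv.span B)" "C \<subseteq> qv.span B" by blast
  obtain m where m: "\<And>n. c ^ n \<in> qv.span ((\<lambda>i. c ^ i) ` {..<m})" using qv_powers_span by blast
  let ?P = "(\<lambda>i. c ^ i) ` {..<m}"
  define B' where "B' = {a * b |a b. a \<in> B \<and> b \<in> ?P}"
  have B'_eq: "B' = (\<lambda>(a, b). a * b) ` (B \<times> ?P)" unfolding B'_def by auto
  have fin: "finite B'" unfolding B'_eq using B(1) by simp
  have prod: "x * c ^ n \<in> qv.span B'" if "x \<in> qv.span B" for x n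
    unfolding B'_def by (rule qv_span_mult[OF that m])
  have one: "1 \<in> qv.span B" using B(2) unital_subringD by blast
  have "unital_subring (qv.span B')"
    unfolding unital_subring_def
  proof (intro conjI ballI)
    show "1 \<in> qv.span B'" using prod[OF one, of 0] by simp
    fix x y assume x: "x \<in> qv.span B'" and y: "y \<in> qv.span B'"
    show "x - y \<in> qv.span B'" by (rule qv.span_diff[OF x y])
    have "{a * b |a b. a \<in> B' \<and> b \<in> B'} \<subseteq> qv.span B'"
    proof safe
      fix a b assume "a \<in> B'" "b \<in> B'"
      then obtain a1 i b1 j where ab: "a = a1 * c ^ i" "b = b1 * c ^ j" "a1 \<in> B" "b1 \<in> B"
        unfolding B'_def by auto
      have "a1 * b1 \<in> qv.span B"
        using ab B(2) unital_subringD(4) qv.span_base by blast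
      from prod[OF this, of "i + j"] show "a * b \<in> qv.span B'"
        by (simp add: ab power_add algebra_simps)
    qed
    then have "qv.span {a * b |a b. a \<in> B' \<and> b \<in> B'} \<subseteq> qv.span B'"
      by (rule qv.span_minimal) (rule qv.subspace_span)
    then show "x * y \<in> qv.span B'" using qv_span_mult[OF x y] by blast
  qed
  moreover have "C \<subseteq> qv.span B'" using prod[of _ 0] B(3) by auto
  moreover have "c \<in> qv.span B'" using prod[OF one, of 1] by simp
  ultimately show ?case using fin by blast
qed

text \<open>Dividing an annihilating polynomial by powers of the variable leaves a nonzero constant
  term \<open>a\<close>; the remaining relation \<open>a + x * p(x) = 0\<close> exhibits the inverse
  as a polynomial in \<open>x\<close>.\<close>

lemma inverse_in_rational_subring:
  fixes x :: qbar
  assumes R: "unital_subring R" and scale: "\<And>q z. z \<in> R \<Longrightarrow> of_rat q * z \<in> R"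
    and x: "x \<in> R" "x \<noteq> 0"
  shows "inverse x \<in> R"
proof -
  note D = unital_subringD[OF R]
  have peval: "poly (map_poly of_rat p) x \<in> R" for p :: "rat poly"
    unfolding poly_altdef
    by (intro unital_subring_sum[OF R]) (auto simp: coeff_map_poly intro!: scale unital_subring_power[OF R x(1)])
  obtain p :: "rat poly" where "p \<noteq> 0" "poly (map_poly of_rat p) x = 0" using qbar_algebraic by blast
  then show ?thesis
  proof (induction p)
    case (pCons a p)
    have e: "of_rat a + x * poly (map_poly of_rat p) x = 0"
      using pCons.prems by (simp add: map_poly_pCons)
    show ?case
    proof (cases "a = 0")
      case True
      then show ?thesis using e x pCons by auto
    next
      case False
      have "inverse x = of_rat (- inverse a) * poly (map_poly of_rat p) x"
      proof -
        have "x * (of_rat (- inverse a) * poly (map_poly of_rat p) x) =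
            of_rat (- inverse a) * (x * poly (map_poly of_rat p) x)" by (simp add: mult_ac)
        also have "x * poly (map_poly of_rat p) x = - of_rat a" using e by (simp add: eq_neg_iff_add_eq_0 add.commute)
        also have "of_rat (- inverse a) * - of_rat a = (1 :: qbar)"
          using False by (simp add: of_rat_minus of_rat_inverse)
        finally show ?thesis by (rule inverse_unique)
      qed
      then show ?thesis by (simp only: scale[OF peval])
    qed
  qed simp
qed

text \<open>The ring of finite rank generated by \<open>C\<close> is already a field, because
  inverses of its elements are polynomials in them.\<close>

theorem number_field_containing:
  assumes "finite (C :: qbar set)"
  obtains K where "number_field K" "C \<subseteq> K"
proof -
  obtain B where B: "finite B" "unital_subring (qv.span B)" "C \<subseteq> qv.span B"
    using finite_rank_subring[OF assms] by blast
  have "inverse x \<in> qv.span B" if "x \<in> qv.span B" for x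
  proof (cases "x = 0")
    case True
    then show ?thesis using that by simp
  next
    case False
    then show ?thesis using that by (intro inverse_in_rational_subring[OF B(2)] qv.span_scale)
  qed
  then have "number_field (qv.span B)"
    using B unfolding number_field_def closed_subfield_def by blast
  then show ?thesis using that B(3) by blast
qed

section \<open>Bases and degrees of number fields\<close>

lemma number_fieldD:
  assumes "number_field K"
  shows "closed_subfield K" "unital_subring K" "of_rat q \<in> K" "x \<in> K \<Longrightarrow> of_rat q * x \<in> K"
    "x \<in> K \<Longrightarrow> inverse x \<in> K"
proof -
  show K: "closed_subfield K" using assms by (simp add: number_field_def)
  then show R: "unital_subring K" by (simp add: closed_subfield_def)
  show q: "of_rat q \<in> K" by (rule of_rat_in_subfield[OF K])
  show "x \<in> K \<Longrightarrow> of_rat q * x \<in> K" using unital_subringD(4)[OF R q] .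
  show "x \<in> K \<Longrightarrow> inverse x \<in> K" using K by (simp add: closed_subfield_def)
qed

lemma number_field_subset:
  assumes "number_field L" "closed_subfield K" "K \<subseteq> L"
  shows "number_field K"
  using assms unfolding number_field_def by blast

lemma number_field_basis:
  assumes "number_field K"
  obtains b :: "nat \<Rightarrow> qbar" where "\<forall>i<degree_over_rat K. b i \<in> K"
    "\<forall>x\<in>K. \<exists>c. x = (\<Sum>i<degree_over_rat K. of_rat (c i) * b i)"
    "\<forall>c. (\<Sum>i<degree_over_rat K. of_rat (c i) * b i) = 0 \<longrightarrow> (\<forall>i<degree_over_rat K. c i = 0)"
proof -
  obtain B where B: "B \<subseteq> K" "qv.independent B" "K \<subseteq> qv.span B" "card B = qv.dim K"
    using qv.basis_exists by blast
  obtain B0 where "finite B0" "K \<subseteq> qv.span B0" using assms unfolding number_field_def by blast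
  then have fin: "finite B" using qv.independent_span_bound[OF _ B(2)] B(1) by blast
  have D: "degree_over_rat K = card B" using B(4) by (simp add: degree_over_rat_def)
  obtain b where b: "bij_betw b {..<card B} B"
    using ex_bij_betw_nat_finite[OF fin] by (auto simp: atLeast0LessThan)
  have reindex: "(\<Sum>i<card B. of_rat (u (b i)) * b i) = (\<Sum>v\<in>B. of_rat (u v) * v)" for u :: "qbar \<Rightarrow> rat"
    using sum.reindex_bij_betw[OF b, of "\<lambda>v. of_rat (u v) * v"] .
  show ?thesis
  proof (rule that[of b], unfold D)
    show "\<forall>i<card B. b i \<in> K" using b B(1) by (auto simp: bij_betw_def)
    show "\<forall>x\<in>K. \<exists>c. x = (\<Sum>i<card B. of_rat (c i) * b i)"
    proof
      fix x assume "x \<in> K"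
      then have "x \<in> range (\<lambda>u. \<Sum>v\<in>B. of_rat (u v) * v)" using B(3) qv.span_finite[OF fin] by blast
      then obtain u where "x = (\<Sum>v\<in>B. of_rat (u v) * v)" by blast
      then show "\<exists>c. x = (\<Sum>i<card B. of_rat (c i) * b i)"
        using reindex[of u] by (intro exI[of _ "u \<circ> b"]) simp
    qed
    show "\<forall>c. (\<Sum>i<card B. of_rat (c i) * b i) = 0 \<longrightarrow> (\<forall>i<card B. c i = 0)"
    proof (intro allI impI)
      fix c i assume c: "(\<Sum>i<card B. of_rat (c i) * b i) = 0" and i: "i < card B"
      define u where "u = c \<circ> the_inv_into {..<card B} b"
      have u: "u (b j) = c j" if "j < card B" for j
        using that b by (simp add: u_def the_inv_into_f_f bij_betw_def)
      have "(\<Sum>i<card B. of_rat (u (b i)) * b i) = (\<Sum>i<card B. of_rat (c i) * b i)"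
        by (rule sum.cong) (simp_all add: u)
      then have "(\<Sum>v\<in>B. of_rat (u v) * v) = 0" using c reindex[of u] by simp
      then have "u (b i) = 0"
        using qv.independentD[OF B(2) fin, of u "b i"] i b by (auto simp: bij_betw_def)
      then show "c i = 0" using u[OF i] by simp
    qed
  qed
qed

lemma degree_over_rat_pos:
  assumes "number_field K"
  shows "0 < degree_over_rat K"
proof (rule ccontr)
  assume "\<not> 0 < degree_over_rat K"
  then have D: "degree_over_rat K = 0" by simp
  obtain b where "\<forall>x\<in>K. \<exists>c. x = (\<Sum>i<degree_over_rat K. of_rat (c i) * b i)"
    using number_field_basis[OF assms] by metis
  then have "x = 0" if "x \<in> K" for x using that by (simp add: D)
  then show False using unital_subringD(1)[OF number_fieldD(2)[OF assms]] by fastforce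
qed

lemma degree_over_rat_mono:
  assumes "number_field L" "K \<subseteq> L"
  shows "degree_over_rat K \<le> degree_over_rat L"
proof -
  obtain B where B: "B \<subseteq> L" "qv.independent B" "L \<subseteq> qv.span B" "card B = qv.dim L"
    using qv.basis_exists by blast
  obtain B0 where "finite B0" "L \<subseteq> qv.span B0" using assms unfolding number_field_def by blast
  then have fin: "finite B" using qv.independent_span_bound[OF _ B(2)] B(1) by blast
  have "qv.dim K \<le> card B" using qv.dim_le_card[OF _ fin] assms(2) B(3) by blast
  then show ?thesis using B(4) by (simp add: degree_over_rat_def)
qed

text \<open>Dependence of a family, where the vector space notion concerns sets; a repeated vector
  gives the relation with coefficients 1 and -1.\<close>

lemma number_field_dependent:
  assumes K: "number_field K" and e: "\<And>i. i < r \<Longrightarrow> e i \<in> K" and r: "degree_over_rat K < r"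
  obtains c :: "nat \<Rightarrow> rat" and j where "(\<Sum>i<r. of_rat (c i) * e i) = 0" "j < r" "c j \<noteq> 0"
proof -
  obtain B where B: "B \<subseteq> K" "qv.independent B" "K \<subseteq> qv.span B" "card B = qv.dim K"
    using qv.basis_exists by blast
  obtain B0 where "finite B0" "K \<subseteq> qv.span B0" using K unfolding number_field_def by blast
  then have fin: "finite B" using qv.independent_span_bound[OF _ B(2)] B(1) by blast
  show ?thesis
  proof (cases "inj_on e {..<r}")
    case False
    then obtain i j where ij: "i < r" "j < r" "i \<noteq> j" "e i = e j" by (auto simp: inj_on_def)
    let ?c = "\<lambda>k. if k = i then 1 else if k = j then - 1 else (0::rat)"
    have "(\<Sum>k<r. of_rat (?c k) * e k) = (\<Sum>k\<in>{i, j}. of_rat (?c k) * e k)"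
      using ij by (intro sum.mono_neutral_right) auto
    also have "\<dots> = 0" using ij by (simp add: of_rat_minus)
    finally show ?thesis using that[of ?c i] ij by auto
  next
    case True
    let ?E = "e ` {..<r}"
    have card: "card ?E = r" using card_image[OF True] by simp
    have "\<not> qv.independent ?E"
    proof
      assume "qv.independent ?E"
      moreover have "?E \<subseteq> qv.span B" using e B(3) by auto
      ultimately have "card ?E \<le> card B" using qv.independent_span_bound[OF fin] by blast
      then show False using r card B(4) by (simp add: degree_over_rat_def)
    qed
    then obtain u v where u: "(\<Sum>v\<in>?E. of_rat (u v) * v) = 0" "v \<in> ?E" "u v \<noteq> 0"
      using qv.dependent_finite[of ?E] by auto
    from u(2) obtain j where j: "j < r" "v = e j" by auto
    have "(\<Sum>i<r. of_rat (u (e i)) * e i) = 0"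
      using u(1) sum.reindex[OF True, of "\<lambda>v. of_rat (u v) * v"] by simp
    then show ?thesis using that[of "u \<circ> e" j] j u(3) by auto
  qed
qed


section \<open>Places of the rationals\<close>

text \<open>\<open>padic_abs\<close> is defined from the reduced fraction; cross-multiplication
  shows that any other fraction gives the same exponent.\<close>

lemma padic_abs_frac:
  assumes p: "Factorial_Ring.prime p" and ab: "a \<noteq> 0" "b \<noteq> 0"
  shows "padic_abs p (of_int a / of_int b) =
    real p powi (int (multiplicity (int p) b) - int (multiplicity (int p) a))"
proof -
  have pe: "prime_elem (int p)" using p by (simp add: prime_imp_prime_elem)
  obtain n d where nd: "quotient_of (of_int a / of_int b) = (n, d)" by fastforce
  have d: "d > 0" using quotient_of_denom_pos[OF nd] .
  have eq: "(of_int a / of_int b :: rat) = of_int n / of_int d" by (rule quotient_of_div[OF nd])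
  then have "(of_int (a * d) :: rat) = of_int (n * b)"
    using ab d by (simp add: field_simps)
  then have e: "a * d = n * b" by (simp only: of_int_eq_iff)
  have n: "n \<noteq> 0" using e ab d by auto
  have "multiplicity (int p) a + multiplicity (int p) d = multiplicity (int p) n + multiplicity (int p) b"
    using arg_cong[OF e, of "multiplicity (int p)"] ab d n pe
    by (simp add: prime_elem_multiplicity_mult_distrib)
  then have "int (multiplicity (int p) d) - int (multiplicity (int p) n) =
      int (multiplicity (int p) b) - int (multiplicity (int p) a)" by linarith
  then show ?thesis using nd ab unfolding padic_abs_def by simp
qed

lemma rat_frac_cases:
  obtains a b where "(q::rat) = of_int a / of_int b" "b > 0"
  by (cases q) (auto simp: Fract_of_int_quotient)

lemma padic_abs_mult:
  assumes p: "Factorial_Ring.prime p"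
  shows "padic_abs p (x * y) = padic_abs p x * padic_abs p y"
proof (cases "x = 0 \<or> y = 0")
  case False
  obtain a b where x: "x = of_int a / of_int b" "b > 0" using rat_frac_cases .
  obtain c d where y: "y = of_int c / of_int d" "d > 0" using rat_frac_cases .
  have nz: "a \<noteq> 0" "c \<noteq> 0" using False x y by auto
  have pe: "prime_elem (int p)" using p by (simp add: prime_imp_prime_elem)
  have p0: "real p \<noteq> 0" using p by (auto simp: prime_gt_0_nat)
  have xy: "x * y = of_int (a * c) / of_int (b * d)" using x y by simp
  show ?thesis unfolding xy unfolding x y
    using nz x(2) y(2) pe p0
    by (subst (1 2 3) padic_abs_frac[OF p])
       (auto simp: prime_elem_multiplicity_mult_distrib power_int_add[symmetric] algebra_simps simp del: of_int_mult)
qed (auto simp: padic_abs_def)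

lemma padic_abs_pos:
  assumes p: "Factorial_Ring.prime p" and "x \<noteq> 0"
  shows "0 < padic_abs p x"
  using assms prime_gt_0_nat[OF p] by (simp add: padic_abs_def)

lemma padic_abs_0 [simp]: "padic_abs p 0 = 0"
  by (simp add: padic_abs_def)

lemma padic_abs_nonneg: "Factorial_Ring.prime p \<Longrightarrow> 0 \<le> padic_abs p x"
  using padic_abs_pos[of p x] by (cases "x = 0") auto

lemma padic_abs_add:
  assumes p: "Factorial_Ring.prime p"
  shows "padic_abs p (x + y) \<le> max (padic_abs p x) (padic_abs p y)"
proof (cases "x = 0 \<or> y = 0 \<or> x + y = 0")
  case True
  then show ?thesis using padic_abs_nonneg[OF p] by (auto simp: max_def)
next
  case False
  obtain a b where x: "x = of_int a / of_int b" "b > 0" using rat_frac_cases .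
  obtain c d where y: "y = of_int c / of_int d" "d > 0" using rat_frac_cases .
  define e where "e = b * d"
  have e: "e \<noteq> 0" using x y by (simp add: e_def)
  have x': "x = of_int (a * d) / of_int e" and y': "y = of_int (c * b) / of_int e"
    using x y by (auto simp: e_def)
  have xy: "x + y = of_int (a * d + c * b) / of_int e" unfolding x' y' by (simp add: add_divide_distrib)
  have "a * d \<noteq> 0" "c * b \<noteq> 0" using False x' y' by auto
  moreover have "a * d + c * b \<noteq> 0" using False xy by (metis div_0 of_int_0)
  ultimately have nz: "a * d \<noteq> 0" "c * b \<noteq> 0" "a * d + c * b \<noteq> 0" by blast+
  define m where "m = min (multiplicity (int p) (a * d)) (multiplicity (int p) (c * b))"
  have p1: "1 < p" by (rule prime_gt_1_nat[OF p])
  have "int p ^ m dvd a * d" "int p ^ m dvd c * b"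
    unfolding m_def by (auto intro: multiplicity_dvd')
  then have "int p ^ m dvd a * d + c * b" by simp
  then have "m \<le> multiplicity (int p) (a * d + c * b)"
    using nz p1 by (intro multiplicity_geI) auto
  then have "padic_abs p (x + y) \<le> real p powi (int (multiplicity (int p) e) - int m)"
    unfolding xy using p1 by (subst padic_abs_frac[OF p nz(3) e]) (intro power_int_increasing, auto)
  also have "\<dots> \<le> max (padic_abs p x) (padic_abs p y)"
    unfolding x' y' padic_abs_frac[OF p nz(1) e] padic_abs_frac[OF p nz(2) e] m_def
    by (auto simp: min_def max_def)
  finally show ?thesis .
qed

lemma padic_abs_of_int_le_1:
  assumes p: "Factorial_Ring.prime p"
  shows "padic_abs p (of_int n) \<le> 1"
proof (cases "n = 0")
  case False
  have "padic_abs p (of_int n / of_int 1) \<le> real p powi 0"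
    using prime_gt_1_nat[OF p] power_int_increasing[of "- int (multiplicity (int p) n)" 0 "real p"]
    by (subst padic_abs_frac[OF p False]) auto
  then show ?thesis by simp
qed simp

text \<open>The normalised places of the rationals, exactly those whose extensions make up
  \<open>places\<close>.\<close>

definition rat_place :: "(rat \<Rightarrow> real) \<Rightarrow> bool" where
  "rat_place w \<longleftrightarrow> w = (\<lambda>q. of_rat \<bar>q\<bar>) \<or> (\<exists>p. Factorial_Ring.prime p \<and> w = padic_abs p)"

lemma rat_place_abs:
  assumes "rat_place w"
  shows "w 0 = 0" "w 1 = 1" "0 \<le> w q" "w q = 0 \<longleftrightarrow> q = 0" "w (q * r) = w q * w r" "w (q + r) \<le> w q + w r"
    "w (inverse q) = inverse (w q)" "w (- q) = w q"
proof -
  have basic: "w 0 = 0 \<and> w q \<ge> 0 \<and> (w q = 0 \<longleftrightarrow> q = 0) \<and> w (q * r) = w q * w r \<and> w (q + r) \<le> w q + w r" for q r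
  proof (cases "w = (\<lambda>q. of_rat \<bar>q\<bar>)")
    case True
    have "of_rat \<bar>q + r\<bar> \<le> (of_rat \<bar>q\<bar> + of_rat \<bar>r\<bar> :: real)"
      by (simp add: of_rat_add[symmetric] of_rat_less_eq abs_triangle_ineq)
    then show ?thesis using True by (simp add: abs_mult of_rat_mult)
  next
    case False
    then obtain p where p: "Factorial_Ring.prime p" "w = padic_abs p" using assms by (auto simp: rat_place_def)
    have "padic_abs p (q + r) \<le> padic_abs p q + padic_abs p r"
      using padic_abs_add[OF p(1), of q r] padic_abs_nonneg[OF p(1), of q] padic_abs_nonneg[OF p(1), of r]
      by linarith
    moreover have "padic_abs p q = 0 \<longleftrightarrow> q = 0" using padic_abs_pos[OF p(1), of q] by (cases "q = 0") auto
    ultimately show ?thesis using p padic_abs_mult padic_abs_nonneg by auto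
  qed
  show "w 0 = 0" "0 \<le> w q" "w q = 0 \<longleftrightarrow> q = 0" "w (q * r) = w q * w r" "w (q + r) \<le> w q + w r"
    using basic by auto
  have "w 1 * w 1 = w 1" using basic[of 1 1] by (metis mult_1)
  moreover have "w 1 \<noteq> 0" using basic[of 1] by simp
  ultimately show one: "w 1 = 1" by simp
  show "w (inverse q) = inverse (w q)"
  proof (cases "q = 0")
    case False
    then have "w q * w (inverse q) = 1" using one basic[of q "inverse q"] by simp
    then show ?thesis by (metis inverse_unique)
  qed (use basic in simp)
  have "w (-1) * w (-1) = 1" using basic[of "-1" "-1"] one by simp
  then have "w (-1) = 1" using basic[of "-1"] by (metis abs_of_nonneg abs_square_eq_1 power2_eq_square)
  then show "w (- q) = w q" using basic[of "-1" q] by simp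
qed

text \<open>The values include all integral powers of some \<open>c = w \<pi>\<close> above 1, where
  2 or the inverse of \<open>p\<close> can serve as \<open>\<pi>\<close>; an interval whose ends
  have ratio above \<open>c\<close> contains one of them.\<close>

lemma rat_place_power_between:
  assumes "rat_place w"
  obtains c where "1 < c" "\<And>a b. 0 < a \<Longrightarrow> a * c < b \<Longrightarrow> \<exists>q. q \<noteq> 0 \<and> a < w q \<and> w q < b"
proof -
  note W = rat_place_abs[OF assms]
  have "\<exists>\<pi>. 1 < w \<pi>"
  proof (cases "w = (\<lambda>q. of_rat \<bar>q\<bar>)")
    case True
    then show ?thesis by (intro exI[of _ 2]) simp
  next
    case False
    then obtain p where p: "Factorial_Ring.prime p" "w = padic_abs p" using assms by (auto simp: rat_place_def)
    have "p \<noteq> 0" using prime_gt_0_nat[OF p(1)] by simp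
    have "padic_abs p (of_int 1 / of_int (int p)) = real p powi (int (multiplicity (int p) (int p)) - int (multiplicity (int p) 1))"
      using \<open>p \<noteq> 0\<close> by (intro padic_abs_frac[OF p(1)]) auto
    also have "\<dots> = real p" using prime_gt_1_nat[OF p(1)] p(1)
      by (simp add: multiplicity_self)
    finally have "1 < w (of_int 1 / of_int (int p))" using p(2) prime_gt_1_nat[OF p(1)] by simp
    then show ?thesis by blast
  qed
  then obtain \<pi> where \<pi>: "1 < w \<pi>" by blast
  define c where "c = w \<pi>"
  have c: "1 < c" using \<pi> by (simp add: c_def)
  have wpow: "w (\<pi> powi k) = c powi k" for k
  proof -
    have pow: "w (r ^ n) = w r ^ n" for r n by (induction n) (auto simp: W)
    show ?thesis unfolding power_int_def c_def by (simp add: pow W)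
  qed
  show ?thesis
  proof (rule that[OF c])
    fix a b :: real assume a: "0 < a" and b: "a * c < b"
    define k where "k = \<lfloor>log c a\<rfloor> + 1"
    have k: "log c a < real_of_int k" "real_of_int k \<le> log c a + 1" unfolding k_def by linarith+
    have powi: "c powi k = c powr real_of_int k" using c by (simp add: powr_real_of_int')
    have "a < c powi k"
    proof -
      have "a = c powr log c a" using a c by simp
      also have "\<dots> < c powr real_of_int k" using c k by (intro powr_less_mono) auto
      finally show ?thesis using powi by simp
    qed
    moreover have "c powi k < b"
    proof -
      have "c powr real_of_int k \<le> c powr (log c a + 1)" using c k by (intro powr_mono) auto
      also have "\<dots> = a * c" using a c by (simp add: powr_add)
      finally show ?thesis using powi b by simp
    qed
    moreover have "\<pi> powi k \<noteq> 0" using \<pi> W(1) by auto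
    ultimately show "\<exists>q. q \<noteq> 0 \<and> a < w q \<and> w q < b" using wpow by metis
  qed
qed

section \<open>Elementary properties of absolute values on subfields\<close>

locale valued_subfield =
  fixes K :: "'a::field set" and v :: "'a \<Rightarrow> real"
  assumes K: "closed_subfield K" and v: "absolute_value_on K v"
begin

lemma R: "unital_subring K" using K by (simp add: closed_subfield_def)

lemmas K_closed = unital_subringD[OF R] unital_subring_power[OF R]

lemma inverse_closed: "x \<in> K \<Longrightarrow> inverse x \<in> K" using K by (simp add: closed_subfield_def)

lemma nonneg: "x \<in> K \<Longrightarrow> 0 \<le> v x" and zero_iff: "x \<in> K \<Longrightarrow> v x = 0 \<longleftrightarrow> x = 0"
  and mult: "x \<in> K \<Longrightarrow> y \<in> K \<Longrightarrow> v (x * y) = v x * v y"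
  and add: "x \<in> K \<Longrightarrow> y \<in> K \<Longrightarrow> v (x + y) \<le> v x + v y"
  using v by (auto simp: absolute_value_on_def)

lemma zero: "v 0 = 0" using zero_iff K_closed(2) by blast

lemma pos: "x \<in> K \<Longrightarrow> x \<noteq> 0 \<Longrightarrow> 0 < v x" using nonneg zero_iff by force

lemma one: "v 1 = 1"
proof -
  have "v 1 * v 1 = v 1" using mult[of 1 1] K_closed(1) by simp
  moreover have "v 1 \<noteq> 0" using zero_iff K_closed(1) by simp
  ultimately show ?thesis by simp
qed

lemma power: "x \<in> K \<Longrightarrow> v (x ^ n) = v x ^ n"
  by (induction n) (auto simp: one mult K_closed)

lemma inverse: "x \<in> K \<Longrightarrow> v (inverse x) = inverse (v x)"
proof (cases "x = 0")
  case False
  assume x: "x \<in> K"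
  have "v x * v (inverse x) = 1" using mult[OF x inverse_closed[OF x]] one False by simp
  then show ?thesis by (metis inverse_unique)
qed (simp add: zero)

lemma uminus: "x \<in> K \<Longrightarrow> v (- x) = v x"
proof -
  assume x: "x \<in> K"
  have m1: "- 1 \<in> K" by (rule K_closed(6)[OF K_closed(1)])
  have "v (-1) * v (-1) = 1" using mult[OF m1 m1] one by simp
  then have "v (-1) = 1" using nonneg[OF m1] by (metis abs_of_nonneg abs_square_eq_1 power2_eq_square)
  then show ?thesis using mult[OF m1 x] by simp
qed

lemma diff: "x \<in> K \<Longrightarrow> y \<in> K \<Longrightarrow> v (x - y) \<le> v x + v y"
  using add[of x "- y"] uminus[of y] K_closed(6)[of y] by simp

lemma diff_ge: "x \<in> K \<Longrightarrow> y \<in> K \<Longrightarrow> v x - v y \<le> v (x + y)"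
  using diff[of "x + y" y] K_closed(5)[of x y] by simp

lemma sum_le: "(\<And>i. i \<in> A \<Longrightarrow> g i \<in> K) \<Longrightarrow> v (sum g A) \<le> (\<Sum>i\<in>A. v (g i))"
proof (induction A rule: infinite_finite_induct)
  case (insert a A)
  have "sum g A \<in> K" using insert by (intro unital_subring_sum[OF R]) auto
  then show ?case using insert add[of "g a" "sum g A"] by auto
qed (auto simp: zero)

end

text \<open>The binomial theorem bounds \<open>v (x + y) ^ n\<close> by \<open>n + 1\<close> times
  \<open>M ^ n\<close>, and the linear factor is lost in the comparison of exponentials.\<close>

lemma valued_subfield_ultrametric:
  fixes K :: "'a::field_char_0 set"
  assumes vs: "valued_subfield K v" and nat: "\<And>n. v (of_nat n) \<le> 1" and xy: "x \<in> K" "y \<in> K"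
  shows "v (x + y) \<le> max (v x) (v y)"
proof -
  interpret valued_subfield K v by fact
  define M where "M = max (v x) (v y)"
  have M: "0 \<le> M" "v x \<le> M" "v y \<le> M" using nonneg[OF xy(1)] by (auto simp: M_def)
  have natK: "of_nat n \<in> K" for n by (induction n) (auto intro: K_closed)
  have bound: "v (x + y) ^ n \<le> real (Suc n) * M ^ n" for n
  proof -
    have mem: "of_nat (n choose k) * x ^ k * y ^ (n - k) \<in> K" for k
      by (intro K_closed(4) K_closed(7) natK xy)
    have "v (x + y) ^ n = v (\<Sum>k\<le>n. of_nat (n choose k) * x ^ k * y ^ (n - k))"
      using power[of "x + y" n] K_closed(5)[OF xy] by (simp add: binomial_ring)
    also have "\<dots> \<le> (\<Sum>k\<le>n. v (of_nat (n choose k) * x ^ k * y ^ (n - k)))"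
      by (rule sum_le) (rule mem)
    also have "\<dots> \<le> (\<Sum>k\<le>n. M ^ n)"
    proof (rule sum_mono)
      fix k assume k: "k \<in> {..n}"
      have "v (of_nat (n choose k) * x ^ k * y ^ (n - k)) = v (of_nat (n choose k)) * v x ^ k * v y ^ (n - k)"
        using natK xy by (simp add: mult power K_closed)
      also have "\<dots> \<le> 1 * M ^ k * M ^ (n - k)"
        using nat M nonneg natK xy
        by (intro mult_mono power_mono mult_nonneg_nonneg zero_le_power) auto
      also have "\<dots> = M ^ n" using k by (simp add: power_add[symmetric])
      finally show "v (of_nat (n choose k) * x ^ k * y ^ (n - k)) \<le> M ^ n" .
    qed
    finally show ?thesis by simp
  qed
  show ?thesis
  proof (rule ccontr)
    assume "\<not> ?thesis"
    then have lt: "M < v (x + y)" unfolding M_def by linarith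
    have "M \<noteq> 0" using bound[of 1] lt by auto
    then have M0: "0 < M" using M(1) by simp
    define t where "t = v (x + y) / M"
    have t: "1 < t" using lt M0 by (simp add: t_def)
    have tb: "t ^ n \<le> real (Suc n)" for n
      using bound[of n] M0 by (simp add: t_def power_divide field_simps)
    have "(\<lambda>n. real (Suc n) / t ^ n) \<longlonglongrightarrow> 0" using t by real_asymp
    then have "eventually (\<lambda>n. real (Suc n) / t ^ n < 1) sequentially"
      by (rule order_tendstoD) simp
    then obtain n where "real (Suc n) / t ^ n < 1" by (auto simp: eventually_sequentially)
    then show False using tb[of n] t by (simp add: field_simps)
  qed
qed


section \<open>Finiteness of the places above a rational place\<close>

definition extends_abs :: "qbar set \<Rightarrow> (rat \<Rightarrow> real) \<Rightarrow> (qbar \<Rightarrow> real) \<Rightarrow> bool" where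
  "extends_abs K w v \<longleftrightarrow> absolute_value_on K v \<and> (\<forall>q. v (of_rat q) = w q)"

lemma extends_abs_valued:
  assumes "closed_subfield K" "extends_abs K w v"
  shows "valued_subfield K v"
  using assms by (simp add: valued_subfield_def extends_abs_def)

text \<open>Since both extend the same \<open>w\<close>, a difference at one element can be
  amplified: at a high power of \<open>y\<close> the two values differ by a factor above
  \<open>c\<close>, and division by a rational of intermediate value puts 1 between them.\<close>

lemma absolute_values_separated:
  assumes K: "closed_subfield K" and w: "rat_place w"
    and u: "extends_abs K w u" and v: "extends_abs K w v" and x: "x \<in> K" "u x \<noteq> v x"
  obtains z where "z \<in> K" "1 < u z" "v z < 1"
proof -
  interpret U: valued_subfield K u by (rule extends_abs_valued[OF K u])
  interpret V: valued_subfield K v by (rule extends_abs_valued[OF K v])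
  have ext: "u (of_rat q) = w q" "v (of_rat q) = w q" for q using u v by (auto simp: extends_abs_def)
  have x0: "x \<noteq> 0" using x(2) U.zero V.zero by auto
  obtain y where y: "y \<in> K" "v y < u y" "y \<noteq> 0"
  proof (cases "v x < u x")
    case True
    then show ?thesis using that x x0 by blast
  next
    case False
    have "u x < v x" using False x by simp
    then have "inverse (v x) < inverse (u x)" using U.pos[OF x(1) x0] by (rule less_imp_inverse_less)
    then show ?thesis using that[of "inverse x"] U.inverse[OF x(1)] V.inverse[OF x(1)]
        U.inverse_closed[OF x(1)] x0 by simp
  qed
  have vy: "0 < v y" by (rule V.pos[OF y(1,3)])
  obtain c where c: "1 < c" "\<And>a b. 0 < a \<Longrightarrow> a * c < b \<Longrightarrow> \<exists>q. q \<noteq> 0 \<and> a < w q \<and> w q < b"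
    using rat_place_power_between[OF w] by metis
  have "1 < u y / v y" using y vy by simp
  then obtain n where n: "c < (u y / v y) ^ n" using real_arch_pow by blast
  then have "v y ^ n * c < u y ^ n" using vy by (simp add: field_simps)
  then obtain q where q: "q \<noteq> 0" "v y ^ n < w q" "w q < u y ^ n" using c(2)[of "v y ^ n" "u y ^ n"] vy by auto
  define z where "z = y ^ n * of_rat (inverse q)"
  have qK: "of_rat (inverse q) \<in> K" by (rule of_rat_in_subfield[OF K])
  have yn: "y ^ n \<in> K" by (rule U.K_closed(7)[OF y(1)])
  have wq: "0 < w q" using rat_place_abs(3,4)[OF w, of q] q(1) by simp
  have wi: "w (inverse q) = inverse (w q)" by (rule rat_place_abs(7)[OF w])
  show ?thesis
  proof (rule that[of z])
    show "z \<in> K" unfolding z_def by (rule U.K_closed(4)[OF yn qK])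
    have "u z = u y ^ n / w q"
      unfolding z_def U.mult[OF yn qK] U.power[OF y(1)] ext wi by (simp add: divide_inverse)
    then show "1 < u z" using q(3) wq by simp
    have "v z = v y ^ n / w q"
      unfolding z_def V.mult[OF yn qK] V.power[OF y(1)] ext wi by (simp add: divide_inverse)
    then show "v z < 1" using q(2) wq by simp
  qed
qed

text \<open>\<open>z ^ n / (1 + z ^ n)\<close> behaves like an idempotent: it approaches 1 where
  \<open>z\<close> is large and 0 where \<open>z\<close> is small.\<close>

lemma approx_idempotent_limits:
  assumes "valued_subfield K v" and z: "z \<in> K"
  shows "v z < 1 \<Longrightarrow> (\<lambda>n. v (z ^ n * inverse (1 + z ^ n))) \<longlonglongrightarrow> 0"
    and "1 < v z \<Longrightarrow> (\<lambda>n. v (z ^ n * inverse (1 + z ^ n) - 1)) \<longlonglongrightarrow> 0"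
proof -
  interpret valued_subfield K v by fact
  have zn: "z ^ n \<in> K" "1 + z ^ n \<in> K" "inverse (1 + z ^ n) \<in> K" for n
    using K_closed(7)[OF z, of n] K_closed(1) K_closed(5) inverse_closed by blast+
  have vz0: "0 \<le> v z" by (rule nonneg[OF z])
  show "(\<lambda>n. v (z ^ n * inverse (1 + z ^ n))) \<longlonglongrightarrow> 0" if lt: "v z < 1"
  proof (rule real_tendsto_sandwich[where f = "\<lambda>_. 0" and h = "\<lambda>n. v z ^ n / (1 - v z ^ n)"])
    have l: "(\<lambda>n. v z ^ n) \<longlonglongrightarrow> 0" using lt vz0 by (intro LIMSEQ_power_zero) simp
    have "(\<lambda>n. v z ^ n / (1 - v z ^ n)) \<longlonglongrightarrow> 0 / (1 - 0)"
      by (intro tendsto_divide tendsto_diff tendsto_const l) auto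
    then show "(\<lambda>n. v z ^ n / (1 - v z ^ n)) \<longlonglongrightarrow> 0" by simp
    show "eventually (\<lambda>n. 0 \<le> v (z ^ n * inverse (1 + z ^ n))) sequentially"
      using zn by (intro always_eventually allI nonneg K_closed(4))
    show "eventually (\<lambda>n. v (z ^ n * inverse (1 + z ^ n)) \<le> v z ^ n / (1 - v z ^ n)) sequentially"
      using eventually_gt_at_top[of 0]
    proof (rule eventually_mono)
      fix n :: nat assume "0 < n"
      then have "v z ^ n < 1" using lt vz0 by (simp add: power_less_one_iff)
      moreover have "1 - v z ^ n \<le> v (1 + z ^ n)"
        using diff_ge[OF K_closed(1) zn(1)] power[OF z] one by simp
      ultimately have "v z ^ n / v (1 + z ^ n) \<le> v z ^ n / (1 - v z ^ n)"
        using vz0 by (intro divide_left_mono) auto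
      then show "v (z ^ n * inverse (1 + z ^ n)) \<le> v z ^ n / (1 - v z ^ n)"
        unfolding mult[OF zn(1,3)] inverse[OF zn(2)] power[OF z] by (simp add: divide_inverse)
    qed
  qed simp
  show "(\<lambda>n. v (z ^ n * inverse (1 + z ^ n) - 1)) \<longlonglongrightarrow> 0" if gt: "1 < v z"
  proof (rule real_tendsto_sandwich[where f = "\<lambda>_. 0" and h = "\<lambda>n. 1 / (v z ^ n - 1)"])
    show "(\<lambda>n. 1 / (v z ^ n - 1)) \<longlonglongrightarrow> 0" using gt by real_asymp
    show "eventually (\<lambda>n. 0 \<le> v (z ^ n * inverse (1 + z ^ n) - 1)) sequentially"
      using zn K_closed by (intro always_eventually allI nonneg) blast
    show "eventually (\<lambda>n. v (z ^ n * inverse (1 + z ^ n) - 1) \<le> 1 / (v z ^ n - 1)) sequentially"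
      using eventually_gt_at_top[of 0]
    proof (rule eventually_mono)
      fix n :: nat assume "0 < n"
      then have big: "1 < v z ^ n" using gt by simp
      have ge: "v z ^ n - 1 \<le> v (1 + z ^ n)"
        using diff_ge[OF zn(1) K_closed(1)] power[OF z] one by (simp add: add.commute)
      then have nz: "1 + z ^ n \<noteq> 0" using big zero by auto
      have "z ^ n * inverse (1 + z ^ n) - 1 = - inverse (1 + z ^ n)"
        using nz by (simp add: field_simps)
      then have "v (z ^ n * inverse (1 + z ^ n) - 1) = 1 / v (1 + z ^ n)"
        using uminus[OF zn(3)] inverse[OF zn(2)] by (simp add: divide_inverse)
      also have "\<dots> \<le> 1 / (v z ^ n - 1)" using ge big by (intro divide_left_mono) auto
      finally show "v (z ^ n * inverse (1 + z ^ n) - 1) \<le> 1 / (v z ^ n - 1)" .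
    qed
  qed simp
qed

text \<open>Induction as in the Artin-Whaples approximation theorem. With \<open>z\<close> for the
  old places and \<open>y\<close> for the new place \<open>s\<close>, a power of \<open>z\<close>
  times \<open>y\<close> works when \<open>s z \<le> 1\<close>; otherwise the approximate idempotent
  leaves \<open>y\<close> unchanged at \<open>u\<close> and \<open>s\<close> in the limit and makes
  it small on \<open>S\<close>.\<close>

lemma weak_approximation_step:
  assumes K: "closed_subfield K" and w: "rat_place w" and u: "extends_abs K w u"
    and "finite S" "\<And>s. s \<in> S \<Longrightarrow> extends_abs K w s \<and> (\<exists>x\<in>K. u x \<noteq> s x)"
  shows "\<exists>z\<in>K. 1 < u z \<and> (\<forall>s\<in>S. s z < 1)"
  using assms(4,5)
proof (induction S rule: finite_induct)
  case empty
  obtain c where c: "1 < c" "\<And>a b. 0 < a \<Longrightarrow> a * c < b \<Longrightarrow> \<exists>q. q \<noteq> 0 \<and> a < w q \<and> w q < b"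
    using rat_place_power_between[OF w] by metis
  obtain q where "1 < w q" using c(2)[of 1 "c + 1"] by auto
  then show ?case using u of_rat_in_subfield[OF K, of q]
    by (intro bexI[of _ "of_rat q"]) (auto simp: extends_abs_def)
next
  case (insert s S)
  then obtain z where z: "z \<in> K" "1 < u z" "\<forall>t\<in>S. t z < 1" by auto
  have s: "extends_abs K w s" "\<exists>x\<in>K. u x \<noteq> s x" using insert.prems by auto
  obtain y where y: "y \<in> K" "1 < u y" "s y < 1"
    using absolute_values_separated[OF K w u s(1)] s(2) by metis
  interpret U: valued_subfield K u by (rule extends_abs_valued[OF K u])
  interpret V: valued_subfield K s by (rule extends_abs_valued[OF K s(1)])
  have S: "valued_subfield K t" if "t \<in> S" for t
    using insert.prems that by (intro extends_abs_valued[OF K]) auto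
  have small: "eventually (\<lambda>n. t (g n * y) < 1) sequentially"
    if t: "valued_subfield K t" and g: "\<And>n. g n \<in> K" "(\<lambda>n. t (g n)) \<longlonglongrightarrow> 0" for t and g :: "nat \<Rightarrow> qbar"
  proof -
    have "(\<lambda>n. t (g n) * t y) \<longlonglongrightarrow> 0 * t y" by (intro tendsto_mult g(2) tendsto_const)
    then have "eventually (\<lambda>n. t (g n) * t y < 1) sequentially" by (intro order_tendstoD(2)) auto
    then show ?thesis using valued_subfield.mult[OF t g(1) y(1)] by simp
  qed
  have zn: "z ^ n \<in> K" "1 + z ^ n \<in> K" "inverse (1 + z ^ n) \<in> K" "z ^ n * inverse (1 + z ^ n) \<in> K" for n
    using U.K_closed(7)[OF z(1), of n] U.K_closed(1,4,5) U.inverse_closed by blast+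
  show ?case
  proof (cases "s z \<le> 1")
    case True
    have "eventually (\<lambda>n. t (z ^ n * y) < 1) sequentially" if "t \<in> S" for t
    proof (rule small[OF S[OF that] zn(1)])
      interpret T: valued_subfield K t by (rule S[OF that])
      have "(\<lambda>n. t z ^ n) \<longlonglongrightarrow> 0"
        using z(3) that T.nonneg[OF z(1)] by (intro LIMSEQ_power_zero) auto
      then show "(\<lambda>n. t (z ^ n)) \<longlonglongrightarrow> 0" using T.power[OF z(1)] by simp
    qed
    then have "eventually (\<lambda>n. \<forall>t\<in>S. t (z ^ n * y) < 1) sequentially"
      using insert.hyps(1) by (simp add: eventually_ball_finite)
    then obtain n where n: "\<forall>t\<in>S. t (z ^ n * y) < 1" by (auto simp: eventually_sequentially)
    have "1 < u (z ^ n * y)"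
    proof -
      have "1 * u y \<le> u z ^ n * u y" using z(2) y(2) by (intro mult_right_mono one_le_power) auto
      then show ?thesis unfolding U.mult[OF zn(1) y(1)] U.power[OF z(1)] using y(2) by linarith
    qed
    moreover have "s (z ^ n * y) < 1"
    proof -
      have "s z ^ n * s y \<le> 1 * s y"
        using True V.nonneg[OF z(1)] V.nonneg[OF y(1)] by (intro mult_right_mono power_le_one) auto
      then show ?thesis unfolding V.mult[OF zn(1) y(1)] V.power[OF z(1)] using y(3) by linarith
    qed
    ultimately show ?thesis using n U.K_closed(4)[OF zn(1) y(1)] by (intro bexI[of _ "z ^ n * y"]) auto
  next
    case False
    define g where "g n = z ^ n * inverse (1 + z ^ n)" for n
    have gK: "g n \<in> K" "g n - 1 \<in> K" for n unfolding g_def using zn(4) U.K_closed(1,3) by blast+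
    have "eventually (\<lambda>n. t (g n * y) < 1) sequentially" if "t \<in> S" for t
      using approx_idempotent_limits(1)[OF S[OF that] z(1)] z(3) that
      by (intro small[OF S[OF that] gK(1)]) (simp add: g_def)
    then have e1: "eventually (\<lambda>n. \<forall>t\<in>S. t (g n * y) < 1) sequentially"
      using insert.hyps(1) by (simp add: eventually_ball_finite)
    have near: "(\<lambda>n. t (g n * y)) \<longlonglongrightarrow> t y" if t: "valued_subfield K t" and tz: "1 < t z" for t
    proof -
      interpret T: valued_subfield K t by fact
      have l: "(\<lambda>n. t (g n - 1)) \<longlonglongrightarrow> 0" using approx_idempotent_limits(2)[OF t z(1) tz] by (simp add: g_def)
      have "(\<lambda>n. t (g n) - 1) \<longlonglongrightarrow> 0"
      proof (rule Lim_null_comparison[OF always_eventually l], rule allI)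
        fix n
        have "t (g n) \<le> t (g n - 1) + 1" using T.add[OF gK(2) T.K_closed(1), of n] T.one by simp
        moreover have "1 \<le> t (g n) + t (g n - 1)"
          using T.diff[OF gK(1) gK(2), of n n] T.one by simp
        ultimately show "norm (t (g n) - 1) \<le> t (g n - 1)" by (simp add: abs_le_iff)
      qed
      then have "(\<lambda>n. t (g n)) \<longlonglongrightarrow> 1" by (simp add: LIM_zero_iff)
      then have "(\<lambda>n. t (g n) * t y) \<longlonglongrightarrow> 1 * t y" by (intro tendsto_mult tendsto_const)
      then show ?thesis using T.mult[OF gK(1) y(1)] by simp
    qed
    have "eventually (\<lambda>n. 1 < u (g n * y)) sequentially"
      using near[OF U.valued_subfield_axioms z(2)] y(2) by (rule order_tendstoD)
    moreover have "eventually (\<lambda>n. s (g n * y) < 1) sequentially"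
      using near[OF V.valued_subfield_axioms] False y(3) by (intro order_tendstoD) auto
    ultimately have "eventually (\<lambda>n. 1 < u (g n * y) \<and> s (g n * y) < 1 \<and> (\<forall>t\<in>S. t (g n * y) < 1)) sequentially"
      using e1 by eventually_elim auto
    then obtain n where n: "1 < u (g n * y)" "s (g n * y) < 1" "\<forall>t\<in>S. t (g n * y) < 1"
      by (auto simp: eventually_sequentially)
    then show ?thesis using U.K_closed(4)[OF gK(1) y(1)] by (intro bexI[of _ "g n * y"]) auto
  qed
qed

text \<open>More places than the degree would give as many approximate idempotents, hence a rational
  relation among them. Read at the place belonging to its largest coefficient, the relation
  contradicts the dominance of that term.\<close>

lemma extends_abs_finite:
  assumes K: "number_field K" and w: "rat_place w"
  shows "finite {v \<in> extensional K. extends_abs K w v}" (is "finite ?E")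
proof (rule ccontr)
  assume inf: "infinite ?E"
  note KF = number_fieldD(1)[OF K]
  note W = rat_place_abs[OF w]
  define r where "r = Suc (degree_over_rat K)"
  obtain E0 where E0: "E0 \<subseteq> ?E" "finite E0" "card E0 = r"
    using infinite_arbitrarily_large[OF inf] by blast
  obtain f where f: "bij_betw f {..<r} E0"
    using ex_bij_betw_nat_finite[OF E0(2)] E0(3) by (auto simp: atLeast0LessThan)
  have fE: "f i \<in> extensional K" "extends_abs K w (f i)" if "i < r" for i
    using that f E0(1) by (auto simp: bij_betw_def)
  have V: "valued_subfield K (f i)" if "i < r" for i by (rule extends_abs_valued[OF KF fE(2)[OF that]])
  \<comment> \<open>With tolerance \<open>1 / (r + 2)\<close> the small terms contribute at most
    \<open>r / (r + 2)\<close> relative to the largest coefficient, while the main term exceeds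
    \<open>1 - 1 / (r + 2)\<close>, which is \<open>(r + 1) / (r + 2)\<close>.\<close>
  have "\<exists>e\<in>K. f i (e - 1) < 1 / (real r + 2) \<and> (\<forall>j<r. j \<noteq> i \<longrightarrow> f j e < 1 / (real r + 2))" if i: "i < r" for i
  proof -
    have "\<exists>z\<in>K. 1 < f i z \<and> (\<forall>s\<in>f ` ({..<r} - {i}). s z < 1)"
    proof (rule weak_approximation_step[OF KF w fE(2)[OF i]])
      fix s assume "s \<in> f ` ({..<r} - {i})"
      then obtain j where j: "j < r" "j \<noteq> i" "s = f j" by auto
      have "f i \<noteq> f j" using f i j by (auto simp: bij_betw_def inj_on_def)
      then have "\<exists>x\<in>K. f i x \<noteq> f j x"
        using extensionalityI[OF fE(1)[OF i] fE(1)[OF j(1)]] by blast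
      then show "extends_abs K w s \<and> (\<exists>x\<in>K. f i x \<noteq> s x)" using fE(2)[OF j(1)] j(3) by blast
    qed simp
    then obtain z where z: "z \<in> K" "1 < f i z" "\<And>j. j < r \<Longrightarrow> j \<noteq> i \<Longrightarrow> f j z < 1" by auto
    define g where "g n = z ^ n * inverse (1 + z ^ n)" for n
    interpret U: valued_subfield K "f i" by (rule V[OF i])
    have gK: "g n \<in> K" for n unfolding g_def
      using U.K_closed(7)[OF z(1), of n] U.K_closed(1,4,5) U.inverse_closed by blast
    have "eventually (\<lambda>n. f i (g n - 1) < 1 / (real r + 2)) sequentially"
      using approx_idempotent_limits(2)[OF V[OF i] z(1,2)] unfolding g_def
      by (rule order_tendstoD) auto
    moreover have "eventually (\<lambda>n. \<forall>j\<in>{..<r} - {i}. f j (g n) < 1 / (real r + 2)) sequentially"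
    proof (rule eventually_ball_finite, simp, rule ballI)
      fix j assume j: "j \<in> {..<r} - {i}"
      show "eventually (\<lambda>n. f j (g n) < 1 / (real r + 2)) sequentially"
        using approx_idempotent_limits(1)[OF V z(1) z(3), of j] j unfolding g_def
        by (intro order_tendstoD) auto
    qed
    ultimately have "eventually (\<lambda>n. f i (g n - 1) < 1 / (real r + 2) \<and>
        (\<forall>j\<in>{..<r} - {i}. f j (g n) < 1 / (real r + 2))) sequentially" by eventually_elim auto
    then obtain n where "f i (g n - 1) < 1 / (real r + 2)" "\<forall>j\<in>{..<r} - {i}. f j (g n) < 1 / (real r + 2)"
      by (auto simp: eventually_sequentially)
    then show ?thesis using gK by (intro bexI[of _ "g n"]) auto
  qed
  then obtain e where e: "\<And>i. i < r \<Longrightarrow> e i \<in> K" "\<And>i. i < r \<Longrightarrow> f i (e i - 1) < 1 / (real r + 2)"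
    "\<And>i j. i < r \<Longrightarrow> j < r \<Longrightarrow> j \<noteq> i \<Longrightarrow> f j (e i) < 1 / (real r + 2)" by metis
  obtain c k where c: "(\<Sum>i<r. of_rat (c i) * e i) = 0" "k < r" "c k \<noteq> 0"
    using number_field_dependent[OF K, of r e] e(1) unfolding r_def by auto
  have "\<exists>j\<in>{..<r}. \<forall>i\<in>{..<r}. w (c i) \<le> w (c j)"
  proof -
    have "Max ((\<lambda>i. w (c i)) ` {..<r}) \<in> (\<lambda>i. w (c i)) ` {..<r}" using c(2) by (intro Max_in) auto
    then obtain j where j: "j < r" "Max ((\<lambda>i. w (c i)) ` {..<r}) = w (c j)" by auto
    have "w (c i) \<le> w (c j)" if "i < r" for i unfolding j(2)[symmetric] using that by (intro Max_ge) auto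
    then show ?thesis using j(1) by auto
  qed
  then obtain j where j: "j < r" "\<And>i. i < r \<Longrightarrow> w (c i) \<le> w (c j)" by auto
  have cj: "0 < w (c j)" using j(2)[OF c(2)] W(3,4)[of "c k"] c(3) by simp
  interpret U: valued_subfield K "f j" by (rule V[OF j(1)])
  have ext: "f j (of_rat q) = w q" for q using fE(2)[OF j(1)] by (simp add: extends_abs_def)
  have qK: "of_rat q \<in> K" for q by (rule number_fieldD(3)[OF K])
  let ?S = "\<Sum>i\<in>{..<r} - {j}. of_rat (c i) * e i"
  have SK: "?S \<in> K" using e(1) by (intro unital_subring_sum[OF U.R] U.K_closed(4) qK) auto
  have cS: "of_rat (c j) * e j = - ?S"
    using c(1) j(1) by (simp add: sum.remove[of "{..<r}" j] eq_neg_iff_add_eq_0)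
  have "w (c j) * f j (e j) = f j (of_rat (c j) * e j)"
    by (simp only: U.mult[OF qK e(1)[OF j(1)]] ext)
  also have "\<dots> = f j ?S" unfolding cS by (rule U.uminus[OF SK])
  also have "\<dots> \<le> (\<Sum>i\<in>{..<r} - {j}. f j (of_rat (c i) * e i))"
    using e(1) by (intro U.sum_le U.K_closed(4) qK) auto
  also have "\<dots> \<le> (\<Sum>i\<in>{..<r} - {j}. w (c j) * (1 / (real r + 2)))"
  proof (rule sum_mono)
    fix i assume i: "i \<in> {..<r} - {j}"
    have "f j (of_rat (c i) * e i) = w (c i) * f j (e i)" using U.mult[OF qK e(1)] i ext by simp
    also have "\<dots> \<le> w (c j) * (1 / (real r + 2))"
      using i j e(3)[of i j] e(1)[of i] W(3) U.nonneg by (intro mult_mono) (auto simp: less_imp_le)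
    finally show "f j (of_rat (c i) * e i) \<le> w (c j) * (1 / (real r + 2))" .
  qed
  also have "\<dots> \<le> w (c j) * (real r * (1 / (real r + 2)))"
    using cj j(1) by (simp add: field_simps)
  finally have "f j (e j) \<le> real r * (1 / (real r + 2))"
    using cj by (simp only: mult_le_cancel_left_pos)
  moreover have "1 - 1 / (real r + 2) < f j (e j)"
  proof -
    have "e j - 1 \<in> K" using U.K_closed(3)[OF e(1)[OF j(1)] U.K_closed(1)] .
    then have "1 \<le> f j (e j) + f j (e j - 1)"
      using U.diff[OF e(1)[OF j(1)], of "e j - 1"] U.one by simp
    then show ?thesis using e(2)[OF j(1)] by linarith
  qed
  ultimately show False by (simp add: field_simps)
qed


section \<open>Local degrees and a lower bound for the height\<close>

lemma places_iff:
  "v \<in> places K \<longleftrightarrow> v \<in> extensional K \<and> (\<exists>w. rat_place w \<and> extends_abs K w v)"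
  unfolding places_def extends_abs_def rat_place_def by auto

lemma places_valued:
  assumes "number_field K" "v \<in> places K"
  shows "valued_subfield K v"
  using assms extends_abs_valued number_fieldD(1) by (auto simp: places_iff)

text \<open>A basis of the completion is given by a maximal set of basis elements of \<open>K\<close> that remains
  independent over the completion of the rationals, with a uniform lower bound.\<close>

lemma completion_spanned_by_subbasis:
  assumes nf: "number_field K" and w: "rat_place w" and vext: "extends_abs K w v"
  obtains I and b :: "nat \<Rightarrow> qbar" and \<delta> where "finite I" "\<forall>i\<in>I. b i \<in> K" "0 < \<delta>"
    "\<forall>c. \<forall>i\<in>I. \<delta> * w (c i) \<le> v (\<Sum>j\<in>I. of_rat (c j) * b j)"
    "\<forall>x\<in>K. \<forall>\<epsilon>>0. \<exists>c. v (x - (\<Sum>j\<in>I. of_rat (c j) * b j)) < \<epsilon>"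
proof -
  let ?D = "degree_over_rat K"
  obtain b :: "nat \<Rightarrow> qbar" where b: "\<forall>i<?D. b i \<in> K"
    "\<forall>x\<in>K. \<exists>c. x = (\<Sum>i<?D. of_rat (c i) * b i)"
    using number_field_basis[OF nf] by metis
  interpret valued_subfield K v by (rule extends_abs_valued[OF number_fieldD(1)[OF nf] vext])
  have ext: "v (of_rat q) = w q" for q using vext by (simp add: extends_abs_def)
  have qK: "of_rat q \<in> K" for q by (rule number_fieldD(3)[OF nf])
  note W = rat_place_abs[OF w]
  have lin: "(\<Sum>j\<in>I. of_rat (c j) * b j) \<in> K" if "I \<subseteq> {..<?D}" for I c
    using that b(1) by (intro unital_subring_sum[OF R] K_closed(4) qK) auto
  define ind where "ind I \<longleftrightarrow> (\<exists>\<delta>>0. \<forall>c. \<forall>i\<in>I. \<delta> * w (c i) \<le> v (\<Sum>j\<in>I. of_rat (c j) * b j))" for I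
  define \<I> where "\<I> = {I. I \<subseteq> {..<?D} \<and> ind I}"
  have "\<I> \<subseteq> Pow {..<?D}" unfolding \<I>_def by auto
  then have fin\<I>: "finite \<I>" by (rule finite_subset) simp
  have "{} \<in> \<I>" unfolding \<I>_def ind_def by (auto intro: exI[of _ 1])
  then obtain I where I: "I \<in> \<I>" "\<And>J. J \<in> \<I> \<Longrightarrow> I \<subseteq> J \<Longrightarrow> I = J"
    using finite_has_maximal[OF fin\<I>] by blast
  have ID: "I \<subseteq> {..<?D}" and "ind I" using I(1) by (auto simp: \<I>_def)
  then obtain \<delta> where \<delta>: "0 < \<delta>" "\<And>c i. i \<in> I \<Longrightarrow> \<delta> * w (c i) \<le> v (\<Sum>j\<in>I. of_rat (c j) * b j)"
    unfolding ind_def by blast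
  have finI: "finite I" using ID finite_subset by blast
  \<comment> \<open>The closure of the rational span of the chosen basis elements, which turns out
    to be all of \<open>K\<close>.\<close>
  define Cl where "Cl = {x \<in> K. \<forall>\<epsilon>>0. \<exists>c. v (x - (\<Sum>j\<in>I. of_rat (c j) * b j)) < \<epsilon>}"
  have b_Cl: "b k \<in> Cl" if k: "k < ?D" for k
  proof (cases "k \<in> I")
    case True
    have "(\<Sum>j\<in>I. of_rat (if j = k then 1 else 0) * b j) = (\<Sum>j\<in>I. if j = k then b j else 0)"
      by (rule sum.cong) auto
    also have "\<dots> = b k" using finI True by (simp add: sum.delta)
    finally have "(\<Sum>j\<in>I. of_rat (if j = k then 1 else 0) * b j) = b k" .
    then show ?thesis unfolding Cl_def using b(1) k zero
      by (intro CollectI conjI allI impI exI[of _ "\<lambda>j. if j = k then 1 else 0"]) auto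
  next
    case False
    have bk: "b k \<in> K" using b(1) k by blast
    have "\<not> ind (insert k I)"
      using I(2)[of "insert k I"] False ID k by (auto simp: \<I>_def)
    then have dep: "\<exists>c. \<exists>i\<in>insert k I. v (\<Sum>j\<in>insert k I. of_rat (c j) * b j) < \<eta> * w (c i)" if "0 < \<eta>" for \<eta>
      using that unfolding ind_def by (metis not_le)
    have "\<exists>c. v (b k - (\<Sum>j\<in>I. of_rat (c j) * b j)) < \<epsilon>" if \<epsilon>: "0 < \<epsilon>" for \<epsilon>
    proof -
      \<comment> \<open>\<open>\<delta> / 2\<close> absorbs the error when a coefficient in
        \<open>I\<close> is extracted, \<open>\<epsilon>\<close> settles the case
        \<open>i = k\<close>, and the last bound turns the estimate of \<open>w (c i)\<close>
        through \<open>w (c k)\<close> into the error \<open>\<epsilon> * w (c k)\<close>.\<close>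
      define \<eta> where "\<eta> = min (\<delta> / 2) (min \<epsilon> (\<epsilon> * \<delta> / (2 * (v (b k) + 1))))"
      have vb: "0 \<le> v (b k)" by (rule nonneg[OF bk])
      have "0 < \<eta>" using \<epsilon> \<delta>(1) vb by (simp add: \<eta>_def)
      moreover have "\<eta> \<le> \<delta> / 2" unfolding \<eta>_def by (rule min.cobounded1)
      moreover have "\<eta> \<le> \<epsilon>" unfolding \<eta>_def by (rule order_trans[OF min.cobounded2 min.cobounded1])
      moreover have "\<eta> \<le> \<epsilon> * \<delta> / (2 * (v (b k) + 1))"
        unfolding \<eta>_def by (rule order_trans[OF min.cobounded2 min.cobounded2])
      ultimately have \<eta>: "0 < \<eta>" "\<eta> \<le> \<delta> / 2" "\<eta> \<le> \<epsilon>" "\<eta> \<le> \<epsilon> * \<delta> / (2 * (v (b k) + 1))"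
        by blast+
      obtain c i where c: "i \<in> insert k I" "v (\<Sum>j\<in>insert k I. of_rat (c j) * b j) < \<eta> * w (c i)"
        using dep[OF \<eta>(1)] by blast
      define S where "S = (\<Sum>j\<in>I. of_rat (c j) * b j)"
      define T where "T = of_rat (c k) * b k + S"
      have T: "v T < \<eta> * w (c i)" using c(2) False finI by (simp add: T_def S_def)
      have SK: "S \<in> K" unfolding S_def by (rule lin[OF ID])
      have TK: "T \<in> K" unfolding T_def by (intro K_closed(5) K_closed(4) qK bk SK)
      have main: "c k \<noteq> 0 \<and> v T < \<epsilon> * w (c k)"
      proof (cases "i = k")
        case True
        have "0 < w (c k)" using T nonneg[OF TK] \<eta>(1) True W(3)[of "c k"]
          by (metis le_less_trans less_irrefl mult_zero_right order_le_less)
        then show ?thesis using T True \<eta>(3) W(1)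
          by (metis less_irrefl less_le_trans mult_right_mono order_le_less)
      next
        case False
        then have iI: "i \<in> I" using c(1) by simp
        have "\<delta> * w (c i) \<le> v S" using \<delta>(2)[OF iI, of c] by (simp add: S_def)
        also have "S = T - of_rat (c k) * b k" by (simp add: T_def)
        also have "v (T - of_rat (c k) * b k) \<le> v T + w (c k) * v (b k)"
          using diff[OF TK K_closed(4)[OF qK bk], of "c k"] mult[OF qK bk] ext by simp
        finally have 1: "\<delta> * w (c i) < \<eta> * w (c i) + w (c k) * v (b k)" using T by linarith
        have "\<eta> * w (c i) \<le> \<delta> / 2 * w (c i)" using \<eta>(2) W(3) by (rule mult_right_mono)
        then have 2: "\<delta> / 2 * w (c i) < w (c k) * v (b k)" using 1 by (simp add: field_simps)
        have "0 \<le> \<delta> / 2 * w (c i)" using \<delta>(1) W(3) by simp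
        then have pos: "0 < w (c k) * v (b k)" using 2 by linarith
        then have wck: "0 < w (c k)" using vb W(3)[of "c k"] by (simp add: zero_less_mult_iff)
        have "v T < \<eta> * w (c i)" by (rule T)
        also have "\<dots> \<le> \<epsilon> * \<delta> / (2 * (v (b k) + 1)) * w (c i)" using \<eta>(4) W(3) by (rule mult_right_mono)
        also have "\<dots> = \<epsilon> / (v (b k) + 1) * (\<delta> / 2 * w (c i))" using vb by (simp add: field_simps)
        also have "\<dots> \<le> \<epsilon> / (v (b k) + 1) * (w (c k) * v (b k))"
          using 2 \<epsilon> vb by (intro mult_left_mono) auto
        also have "\<dots> \<le> \<epsilon> * w (c k)"
        proof -
          have "v (b k) / (v (b k) + 1) \<le> 1" using vb by simp
          then have "(\<epsilon> * w (c k)) * (v (b k) / (v (b k) + 1)) \<le> (\<epsilon> * w (c k)) * 1"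
            using \<epsilon> wck by (intro mult_left_mono) auto
          then show ?thesis by (simp add: mult_ac)
        qed
        finally show ?thesis using wck W(1) by auto
      qed
      \<comment> \<open>The almost vanishing relation is solved for \<open>b k\<close> by dividing
        by its coefficient there.\<close>
      define c' where "c' j = - c j / c k" for j
      have sumc: "(\<Sum>j\<in>I. of_rat (c' j) * b j) = - of_rat (inverse (c k)) * S"
        unfolding S_def c'_def by (simp add: sum_distrib_left sum_negf[symmetric] of_rat_divide of_rat_minus of_rat_inverse field_simps)
      have bkeq: "of_rat (inverse (c k)) * (of_rat (c k) * b k) = b k"
        using main by (simp add: mult.assoc[symmetric] of_rat_mult[symmetric])
      have "b k - (\<Sum>j\<in>I. of_rat (c' j) * b j) = of_rat (inverse (c k)) * T"
        unfolding sumc T_def distrib_left bkeq by simp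
      then have "v (b k - (\<Sum>j\<in>I. of_rat (c' j) * b j)) = inverse (w (c k)) * v T"
        using mult[OF qK TK] ext W(7) by simp
      also have "\<dots> < \<epsilon>"
      proof -
        have "0 < w (c k)" using main W(3,4)[of "c k"] by simp
        then show ?thesis using main by (simp add: field_simps)
      qed
      finally show ?thesis by blast
    qed
    then show ?thesis using bk by (simp add: Cl_def)
  qed
  have Cl_add: "x + y \<in> Cl" if x: "x \<in> Cl" and y: "y \<in> Cl" for x y
  proof -
    have xK: "x \<in> K" and yK: "y \<in> K" using x y by (auto simp: Cl_def)
    have "\<exists>c. v (x + y - (\<Sum>j\<in>I. of_rat (c j) * b j)) < \<epsilon>" if "0 < \<epsilon>" for \<epsilon>
    proof -
      have e2: "0 < \<epsilon> / 2" using that by simp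
      obtain c where c: "v (x - (\<Sum>j\<in>I. of_rat (c j) * b j)) < \<epsilon> / 2" using x e2 unfolding Cl_def by blast
      obtain d where d: "v (y - (\<Sum>j\<in>I. of_rat (d j) * b j)) < \<epsilon> / 2" using y e2 unfolding Cl_def by blast
      have e: "x + y - (\<Sum>j\<in>I. of_rat (c j + d j) * b j) =
          (x - (\<Sum>j\<in>I. of_rat (c j) * b j)) + (y - (\<Sum>j\<in>I. of_rat (d j) * b j))"
        by (simp add: of_rat_add distrib_right sum.distrib)
      have "v (x + y - (\<Sum>j\<in>I. of_rat (c j + d j) * b j)) < \<epsilon>"
        unfolding e
        using add[OF K_closed(3)[OF xK lin[OF ID, of c]] K_closed(3)[OF yK lin[OF ID, of d]]] c d by linarith
      then show ?thesis by (rule exI[of _ "\<lambda>j. c j + d j"])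
    qed
    then show ?thesis using K_closed(5)[OF xK yK] by (simp add: Cl_def)
  qed
  have Cl_scale: "of_rat q * x \<in> Cl" if x: "x \<in> Cl" for x q
  proof -
    have xK: "x \<in> K" using x by (auto simp: Cl_def)
    have "\<exists>c. v (of_rat q * x - (\<Sum>j\<in>I. of_rat (c j) * b j)) < \<epsilon>" if e: "0 < \<epsilon>" for \<epsilon>
    proof -
      have "0 < \<epsilon> / (w q + 1)" using e W(3)[of q] by simp
      then obtain c where c: "v (x - (\<Sum>j\<in>I. of_rat (c j) * b j)) < \<epsilon> / (w q + 1)"
        using x unfolding Cl_def by blast
      have e': "of_rat q * x - (\<Sum>j\<in>I. of_rat (q * c j) * b j) = of_rat q * (x - (\<Sum>j\<in>I. of_rat (c j) * b j))"
        by (simp only: of_rat_mult sum_distrib_left right_diff_distrib mult.assoc)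
      have "v (of_rat q * x - (\<Sum>j\<in>I. of_rat (q * c j) * b j)) = w q * v (x - (\<Sum>j\<in>I. of_rat (c j) * b j))"
        unfolding e' using mult[OF qK K_closed(3)[OF xK lin[OF ID, of c]]] ext by simp
      also have "\<dots> \<le> w q * (\<epsilon> / (w q + 1))" using c W(3) by (intro mult_left_mono) auto
      also have "\<dots> < \<epsilon>" using e W(3)[of q] by (simp add: field_simps)
      finally show ?thesis by (rule exI[of _ "\<lambda>j. q * c j"])
    qed
    then show ?thesis using K_closed(4)[OF qK xK] by (simp add: Cl_def)
  qed
  have Cl_sum: "(\<Sum>i\<in>J. of_rat (c i) * b i) \<in> Cl" if "J \<subseteq> {..<?D}" for J c
  proof -
    have "finite J" using that finite_subset by blast
    then show ?thesis using that
    proof (induction J rule: finite_induct)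
      case empty
      show ?case unfolding Cl_def using K_closed(2) zero
        by (auto intro!: exI[of _ "\<lambda>_. 0"])
    next
      case (insert k J)
      then show ?case using Cl_add[OF Cl_scale[OF b_Cl]] by simp
    qed
  qed
  have "x \<in> Cl" if x: "x \<in> K" for x
  proof -
    obtain c where "x = (\<Sum>i<?D. of_rat (c i) * b i)" using b(2) x by blast
    then show ?thesis using Cl_sum[of "{..<?D}" c] by simp
  qed
  then have approx: "\<forall>x\<in>K. \<forall>\<epsilon>>0. \<exists>c. v (x - (\<Sum>j\<in>I. of_rat (c j) * b j)) < \<epsilon>"
    unfolding Cl_def by blast
  have low: "\<forall>c. \<forall>i\<in>I. \<delta> * w (c i) \<le> v (\<Sum>j\<in>I. of_rat (c j) * b j)" using \<delta>(2) by blast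
  have bI: "\<forall>i\<in>I. b i \<in> K" using b(1) ID by auto
  show ?thesis by (rule that[OF finI bI \<delta>(1) low approx])
qed

text \<open>\<open>LEAST\<close> carries information only if some \<open>d\<close> qualifies. The
  cardinality of \<open>I\<close> does, because the uniform lower bound makes the coordinates of a
  Cauchy sequence Cauchy again. The value 0 is impossible, as the constant sequence 1 is not
  null.\<close>

lemma local_degree_pos:
  assumes nf: "number_field K" and vp: "v \<in> places K"
  shows "1 \<le> local_degree K v"
proof -
  obtain w where w: "rat_place w" and vext: "extends_abs K w v" using vp by (auto simp: places_iff)
  interpret valued_subfield K v by (rule places_valued[OF nf vp])
  have ext: "v (of_rat q) = w q" for q using vext by (simp add: extends_abs_def)
  have qK: "of_rat q \<in> K" for q by (rule number_fieldD(3)[OF nf])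
  obtain I and b :: "nat \<Rightarrow> qbar" and \<delta> where I: "finite I" "\<forall>i\<in>I. b i \<in> K" "0 < \<delta>"
    "\<forall>c. \<forall>i\<in>I. \<delta> * w (c i) \<le> v (\<Sum>j\<in>I. of_rat (c j) * b j)"
    "\<forall>x\<in>K. \<forall>\<epsilon>>0. \<exists>c. v (x - (\<Sum>j\<in>I. of_rat (c j) * b j)) < \<epsilon>"
    by (rule completion_spanned_by_subbasis[OF nf w vext])
  define P where "P d \<longleftrightarrow> (\<exists>e. (\<forall>i<d. e i \<in> cauchy_seqs K v) \<and>
     (\<forall>s \<in> cauchy_seqs K v. \<exists>c. (\<forall>i<d. c i \<in> cauchy_seqs (range of_rat) v) \<and>
        (\<lambda>n. v (s n - (\<Sum>i<d. c i n * e i n))) \<longlonglongrightarrow> 0))" for d :: nat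
  have ld: "local_degree K v = (LEAST d. P d)" unfolding local_degree_def P_def ..
  have lin: "(\<Sum>j\<in>I. of_rat (c j) * b j) \<in> K" for c
    using I(2) by (intro unital_subring_sum[OF R] K_closed(4) qK) auto
  define d where "d = card I"
  obtain h where h: "bij_betw h {..<d} I"
    using ex_bij_betw_nat_finite[OF I(1)] by (auto simp: atLeast0LessThan d_def)
  have hI: "h i \<in> I" if "i < d" for i using h that by (auto simp: bij_betw_def)
  have "P d" unfolding P_def
  proof (rule exI[of _ "\<lambda>i n. b (h i)"], intro conjI allI impI ballI)
    fix i assume "i < d"
    then show "(\<lambda>n. b (h i)) \<in> cauchy_seqs K v"
      using I(2) hI zero unfolding cauchy_seqs_def by auto
  next
    fix s assume s: "s \<in> cauchy_seqs K v"
    have sK: "s n \<in> K" for n using s by (auto simp: cauchy_seqs_def)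
    \<comment> \<open>The approximation improves with \<open>n\<close>, so replacing
      \<open>s\<close> by it changes the sequence only by a null sequence.\<close>
    have "\<forall>n. \<exists>c. v (s n - (\<Sum>j\<in>I. of_rat (c j) * b j)) < 1 / (real n + 1)"
    proof
      fix n
      have "0 < 1 / (real n + 1)" by simp
      then show "\<exists>c. v (s n - (\<Sum>j\<in>I. of_rat (c j) * b j)) < 1 / (real n + 1)"
        using I(5) sK by blast
    qed
    then obtain c where c: "\<And>n. v (s n - (\<Sum>j\<in>I. of_rat (c n j) * b j)) < 1 / (real n + 1)" by metis
    define t where "t n = (\<Sum>j\<in>I. of_rat (c n j) * b j)" for n
    have tK: "t n \<in> K" for n unfolding t_def by (rule lin)
    have st: "v (s n - t n) < 1 / (real n + 1)" for n using c by (simp add: t_def)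
    have lim: "(\<lambda>n. v (s n - t n)) \<longlonglongrightarrow> 0"
    proof (rule real_tendsto_sandwich[where f = "\<lambda>_. 0" and h = "\<lambda>n. 1 / (real n + 1)"])
      show "(\<lambda>n. 1 / (real n + 1)) \<longlonglongrightarrow> 0" by real_asymp
      show "eventually (\<lambda>n. 0 \<le> v (s n - t n)) sequentially"
        by (intro always_eventually allI nonneg K_closed(3) sK tK)
      show "eventually (\<lambda>n. v (s n - t n) \<le> 1 / (real n + 1)) sequentially"
        by (intro always_eventually allI less_imp_le st)
    qed simp
    have coordc: "(\<lambda>n. of_rat (c n j)) \<in> cauchy_seqs (range of_rat) v" if j: "j \<in> I" for j
      unfolding cauchy_seqs_def
    proof (intro CollectI conjI allI impI)
      show "range (\<lambda>n. of_rat (c n j)) \<subseteq> range of_rat" by auto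
      fix e :: real assume e: "0 < e"
      \<comment> \<open>Three differences of size \<open>e'\<close> bound \<open>t m - t n\<close>,
        and the lower bound \<open>\<delta>\<close> passes this on to the coordinates.\<close>
      define e' where "e' = \<delta> * e / 3"
      have e': "0 < e'" using e I(3) by (simp add: e'_def)
      have "\<exists>M. \<forall>m\<ge>M. \<forall>n\<ge>M. v (s m - s n) < e'"
        using s e' by (simp add: cauchy_seqs_def)
      then obtain M1 where M1: "\<And>m n. m \<ge> M1 \<Longrightarrow> n \<ge> M1 \<Longrightarrow> v (s m - s n) < e'" by blast
      have "eventually (\<lambda>n. v (s n - t n) < e') sequentially" by (rule order_tendstoD(2)[OF lim e'])
      then obtain M2 where M2: "\<And>n. n \<ge> M2 \<Longrightarrow> v (s n - t n) < e'"
        unfolding eventually_sequentially by blast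
      show "\<exists>M. \<forall>m\<ge>M. \<forall>n\<ge>M. v (of_rat (c m j) - of_rat (c n j)) < e"
      proof (intro exI[of _ "max M1 M2"] allI impI)
        fix m n assume m: "m \<ge> max M1 M2" and n: "n \<ge> max M1 M2"
        have dec: "t m - t n = (s m - s n) - ((s m - t m) - (s n - t n))" by simp
        have k1: "s m - s n \<in> K" "s m - t m \<in> K" "s n - t n \<in> K" by (intro K_closed(3) sK tK)+
        have "v (t m - t n) \<le> v (s m - s n) + v ((s m - t m) - (s n - t n))"
          unfolding dec by (rule diff[OF k1(1) K_closed(3)[OF k1(2,3)]])
        also have "\<dots> \<le> v (s m - s n) + (v (s m - t m) + v (s n - t n))"
          using diff[OF k1(2,3)] by simp
        also have "\<dots> < 3 * e'" using M1[of m n] M2[of m] M2[of n] m n by simp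
        finally have tt: "v (t m - t n) < \<delta> * e" by (simp add: e'_def)
        have "t m - t n = (\<Sum>j\<in>I. of_rat (c m j - c n j) * b j)"
          by (simp add: t_def sum_subtractf of_rat_diff left_diff_distrib)
        then have "\<delta> * w (c m j - c n j) \<le> v (t m - t n)"
          using I(4)[rule_format, OF j, of "\<lambda>j. c m j - c n j"] by simp
        then have "\<delta> * w (c m j - c n j) < \<delta> * e" using tt by linarith
        then have "w (c m j - c n j) < e" using I(3) by simp
        then show "v (of_rat (c m j) - of_rat (c n j)) < e" using ext[of "c m j - c n j"] by (simp add: of_rat_diff)
      qed
    qed
    have "(\<Sum>i<d. of_rat (c n (h i)) * b (h i)) = t n" for n
      unfolding t_def by (rule sum.reindex_bij_betw[OF h])
    then show "\<exists>c. (\<forall>i<d. c i \<in> cauchy_seqs (range of_rat) v) \<and>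
        (\<lambda>n. v (s n - (\<Sum>i<d. c i n * b (h i)))) \<longlonglongrightarrow> 0"
      using lim coordc hI by (intro exI[of _ "\<lambda>i n. of_rat (c n (h i))"]) auto
  qed
  then have least: "P (LEAST d. P d)" by (rule LeastI)
  have "\<not> P 0"
  proof
    assume "P 0"
    moreover have "(\<lambda>_. 1) \<in> cauchy_seqs K v" unfolding cauchy_seqs_def using K_closed(1) zero by auto
    ultimately have "(\<lambda>n::nat. v 1) \<longlonglongrightarrow> 0" unfolding P_def by force
    then show False using one by (simp add: LIMSEQ_const_iff)
  qed
  then have "(LEAST d. P d) \<noteq> 0" using least by metis
  then show ?thesis unfolding ld by simp
qed

lemma padic_place_ultrametric:
  assumes K: "closed_subfield K" and p: "Factorial_Ring.prime p" and v: "extends_abs K (padic_abs p) v"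
    and xy: "x \<in> K" "y \<in> K"
  shows "v (x + y) \<le> max (v x) (v y)"
proof (rule valued_subfield_ultrametric[OF extends_abs_valued[OF K v] _ xy])
  fix n :: nat
  have "v (of_rat (of_int (int n))) \<le> 1"
    using v padic_abs_of_int_le_1[OF p, of "int n"] by (simp only: extends_abs_def)
  then show "v (of_nat n) \<le> 1" by simp
qed

section \<open>Finiteness of the support of the height\<close>

lemma finite_primes_padic_gt_1: "finite {p. Factorial_Ring.prime p \<and> 1 < padic_abs p q}"
proof -
  obtain a b where q: "q = of_int a / of_int b" "b > 0" by (rule rat_frac_cases)
  have "{p. Factorial_Ring.prime p \<and> 1 < padic_abs p q} \<subseteq> {p. p dvd nat b}"
  proof safe
    fix p assume p: "Factorial_Ring.prime p" "1 < padic_abs p q"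
    show "p dvd nat b"
    proof (rule ccontr)
      assume "\<not> p dvd nat b"
      then have nd: "\<not> int p dvd b" using q(2) by (simp add: int_dvd_int_iff[symmetric] del: int_dvd_int_iff)
      have "a \<noteq> 0" using p(2) q by auto
      then have "padic_abs p q = real p powi (int (multiplicity (int p) b) - int (multiplicity (int p) a))"
        unfolding q(1) using q(2) by (intro padic_abs_frac[OF p(1)]) auto
      also have "multiplicity (int p) b = 0" using nd by (rule not_dvd_imp_multiplicity_0)
      also have "real p powi (int 0 - int (multiplicity (int p) a)) \<le> real p powi 0"
        using prime_gt_1_nat[OF p(1)] by (intro power_int_increasing) auto
      finally show False using p(2) by simp
    qed
  qed
  moreover have "finite {p. p dvd nat b}" using q(2) by simp
  ultimately show ?thesis by (rule finite_subset)
qed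

text \<open>At a prime where all coefficients of a relation for \<open>\<alpha> ^ m\<close> are
  integral, the ultrametric inequality excludes \<open>v \<alpha> > 1\<close>. What remains is the
  archimedean place and finitely many primes, each with finitely many places above it.\<close>

lemma finite_places_gt_1:
  assumes nf: "number_field K" and \<alpha>: "\<alpha> \<in> K"
  shows "finite {v \<in> places K. 1 < v \<alpha>}"
proof -
  obtain m where m: "\<And>n. \<alpha> ^ n \<in> qv.span ((\<lambda>i. \<alpha> ^ i) ` {..<m})" using qv_powers_span by blast
  have "\<exists>c. \<alpha> ^ m = (\<Sum>i<m. of_rat (c i) * \<alpha> ^ i)"
  proof -
    have "y \<in> qv.span ((\<lambda>i. \<alpha> ^ i) ` {..<m}) \<Longrightarrow> \<exists>c. y = (\<Sum>i<m. of_rat (c i) * \<alpha> ^ i)" for y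
    proof (induction rule: qv.span_induct_alt)
      case base
      show ?case by (rule exI[of _ "\<lambda>_. 0"]) simp
    next
      case (step q x y)
      then obtain j c where j: "x = \<alpha> ^ j" "j < m" and c: "y = (\<Sum>i<m. of_rat (c i) * \<alpha> ^ i)" by auto
      have "(\<Sum>i<m. of_rat (c i + (if i = j then q else 0)) * \<alpha> ^ i) =
          (\<Sum>i<m. of_rat (c i) * \<alpha> ^ i) + (\<Sum>i<m. if i = j then of_rat q * \<alpha> ^ i else 0)"
        unfolding sum.distrib[symmetric] by (rule sum.cong) (auto simp: of_rat_add distrib_right)
      also have "\<dots> = of_rat q * x + y" using j c by (simp add: sum.delta add.commute)
      finally have e: "(\<Sum>i<m. of_rat (c i + (if i = j then q else 0)) * \<alpha> ^ i) = of_rat q * x + y" .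
      show ?case
        by (intro exI[of _ "\<lambda>i. c i + (if i = j then q else 0)"]) (simp only: e)
    qed
    then show ?thesis using m by blast
  qed
  then obtain c where c: "\<alpha> ^ m = (\<Sum>i<m. of_rat (c i) * \<alpha> ^ i)" by blast
  define Pr where "Pr = (\<Union>i<m. {p. Factorial_Ring.prime p \<and> 1 < padic_abs p (c i)})"
  have finPr: "finite Pr" unfolding Pr_def using finite_primes_padic_gt_1 by blast
  let ?E = "\<lambda>w. {v \<in> extensional K. extends_abs K w v}"
  have "{v \<in> places K. 1 < v \<alpha>} \<subseteq> ?E (\<lambda>q. of_rat \<bar>q\<bar>) \<union> (\<Union>p\<in>Pr. ?E (padic_abs p))"
  proof
    fix v assume "v \<in> {v \<in> places K. 1 < v \<alpha>}"
    then have vp: "v \<in> places K" and gt: "1 < v \<alpha>" by auto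
    then obtain w where w: "rat_place w" "extends_abs K w v" "v \<in> extensional K" by (auto simp: places_iff)
    show "v \<in> ?E (\<lambda>q. of_rat \<bar>q\<bar>) \<union> (\<Union>p\<in>Pr. ?E (padic_abs p))"
    proof (cases "w = (\<lambda>q. of_rat \<bar>q\<bar>)")
      case True
      then show ?thesis using w by blast
    next
      case False
      then obtain p where p: "Factorial_Ring.prime p" "w = padic_abs p" using w(1) by (auto simp: rat_place_def)
      have "p \<in> Pr"
      proof (rule ccontr)
        assume "p \<notin> Pr"
        then have le: "padic_abs p (c i) \<le> 1" if "i < m" for i using that p(1) by (auto simp: Pr_def not_less)
        interpret valued_subfield K v by (rule places_valued[OF nf vp])
        have qK: "of_rat q \<in> K" for q by (rule number_fieldD(3)[OF nf])
        have termK: "of_rat (c i) * \<alpha> ^ i \<in> K" for i by (intro K_closed(4) K_closed(7) qK \<alpha>)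
        \<comment> \<open>All exponents on the right are at most \<open>m - 1\<close>, and since
          \<open>v \<alpha>\<close> exceeds 1 the largest power dominates.\<close>
        have bound: "v (\<Sum>i\<in>J. of_rat (c i) * \<alpha> ^ i) \<le> v \<alpha> ^ (m - 1)" if "finite J" "J \<subseteq> {..<m}" for J
          using that
        proof (induction J rule: finite_induct)
          case empty
          show ?case using zero gt by simp
        next
          case (insert j J)
          have "v (of_rat (c j) * \<alpha> ^ j + (\<Sum>i\<in>J. of_rat (c i) * \<alpha> ^ i)) \<le>
              max (v (of_rat (c j) * \<alpha> ^ j)) (v (\<Sum>i\<in>J. of_rat (c i) * \<alpha> ^ i))"
            by (rule padic_place_ultrametric[OF number_fieldD(1)[OF nf] p(1) w(2)[unfolded p(2)] termK
                  unital_subring_sum[OF R termK]])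
          also have "\<dots> \<le> v \<alpha> ^ (m - 1)"
          proof (rule max.boundedI)
            have "v (of_rat (c j) * \<alpha> ^ j) = padic_abs p (c j) * v \<alpha> ^ j"
              using mult[OF qK K_closed(7)[OF \<alpha>]] power[OF \<alpha>] w(2) p(2) by (simp add: extends_abs_def)
            also have "\<dots> \<le> 1 * v \<alpha> ^ (m - 1)"
              using le[of j] insert.prems gt padic_abs_nonneg[OF p(1)]
              by (intro mult_mono power_increasing) auto
            finally show "v (of_rat (c j) * \<alpha> ^ j) \<le> v \<alpha> ^ (m - 1)" by simp
            show "v (\<Sum>i\<in>J. of_rat (c i) * \<alpha> ^ i) \<le> v \<alpha> ^ (m - 1)" using insert by simp
          qed
          finally show ?case using insert.hyps by simp
        qed
        have "v \<alpha> ^ m \<le> v \<alpha> ^ (m - 1)"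
          using bound[of "{..<m}"] power[OF \<alpha>, of m] c by simp
        moreover have "m \<noteq> 0" using c by (cases m) auto
        then have "v \<alpha> ^ (m - 1) < v \<alpha> ^ m" using gt by (intro power_strict_increasing) auto
        ultimately show False by simp
      qed
      then show ?thesis using w p by blast
    qed
  qed
  moreover have "finite (?E (\<lambda>q. of_rat \<bar>q\<bar>) \<union> (\<Union>p\<in>Pr. ?E (padic_abs p)))"
  proof (intro finite_UnI finite_UN_I finPr)
    show "finite (?E (\<lambda>q. of_rat \<bar>q\<bar>))"
      by (rule extends_abs_finite[OF nf]) (simp add: rat_place_def)
    fix p assume "p \<in> Pr"
    then have "rat_place (padic_abs p)" by (auto simp: rat_place_def Pr_def)
    then show "finite (?E (padic_abs p))" by (rule extends_abs_finite[OF nf])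
  qed
  ultimately show ?thesis by (rule finite_subset)
qed

text \<open>For a family that is not summable \<open>infsum\<close> is a default value, so the sum
  is first reduced to the finite set \<open>T\<close>. The coordinate 1 makes its terms nonnegative,
  and local degrees are at least 1, hence any finite set of places gives a lower bound.\<close>

lemma height_over_ge:
  fixes x :: "qbar ^ 'n::finite"
  assumes nf: "number_field K" and \<alpha>: "\<alpha> \<in> K" and x: "range (\<lambda>i. x $ i) = {1, \<alpha>}"
    and S: "finite S" "S \<subseteq> places K"
  shows "(\<Sum>v\<in>S. ln (max 1 (v \<alpha>))) \<le> real (degree_over_rat K) * height_over K x"
proof -
  define T where "T = {v \<in> places K. 1 < v \<alpha>}"
  have finT: "finite T" unfolding T_def by (rule finite_places_gt_1[OF nf \<alpha>])
  define g where "g v = real (local_degree K v) * ln (Max (range (\<lambda>i. v (x $ i))))" for v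
  have mx: "Max (range (\<lambda>i. v (x $ i))) = max 1 (v \<alpha>)" if "v \<in> places K" for v
  proof -
    have "range (\<lambda>i. v (x $ i)) = v ` range (\<lambda>i. x $ i)" by auto
    then show ?thesis using valued_subfield.one[OF places_valued[OF nf that]] by (simp add: x)
  qed
  have "infsum g (places K) = infsum g T"
    by (rule infsum_cong_neutral) (auto simp: T_def g_def mx max_def)
  also have "\<dots> = sum g T" using finT by simp
  finally have inf: "infsum g (places K) = sum g T" .
  have "(\<Sum>v\<in>S. ln (max 1 (v \<alpha>))) = (\<Sum>v\<in>S \<inter> T. ln (max 1 (v \<alpha>)))"
    using S by (intro sum.mono_neutral_right) (auto simp: T_def max_def)
  also have "\<dots> \<le> (\<Sum>v\<in>T. ln (max 1 (v \<alpha>)))"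
    using finT by (intro sum_mono2) auto
  also have "\<dots> \<le> sum g T"
  proof (rule sum_mono)
    fix v assume "v \<in> T"
    then have v: "v \<in> places K" by (simp add: T_def)
    have "1 * ln (max 1 (v \<alpha>)) \<le> real (local_degree K v) * ln (max 1 (v \<alpha>))"
      using local_degree_pos[OF nf v] by (intro mult_right_mono) auto
    then show "ln (max 1 (v \<alpha>)) \<le> g v" by (simp add: g_def mx[OF v])
  qed
  also have "\<dots> = real (degree_over_rat K) * height_over K x"
    using degree_over_rat_pos[OF nf] inf unfolding height_over_def g_def by simp
  finally show ?thesis .
qed


section \<open>Norms and characteristic polynomials\<close>

lemma rat_place_sum_le:
  assumes "rat_place w"
  shows "w (sum g A) \<le> (\<Sum>i\<in>A. w (g i))"
proof (induction A rule: infinite_finite_induct)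
  case (insert a A)
  then show ?case using rat_place_abs(6)[OF assms, of "g a" "sum g A"] by simp
qed (auto simp: rat_place_abs[OF assms])

lemma rat_place_prod:
  assumes "rat_place w"
  shows "w (prod g A) = (\<Prod>i\<in>A. w (g i))"
  by (induction A rule: infinite_finite_induct) (auto simp: rat_place_abs[OF assms])

text \<open>Leibniz' formula with the triangle inequality at every place alike; the factor
  \<open>fact n\<close> is removed later by passing to powers.\<close>

lemma rat_place_det_le:
  assumes w: "rat_place w" and A: "A \<in> carrier_mat n n"
    and E: "\<And>i j. i < n \<Longrightarrow> j < n \<Longrightarrow> w (A $$ (i, j)) \<le> E"
  shows "w (Determinant.det A) \<le> fact n * E ^ n"
proof -
  note W = rat_place_abs[OF w]
  let ?Q = "{p. p permutes {0..<n}}"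
  have "w (Determinant.det A) = w (\<Sum>p\<in>?Q. signof p * (\<Prod>i = 0..<n. A $$ (i, p i)))"
    using Determinant.det_def'[OF A] by simp
  also have "\<dots> \<le> (\<Sum>p\<in>?Q. w (signof p * (\<Prod>i = 0..<n. A $$ (i, p i))))"
    by (rule rat_place_sum_le[OF w])
  also have "\<dots> \<le> (\<Sum>p\<in>?Q. E ^ n)"
  proof (rule sum_mono)
    fix p assume p: "p \<in> ?Q"
    have "w (signof p) = 1" by (cases "evenperm p") (auto simp: sign_def W)
    then have "w (signof p * (\<Prod>i = 0..<n. A $$ (i, p i))) = (\<Prod>i = 0..<n. w (A $$ (i, p i)))"
      by (simp add: W(5) rat_place_prod[OF w])
    also have "\<dots> \<le> (\<Prod>i = 0..<n. E)"
    proof (rule prod_mono)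
      fix i assume i: "i \<in> {0..<n}"
      then have "p i \<in> {0..<n}" using p permutes_in_image[of p "{0..<n}" i] by simp
      then show "0 \<le> w (A $$ (i, p i)) \<and> w (A $$ (i, p i)) \<le> E" using i W(3) E by auto
    qed
    finally show "w (signof p * (\<Prod>i = 0..<n. A $$ (i, p i))) \<le> E ^ n" by simp
  qed
  also have "\<dots> = fact n * E ^ n" using card_permutations[of "{0..<n}" n] by simp
  finally show ?thesis .
qed

locale number_field_coordinates =
  fixes L :: "qbar set" and D :: nat and b :: "nat \<Rightarrow> qbar" and co :: "qbar \<Rightarrow> nat \<Rightarrow> rat"
  assumes nf: "number_field L" and D_pos: "0 < D"
    and b_in: "i < D \<Longrightarrow> b i \<in> L"
    and expand: "x \<in> L \<Longrightarrow> x = (\<Sum>i<D. of_rat (co x i) * b i)"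
    and independent: "(\<Sum>i<D. of_rat (c i) * b i) = 0 \<Longrightarrow> i < D \<Longrightarrow> c i = 0"
begin

lemmas L_ring = unital_subringD[OF number_fieldD(2)[OF nf]] unital_subring_power[OF number_fieldD(2)[OF nf]]

lemma of_rat_in: "of_rat q \<in> L" by (rule number_fieldD(3)[OF nf])

lemma lin_in: "(\<Sum>i<D. of_rat (c i) * b i) \<in> L"
  by (intro unital_subring_sum[OF number_fieldD(2)[OF nf]] L_ring(4) of_rat_in b_in) auto

lemma co_unique:
  assumes "x = (\<Sum>i<D. of_rat (c i) * b i)" "i < D"
  shows "co x i = c i"
proof -
  have "x \<in> L" unfolding assms(1) by (rule lin_in)
  then have "(\<Sum>i<D. of_rat (co x i) * b i) = (\<Sum>i<D. of_rat (c i) * b i)"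
    using expand assms(1) by simp
  then have "(\<Sum>i<D. of_rat (co x i - c i) * b i) = 0"
    by (simp add: of_rat_diff left_diff_distrib sum_subtractf)
  then show ?thesis using independent[of "\<lambda>i. co x i - c i" i] assms(2) by simp
qed

lemma co_add: "x \<in> L \<Longrightarrow> y \<in> L \<Longrightarrow> i < D \<Longrightarrow> co (x + y) i = co x i + co y i"
proof (rule co_unique)
  assume "x \<in> L" "y \<in> L"
  then have "x + y = (\<Sum>i<D. of_rat (co x i) * b i) + (\<Sum>i<D. of_rat (co y i) * b i)"
    using expand by metis
  also have "\<dots> = (\<Sum>i<D. of_rat (co x i + co y i) * b i)"
    by (simp add: of_rat_add distrib_right sum.distrib)
  finally show "x + y = (\<Sum>i<D. of_rat (co x i + co y i) * b i)" .
qed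

lemma co_scale: "x \<in> L \<Longrightarrow> i < D \<Longrightarrow> co (of_rat q * x) i = q * co x i"
proof (rule co_unique)
  assume "x \<in> L"
  then have "of_rat q * x = of_rat q * (\<Sum>i<D. of_rat (co x i) * b i)" using expand by metis
  also have "\<dots> = (\<Sum>i<D. of_rat (q * co x i) * b i)"
    by (simp only: of_rat_mult sum_distrib_left mult.assoc)
  finally show "of_rat q * x = (\<Sum>i<D. of_rat (q * co x i) * b i)" .
qed

lemma co_zero: "i < D \<Longrightarrow> co 0 i = 0"
  by (rule co_unique[of _ "\<lambda>_. 0"]) auto

lemma co_sum:
  assumes "\<And>k. k \<in> A \<Longrightarrow> g k \<in> L" "i < D"
  shows "co (sum g A) i = (\<Sum>k\<in>A. co (g k) i)"
  using assms(1)
proof (induction A rule: infinite_finite_induct)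
  case (insert a A)
  have "sum g A \<in> L" using insert by (intro unital_subring_sum[OF number_fieldD(2)[OF nf]]) auto
  then show ?case using insert co_add assms(2) by simp
qed (auto simp: co_zero assms(2))

lemma co_basis: "i < D \<Longrightarrow> j < D \<Longrightarrow> co (b i) j = (if i = j then 1 else 0)"
proof (rule co_unique)
  assume i: "i < D"
  have "(\<Sum>j<D. of_rat (if i = j then 1 else 0) * b j) = (\<Sum>j<D. if i = j then b j else 0)"
    by (rule sum.cong) auto
  also have "\<dots> = b i" using i by (simp add: sum.delta)
  finally show "b i = (\<Sum>j<D. of_rat (if i = j then 1 else 0) * b j)" ..
qed

text \<open>With coordinates of \<open>x * b i\<close> in row \<open>i\<close>, the column of basis
  elements is an eigenvector for the eigenvalue \<open>x\<close>. Commutativity of the field makes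
  the map multiplicative in this convention.\<close>

definition mulmat :: "qbar \<Rightarrow> rat mat" where
  "mulmat x = Matrix.mat D D (\<lambda>(i, j). co (x * b i) j)"

lemma mulmat_carrier: "mulmat x \<in> carrier_mat D D" by (simp add: mulmat_def)

lemma mulmat_mult:
  assumes x: "x \<in> L" and y: "y \<in> L"
  shows "mulmat (x * y) = mulmat x * mulmat y"
proof (rule eq_matI)
  fix i k assume "i < dim_row (mulmat x * mulmat y)" "k < dim_col (mulmat x * mulmat y)"
  then have i: "i < D" and k: "k < D" by (auto simp: mulmat_def)
  have xb: "x * b i \<in> L" by (rule L_ring(4)[OF x b_in[OF i]])
  have yb: "y * b j \<in> L" if "j < D" for j by (rule L_ring(4)[OF y b_in[OF that]])
  have "x * y * b i = y * (x * b i)" by (simp add: mult_ac)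
  also have "\<dots> = y * (\<Sum>j<D. of_rat (co (x * b i) j) * b j)" using expand[OF xb] by simp
  also have "\<dots> = (\<Sum>j<D. of_rat (co (x * b i) j) * (y * b j))"
    by (simp add: sum_distrib_left mult_ac)
  finally have e: "x * y * b i = (\<Sum>j<D. of_rat (co (x * b i) j) * (y * b j))" .
  have "co (x * y * b i) k = (\<Sum>j<D. co (of_rat (co (x * b i) j) * (y * b j)) k)"
    unfolding e by (rule co_sum[OF _ k]) (use L_ring(4)[OF of_rat_in yb] in auto)
  also have "\<dots> = (\<Sum>j<D. co (x * b i) j * co (y * b j) k)"
    using yb k by (intro sum.cong) (auto simp: co_scale)
  finally show "mulmat (x * y) $$ (i, k) = (mulmat x * mulmat y) $$ (i, k)"
    using i k by (simp add: mulmat_def scalar_prod_def atLeast0LessThan)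
qed (auto simp: mulmat_def)

lemma mulmat_one: "mulmat 1 = 1\<^sub>m D"
  by (rule eq_matI) (auto simp: mulmat_def co_basis)

text \<open>The field norm from \<open>L\<close> to the rationals.\<close>

definition nm :: "qbar \<Rightarrow> rat" where "nm x = Determinant.det (mulmat x)"

lemma nm_power: "x \<in> L \<Longrightarrow> nm (x ^ n) = nm x ^ n"
proof (induction n)
  case 0
  show ?case by (simp add: nm_def mulmat_one)
next
  case (Suc n)
  then show ?case
    using mulmat_mult[OF Suc(2) L_ring(7)[OF Suc(2)], of n]
      Determinant.det_mult[OF mulmat_carrier mulmat_carrier, of x "x ^ n"]
    by (simp add: nm_def)
qed

definition nrm :: "(rat \<Rightarrow> real) \<Rightarrow> qbar \<Rightarrow> real" where "nrm w x = (\<Sum>i<D. w (co x i))"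

lemma nrm_add: "rat_place w \<Longrightarrow> x \<in> L \<Longrightarrow> y \<in> L \<Longrightarrow> nrm w (x + y) \<le> nrm w x + nrm w y"
  unfolding nrm_def sum.distrib[symmetric]
  by (rule sum_mono) (simp add: co_add rat_place_abs(6))

lemma nrm_scale: "rat_place w \<Longrightarrow> x \<in> L \<Longrightarrow> nrm w (of_rat q * x) = w q * nrm w x"
  unfolding nrm_def sum_distrib_left
  by (rule sum.cong) (simp_all add: co_scale rat_place_abs(5))

lemma nrm_nonneg: "rat_place w \<Longrightarrow> 0 \<le> nrm w x"
  unfolding nrm_def by (intro sum_nonneg rat_place_abs(3))

lemma nrm_zero: "rat_place w \<Longrightarrow> nrm w 0 = 0"
  unfolding nrm_def by (simp add: co_zero rat_place_abs)

lemma nrm_sum: "rat_place w \<Longrightarrow> (\<And>k. k \<in> A \<Longrightarrow> g k \<in> L) \<Longrightarrow> nrm w (sum g A) \<le> (\<Sum>k\<in>A. nrm w (g k))"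
proof (induction A rule: infinite_finite_induct)
  case (insert a A)
  have "sum g A \<in> L" using insert by (intro unital_subring_sum[OF number_fieldD(2)[OF nf]]) auto
  then show ?case using insert nrm_add[OF insert.prems(1), of "g a" "sum g A"] by force
qed (auto simp: nrm_zero)

lemma nrm_pos: "rat_place w \<Longrightarrow> x \<in> L \<Longrightarrow> x \<noteq> 0 \<Longrightarrow> 0 < nrm w x"
proof (rule ccontr)
  assume w: "rat_place w" and x: "x \<in> L" "x \<noteq> 0" and "\<not> 0 < nrm w x"
  then have "nrm w x = 0" using nrm_nonneg[OF w, of x] by simp
  then have "w (co x i) = 0" if "i < D" for i
    unfolding nrm_def using that rat_place_abs(3)[OF w] by (simp add: sum_nonneg_eq_0_iff)
  then have "co x i = 0" if "i < D" for i using that rat_place_abs(4)[OF w] by simp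
  then have "x = 0" using expand[OF x(1)] by simp
  then show False using x(2) by simp
qed

text \<open>The total size of the structure constants of the basis, a crude bound for multiplication
  as a bilinear map.\<close>

definition mulc :: "(rat \<Rightarrow> real) \<Rightarrow> real" where "mulc w = (\<Sum>i<D. \<Sum>j<D. nrm w (b i * b j))"

lemma nrm_mult:
  assumes w: "rat_place w" and x: "x \<in> L" and y: "y \<in> L"
  shows "nrm w (x * y) \<le> mulc w * nrm w x * nrm w y"
proof -
  note W = rat_place_abs[OF w]
  have bb: "b i * b j \<in> L" if "i < D" "j < D" for i j using that by (intro L_ring(4) b_in)
  have "x * y = (\<Sum>i<D. of_rat (co x i) * b i) * (\<Sum>j<D. of_rat (co y j) * b j)"
    using expand[OF x] expand[OF y] by simp
  also have "\<dots> = (\<Sum>i<D. \<Sum>j<D. of_rat (co x i * co y j) * (b i * b j))"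
    by (simp add: sum_product of_rat_mult mult_ac)
  finally have "nrm w (x * y) = nrm w (\<Sum>i<D. \<Sum>j<D. of_rat (co x i * co y j) * (b i * b j))" by simp
  also have "\<dots> \<le> (\<Sum>i<D. nrm w (\<Sum>j<D. of_rat (co x i * co y j) * (b i * b j)))"
    by (intro nrm_sum[OF w] unital_subring_sum[OF number_fieldD(2)[OF nf]] L_ring(4) of_rat_in bb) auto
  also have "\<dots> \<le> (\<Sum>i<D. \<Sum>j<D. nrm w (of_rat (co x i * co y j) * (b i * b j)))"
    by (intro sum_mono nrm_sum[OF w] L_ring(4) of_rat_in bb) auto
  also have "\<dots> = (\<Sum>i<D. \<Sum>j<D. (w (co x i) * w (co y j)) * nrm w (b i * b j))"
    using bb by (intro sum.cong refl) (auto simp: nrm_scale[OF w] W)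
  also have "\<dots> \<le> (\<Sum>i<D. \<Sum>j<D. (w (co x i) * w (co y j)) * mulc w)"
  proof (intro sum_mono mult_left_mono)
    fix i j assume ij: "i \<in> {..<D}" "j \<in> {..<D}"
    have "nrm w (b i * b j) \<le> (\<Sum>j<D. nrm w (b i * b j))"
      using ij nrm_nonneg[OF w] by (intro member_le_sum) auto
    also have "\<dots> \<le> mulc w" unfolding mulc_def
      using ij nrm_nonneg[OF w] by (intro member_le_sum[of _ _ "\<lambda>i. \<Sum>j<D. nrm w (b i * b j)"] sum_nonneg) auto
    finally show "nrm w (b i * b j) \<le> mulc w" .
    show "0 \<le> w (co x i) * w (co y j)" using W(3) by simp
  qed
  also have "\<dots> = mulc w * nrm w x * nrm w y"
    unfolding nrm_def by (simp add: sum_product[symmetric] sum_distrib_left sum_distrib_right mult_ac)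
  finally show ?thesis .
qed

lemma quasi_norm_nrm: "rat_place w \<Longrightarrow> quasi_norm L (nrm w) (mulc w)"
proof
  assume w: "rat_place w"
  show "unital_subring L" by (rule number_fieldD(2)[OF nf])
  show "nrm w 0 = 0" by (rule nrm_zero[OF w])
  show "0 < nrm w 1" by (rule nrm_pos[OF w L_ring(1)]) simp
  show "0 \<le> nrm w x" for x by (rule nrm_nonneg[OF w])
  show "nrm w (x + y) \<le> nrm w x + nrm w y" if "x \<in> L" "y \<in> L" for x y by (rule nrm_add[OF w that])
  show "nrm w (x * y) \<le> mulc w * nrm w x * nrm w y" if "x \<in> L" "y \<in> L" for x y by (rule nrm_mult[OF w that])
qed

text \<open>The entries of the multiplication matrix are linear in \<open>x\<close>, so the
  determinant is a form of degree \<open>D\<close> in the coordinates.\<close>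

lemma nm_le:
  assumes w: "rat_place w"
  obtains C where "0 \<le> C" "\<And>x. x \<in> L \<Longrightarrow> w (nm x) \<le> C * nrm w x ^ D"
proof -
  define E where "E = (\<Sum>i<D. mulc w * nrm w (b i))"
  have mulc: "0 \<le> mulc w" unfolding mulc_def by (intro sum_nonneg nrm_nonneg[OF w])
  have E: "0 \<le> E" unfolding E_def by (intro sum_nonneg mult_nonneg_nonneg mulc nrm_nonneg[OF w])
  have "w (nm x) \<le> (fact D * E ^ D) * nrm w x ^ D" if x: "x \<in> L" for x
  proof -
    have "w (nm x) \<le> fact D * (E * nrm w x) ^ D"
      unfolding nm_def
    proof (rule rat_place_det_le[OF w mulmat_carrier])
      fix i j assume i: "i < D" and j: "j < D"
      have "w (co (x * b i) j) \<le> nrm w (x * b i)" unfolding nrm_def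
        using j rat_place_abs(3)[OF w] by (intro member_le_sum) auto
      also have "\<dots> \<le> mulc w * nrm w x * nrm w (b i)" by (rule nrm_mult[OF w x b_in[OF i]])
      also have "\<dots> = (mulc w * nrm w (b i)) * nrm w x" by simp
      also have "\<dots> \<le> E * nrm w x"
        unfolding E_def using i mulc nrm_nonneg[OF w]
        by (intro mult_right_mono member_le_sum[of i "{..<D}" "\<lambda>i. mulc w * nrm w (b i)"]) auto
      finally show "w (mulmat x $$ (i, j)) \<le> E * nrm w x" using i j by (simp add: mulmat_def)
    qed
    then show ?thesis by (simp add: power_mult_distrib mult.assoc)
  qed
  then show ?thesis using E that[of "fact D * E ^ D"] by simp
qed

text \<open>The norm of \<open>x\<close> is bounded by the spectral seminorm of \<open>x\<close>, whose value is attained by some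
  absolute value.\<close>

lemma exists_place_norm_le:
  assumes w: "rat_place w" and x: "x \<in> L"
  obtains v where "extends_abs L w v" "w (nm x) \<le> v x ^ D"
proof -
  interpret Q: quasi_norm L "nrm w" "mulc w" by (rule quasi_norm_nrm[OF w])
  let ?\<rho> = "spectral (nrm w)"
  note W = rat_place_abs[OF w]
  have LF: "closed_subfield L" by (rule number_fieldD(1)[OF nf])
  have rho_rat: "?\<rho> (of_rat q) \<le> w q" for q
  proof (rule Q.spectral_le[OF W(3)])
    fix n
    have wpow: "w (q ^ n) = w q ^ n" by (induction n) (auto simp: W)
    have "nrm w (of_rat q ^ n) = nrm w (of_rat (q ^ n) * 1)" by (simp add: of_rat_power)
    also have "\<dots> = nrm w 1 * w q ^ n" unfolding nrm_scale[OF w L_ring(1)] wpow by simp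
    finally show "nrm w (of_rat q ^ n) \<le> nrm w 1 * w q ^ n" by simp
  qed
  \<comment> \<open>An upper bound by \<open>w\<close> on all rationals applies to inverses as well
    and so becomes equality.\<close>
  have ext: "extends_abs L w v" if v: "absolute_value_on L v" "\<forall>x\<in>L. v x \<le> ?\<rho> x" for v
  proof -
    interpret V: valued_subfield L v using LF v(1) by (simp add: valued_subfield_def)
    have le: "v (of_rat q) \<le> w q" for q by (rule order_trans[OF v(2)[rule_format, OF of_rat_in] rho_rat])
    have "v (of_rat q) = w q" for q
    proof (cases "q = 0")
      case False
      have "inverse (v (of_rat q)) \<le> inverse (w q)"
        using le[of "inverse q"] V.inverse[OF of_rat_in, of q] W(7)[of q] by (simp add: of_rat_inverse)
      moreover have "0 < v (of_rat q)" using False by (intro V.pos of_rat_in) simp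
      moreover have "0 < w q" using False W(3,4)[of q] by simp
      ultimately have "w q \<le> v (of_rat q)" by simp
      then show ?thesis using le[of q] by simp
    qed (simp add: V.zero W)
    then show ?thesis using v(1) by (simp add: extends_abs_def)
  qed
  have bound: "w (nm x) \<le> ?\<rho> x ^ D"
  proof (rule tendsto_lowerbound)
    obtain C1 where C1: "0 \<le> C1" "\<And>x. x \<in> L \<Longrightarrow> w (nm x) \<le> C1 * nrm w x ^ D" using nm_le[OF w] by metis
    show "((\<lambda>e. (?\<rho> x + e) ^ D) \<longlongrightarrow> ?\<rho> x ^ D) (at_right 0)"
      by (auto intro!: tendsto_eq_intros)
    show "\<forall>\<^sub>F e in at_right 0. w (nm x) \<le> (?\<rho> x + e) ^ D"
      using eventually_at_right_less
    proof (rule eventually_mono)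
      fix e :: real assume e: "0 < e"
      define s where "s = ?\<rho> x + e"
      have "?\<rho> x < s" using e by (simp add: s_def)
      then obtain C where C: "0 < C" "\<And>n. nrm w (x ^ n) \<le> C * s ^ n" using Q.spectral_less[OF x] by metis
      have s: "0 < s" using e Q.spectral_nonneg[OF x] by (simp add: s_def)
      have wpow: "w (nm x ^ n) = w (nm x) ^ n" for n by (induction n) (auto simp: W)
      \<comment> \<open>Applied to \<open>x ^ n\<close>, the bound with constant \<open>C1\<close>
        becomes sharp: the norm is multiplicative on powers, and constants vanish in the comparison
        of growth rates.\<close>
      have "w (nm x) \<le> s ^ D"
      proof (rule power_growth_le[OF W(3)])
        fix n
        have "w (nm x) ^ n = w (nm (x ^ n))" by (simp add: nm_power[OF x] wpow)
        also have "\<dots> \<le> C1 * nrm w (x ^ n) ^ D" by (rule C1(2)[OF L_ring(7)[OF x]])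
        also have "\<dots> \<le> C1 * (C * s ^ n) ^ D"
          using C1 C nrm_nonneg[OF w] by (intro mult_left_mono power_mono) auto
        also have "\<dots> = (C1 * C ^ D) * (s ^ D) ^ n"
          by (simp add: power_mult_distrib power_mult[symmetric] mult_ac)
        finally show "w (nm x) ^ n \<le> (C1 * C ^ D) * (s ^ D) ^ n" .
      qed (use s in simp)
      then show "w (nm x) \<le> (?\<rho> x + e) ^ D" by (simp add: s_def)
    qed
  qed auto
  show ?thesis
  proof (cases "x = 0")
    case True
    \<comment> \<open>Equality can be prescribed only at a nonzero element; here any absolute value
      below the spectral seminorm will do, and 1 is used to produce one.\<close>
    obtain v where v: "absolute_value_on L v" "\<forall>x\<in>L. v x \<le> ?\<rho> x"
      by (rule absolute_value_below_pm_seminorm[OF LF Q.pm_seminorm_spectral L_ring(1) one_neq_zero])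
    have "?\<rho> x ^ D = 0" using True Q.spectral_zero D_pos by simp
    moreover have "v x = 0" using v(1) x True by (simp add: absolute_value_on_def)
    ultimately show ?thesis using that[OF ext[OF v]] bound D_pos by simp
  next
    case False
    obtain v where v: "absolute_value_on L v" "\<forall>x\<in>L. v x \<le> ?\<rho> x" "v x = ?\<rho> x"
      by (rule absolute_value_below_pm_seminorm[OF LF Q.pm_seminorm_spectral x False])
    then show ?thesis using that[OF ext[OF v(1,2)]] bound by simp
  qed
qed

definition chp :: "qbar \<Rightarrow> rat poly" where "chp \<alpha> = char_poly (mulmat \<alpha>)"

lemma chp_monic: "Polynomial.degree (chp \<alpha>) = D" "Polynomial.coeff (chp \<alpha>) D = 1"
  using degree_monic_char_poly[OF mulmat_carrier[of \<alpha>]] by (auto simp: chp_def)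

text \<open>Subtracting the matrix of \<open>\<alpha>\<close> from \<open>q\<close> times the
  identity gives the matrix of \<open>q - \<alpha>\<close>. Values of the characteristic polynomial
  are therefore norms, which can be bounded place by place.\<close>

lemma poly_chp:
  assumes \<alpha>: "\<alpha> \<in> L"
  shows "poly (chp \<alpha>) q = nm (of_rat q - \<alpha>)"
proof -
  have "- char_matrix (mulmat \<alpha>) q = mulmat (of_rat q - \<alpha>)"
  proof (rule eq_matI)
    fix i j assume "i < dim_row (mulmat (of_rat q - \<alpha>))" "j < dim_col (mulmat (of_rat q - \<alpha>))"
    then have i: "i < D" and j: "j < D" by (auto simp: mulmat_def)
    have ab: "\<alpha> * b i \<in> L" by (rule L_ring(4)[OF \<alpha> b_in[OF i]])
    have "(of_rat q - \<alpha>) * b i = of_rat q * b i + of_rat (- 1) * (\<alpha> * b i)"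
      by (simp add: algebra_simps)
    then have "co ((of_rat q - \<alpha>) * b i) j = co (of_rat q * b i) j + co (of_rat (- 1) * (\<alpha> * b i)) j"
      using co_add[OF L_ring(4)[OF of_rat_in b_in[OF i]] L_ring(4)[OF of_rat_in ab] j] by (simp only:)
    also have "\<dots> = q * (if i = j then 1 else 0) - co (\<alpha> * b i) j"
      unfolding co_scale[OF b_in[OF i] j] co_scale[OF ab j] using co_basis[OF i j] by simp
    finally show "(- char_matrix (mulmat \<alpha>) q) $$ (i, j) = mulmat (of_rat q - \<alpha>) $$ (i, j)"
      using i j by (simp add: mulmat_def char_matrix_def)
  qed (auto simp: mulmat_def char_matrix_def)
  then show ?thesis unfolding chp_def nm_def char_poly_matrix[OF mulmat_carrier] by simp
qed

text \<open>The column of basis elements is an eigenvector over the large field with eigenvalue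
  \<open>\<alpha>\<close>; it is nonzero because the basis is independent.\<close>

lemma chp_root:
  assumes \<alpha>: "\<alpha> \<in> L"
  shows "poly (map_poly of_rat (chp \<alpha>)) \<alpha> = 0"
proof -
  have h: "comm_ring_hom (of_rat :: rat \<Rightarrow> qbar)"
    by unfold_locales (auto simp: of_rat_add of_rat_mult)
  let ?A = "map_mat of_rat (mulmat \<alpha>) :: qbar mat"
  have A: "?A \<in> carrier_mat D D" using mulmat_carrier by simp
  let ?b = "Matrix.vec D b"
  have "?A *\<^sub>v ?b = \<alpha> \<cdot>\<^sub>v ?b"
  proof (rule Matrix.eq_vecI)
    fix i assume "i < dim_vec (\<alpha> \<cdot>\<^sub>v ?b)"
    then have i: "i < D" by simp
    have "\<alpha> * b i = (\<Sum>j<D. of_rat (co (\<alpha> * b i) j) * b j)"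
      by (rule expand[OF L_ring(4)[OF \<alpha> b_in[OF i]]])
    then show "Matrix.vec_index (?A *\<^sub>v ?b) i = Matrix.vec_index (\<alpha> \<cdot>\<^sub>v ?b) i"
      using i by (simp add: mulmat_def scalar_prod_def atLeast0LessThan)
  qed (simp add: mulmat_def)
  moreover have "?b \<noteq> 0\<^sub>v D"
  proof
    assume b0: "?b = 0\<^sub>v D"
    have "b i = 0" if "i < D" for i
      using arg_cong[OF b0, of "\<lambda>u. Matrix.vec_index u i"] that by simp
    then have "(\<Sum>i<D. of_rat 1 * b i) = 0" by simp
    then show False using independent[of "\<lambda>_. 1" 0] D_pos by simp
  qed
  ultimately have "eigenvector ?A ?b \<alpha>" unfolding eigenvector_def using A by simp
  then have "eigenvalue ?A \<alpha>" unfolding eigenvalue_def by blast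
  then have "poly (char_poly ?A) \<alpha> = 0" using eigenvalue_root_char_poly[OF A] by simp
  then show ?thesis
    unfolding chp_def using comm_ring_hom.char_poly_hom[OF h mulmat_carrier[of \<alpha>]] by simp
qed

end

lemma number_field_coordinates_exist:
  assumes nf: "number_field L"
  shows "\<exists>b co. number_field_coordinates L (degree_over_rat L) b co"
proof -
  let ?D = "degree_over_rat L"
  obtain b :: "nat \<Rightarrow> qbar" where b: "\<forall>i<?D. b i \<in> L"
    "\<forall>x\<in>L. \<exists>c. x = (\<Sum>i<?D. of_rat (c i) * b i)"
    "\<forall>c. (\<Sum>i<?D. of_rat (c i) * b i) = 0 \<longrightarrow> (\<forall>i<?D. c i = 0)"
    by (rule number_field_basis[OF nf])
  from b(2) obtain co where co: "\<forall>x\<in>L. x = (\<Sum>i<?D. of_rat (co x i) * b i)" by metis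
  have "number_field_coordinates L ?D b co"
    by unfold_locales (use nf degree_over_rat_pos[OF nf] b(1,3) co in blast)+
  then show ?thesis by blast
qed


section \<open>Counting points of bounded height on the projective line\<close>

lemma type_algebra_simps:
  fixes x y :: "'a::field"
  shows "x \<oplus>\<^bsub>ring_of_type_algebra\<^esub> y = x + y" "x \<otimes>\<^bsub>ring_of_type_algebra\<^esub> y = x * y"
    "\<zero>\<^bsub>ring_of_type_algebra\<^esub> = (0::'a)" "\<one>\<^bsub>ring_of_type_algebra\<^esub> = (1::'a)"
    "carrier ring_of_type_algebra = (UNIV::'a set)"
    "\<ominus>\<^bsub>ring_of_type_algebra\<^esub> x = - x" "x \<noteq> 0 \<Longrightarrow> inv\<^bsub>ring_of_type_algebra\<^esub> x = inverse x"
proof -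
  interpret F: field "ring_of_type_algebra :: 'a ring" by (rule field_from_type_algebra)
  show "x \<oplus>\<^bsub>ring_of_type_algebra\<^esub> y = x + y" "x \<otimes>\<^bsub>ring_of_type_algebra\<^esub> y = x * y"
    "\<zero>\<^bsub>ring_of_type_algebra\<^esub> = (0::'a)" "\<one>\<^bsub>ring_of_type_algebra\<^esub> = (1::'a)"
    "carrier ring_of_type_algebra = (UNIV::'a set)"
    by (auto simp: ring_of_type_algebra_def)
  show "\<ominus>\<^bsub>ring_of_type_algebra\<^esub> x = - x"
    by (rule F.minus_equality) (auto simp: ring_of_type_algebra_def)
  show "inv\<^bsub>ring_of_type_algebra\<^esub> x = inverse x" if "x \<noteq> 0"
    by (rule F.comm_inv_char) (use that in \<open>auto simp: ring_of_type_algebra_def\<close>)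
qed

lemma closed_subfield_generate_field:
  "closed_subfield (generate_field ring_of_type_algebra (H :: 'a::field set))" (is "closed_subfield ?G")
proof -
  have one: "1 \<in> ?G" using generate_field.one[of ring_of_type_algebra H] by (simp add: type_algebra_simps)
  have neg: "- x \<in> ?G" if "x \<in> ?G" for x
    using generate_field.a_inv[OF that] by (simp add: type_algebra_simps)
  have add: "x + y \<in> ?G" if "x \<in> ?G" "y \<in> ?G" for x y
    using generate_field.eng_add[OF that] by (simp add: type_algebra_simps)
  have mult: "x * y \<in> ?G" if "x \<in> ?G" "y \<in> ?G" for x y
    using generate_field.eng_mult[OF that] by (simp add: type_algebra_simps)
  have inv: "inverse x \<in> ?G" if "x \<in> ?G" for x
  proof (cases "x = 0")
    case True
    then show ?thesis using that by simp
  next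
    case False
    then show ?thesis using generate_field.m_inv[OF that] by (simp add: type_algebra_simps)
  qed
  have "x - y \<in> ?G" if "x \<in> ?G" "y \<in> ?G" for x y using add[OF that(1) neg[OF that(2)]] by simp
  then show ?thesis unfolding closed_subfield_def unital_subring_def using one mult inv by blast
qed

lemma generate_field_subset:
  assumes L: "closed_subfield (L :: 'a::field set)" and H: "H \<subseteq> L"
  shows "generate_field ring_of_type_algebra H \<subseteq> L"
proof
  have R: "unital_subring L" using L by (simp add: closed_subfield_def)
  note D = unital_subringD[OF R]
  fix x assume "x \<in> generate_field ring_of_type_algebra H"
  then show "x \<in> L"
  proof induction
    case (m_inv h)
    then show ?case using L by (simp add: type_algebra_simps closed_subfield_def)
  qed (use H D in \<open>auto simp: type_algebra_simps\<close>)
qed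

lemma multiplicity_of_nat_int: "multiplicity (int p) (int n) = multiplicity p n"
proof -
  have "int p ^ k dvd int n \<longleftrightarrow> p ^ k dvd n" for k
    by (simp only: of_nat_power[symmetric] int_dvd_int_iff)
  then show ?thesis unfolding multiplicity_def by (simp add: multiplicity_def)
qed

text \<open>A prime is a unit at every other prime, so places above different primes already differ
  at a rational.\<close>

lemma padic_abs_prime_self:
  assumes p: "Factorial_Ring.prime p" and q: "Factorial_Ring.prime q"
  shows "padic_abs p (of_nat q) = 1 \<longleftrightarrow> p \<noteq> q"
proof -
  have q0: "int q \<noteq> 0" using prime_gt_0_nat[OF q] by simp
  have "padic_abs p (of_int (int q) / of_int 1) =
      real p powi (int (multiplicity (int p) 1) - int (multiplicity (int p) (int q)))"
    by (rule padic_abs_frac[OF p q0]) simp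
  then have e: "padic_abs p (of_nat q) = real p powi (- int (multiplicity (int p) (int q)))" by simp
  show ?thesis
  proof (cases "p = q")
    case True
    have "multiplicity (int p) (int p) = 1" using p prime_gt_1_nat[OF p] by (intro multiplicity_self) auto
    then show ?thesis using e True prime_gt_1_nat[OF p] by (simp add: power_int_minus)
  next
    case False
    then have "\<not> int p dvd int q" using p q primes_dvd_imp_eq by auto
    then have "multiplicity (int p) (int q) = 0" by (rule not_dvd_imp_multiplicity_0)
    then show ?thesis using e False by simp
  qed
qed

context number_field_coordinates
begin

text \<open>The place is found on \<open>L\<close>, where the norm lives, and restricted to
  \<open>K\<close>, where the height of the point is computed; \<open>restrict\<close> supplies the
  extensionality demanded by \<open>places\<close>.\<close>

lemma place_of_subfield:
  assumes K: "closed_subfield K" "K \<subseteq> L" and w: "rat_place w" and \<alpha>: "\<alpha> \<in> K"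
  obtains v where "v \<in> places K" "extends_abs K w v" "w (poly (chp \<alpha>) q) \<le> v (of_rat q - \<alpha>) ^ D"
proof -
  have \<alpha>L: "\<alpha> \<in> L" using \<alpha> K(2) by blast
  obtain u where u: "extends_abs L w u" "w (nm (of_rat q - \<alpha>)) \<le> u (of_rat q - \<alpha>) ^ D"
    by (rule exists_place_norm_le[OF w L_ring(3)[OF of_rat_in \<alpha>L]])
  have R: "unital_subring K" using K(1) by (simp add: closed_subfield_def)
  note KD = unital_subringD[OF R]
  have qK: "of_rat r \<in> K" for r by (rule of_rat_in_subfield[OF K(1)])
  define v where "v = restrict u K"
  have "absolute_value_on K v"
    using u(1) K(2) KD unfolding extends_abs_def absolute_value_on_def v_def
    by (auto simp: subset_iff)
  then have ext: "extends_abs K w v"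
    using u(1) qK unfolding extends_abs_def v_def by simp
  moreover have "v \<in> places K" using ext w unfolding places_iff v_def by auto
  moreover have "w (poly (chp \<alpha>) q) \<le> v (of_rat q - \<alpha>) ^ D"
    using u(2) poly_chp[OF \<alpha>L] KD(3)[OF qK \<alpha>] by (simp add: v_def)
  ultimately show ?thesis using that by blast
qed

text \<open>At each prime dividing the denominator, and at the archimedean place, a single place of
  \<open>K\<close> bounds the value by the \<open>D\<close>-th power of
  \<open>max 1 (v \<alpha>)\<close>, up to a constant in the archimedean case. Different rational
  places give different places of \<open>K\<close>, so the logarithms add up to at most degree times
  height. Hence \<open>D ^ 2\<close>: one factor from the exponent in the norm bound, one from the
  degree.\<close>

lemma chp_value_bound:
  fixes x :: "qbar ^ 'n::finite"
  assumes K: "closed_subfield K" "K \<subseteq> L" and \<alpha>: "\<alpha> \<in> K" and x: "range (\<lambda>i. x $ i) = {1, \<alpha>}"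
    and B: "height_over K x \<le> B" and j: "j < D" and D: "D = degree_over_rat L"
    and quot: "quotient_of (poly (chp \<alpha>) (of_nat j)) = (a, c)"
  shows "\<bar>real_of_int a\<bar> \<le> (real D + 1) ^ D * exp (real D ^ 2 * B)"
    and "real_of_int c \<le> (real D + 1) ^ D * exp (real D ^ 2 * B)"
proof -
  have nfK: "number_field K" by (rule number_field_subset[OF nf K])
  have qK: "of_rat r \<in> K" for r by (rule of_rat_in_subfield[OF K(1)])
  define r where "r = poly (chp \<alpha>) (of_nat j)"
  have c: "c > 0" and r: "r = of_int a / of_int c" and cop: "coprime a c"
    using quotient_of_denom_pos[OF quot] quotient_of_div[OF quot] quotient_of_coprime[OF quot]
    by (auto simp: r_def)
  define PF where "PF = prime_factors (nat c)"
  have finPF: "finite PF" by (simp add: PF_def)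
  have prime: "Factorial_Ring.prime p" if "p \<in> PF" for p using that by (auto simp: PF_def)
  have "\<exists>v. v \<in> places K \<and> extends_abs K (padic_abs p) v \<and> padic_abs p r \<le> v (of_nat j - \<alpha>) ^ D" if "p \<in> PF" for p
  proof -
    have "rat_place (padic_abs p)" using prime[OF that] by (auto simp: rat_place_def)
    from place_of_subfield[OF K this \<alpha>, of "of_nat j"] show ?thesis unfolding r_def by (metis of_rat_of_nat_eq)
  qed
  then obtain vp where vp: "\<And>p. p \<in> PF \<Longrightarrow> vp p \<in> places K" "\<And>p. p \<in> PF \<Longrightarrow> extends_abs K (padic_abs p) (vp p)"
    "\<And>p. p \<in> PF \<Longrightarrow> padic_abs p r \<le> vp p (of_nat j - \<alpha>) ^ D" by metis
  have "rat_place (\<lambda>q. of_rat \<bar>q\<bar>)" by (simp add: rat_place_def)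
  from place_of_subfield[OF K this \<alpha>, of "of_nat j"]
  obtain u where u: "u \<in> places K" "extends_abs K (\<lambda>q. of_rat \<bar>q\<bar>) u"
    "of_rat \<bar>r\<bar> \<le> u (of_nat j - \<alpha>) ^ D" unfolding r_def by (metis of_rat_of_nat_eq)
  have inj: "inj_on vp PF"
  proof (rule inj_onI, rule ccontr)
    fix p q assume pq: "p \<in> PF" "q \<in> PF" "vp p = vp q" "p \<noteq> q"
    have "padic_abs p (of_nat q) = padic_abs q (of_nat q)"
      using vp(2)[OF pq(1)] vp(2)[OF pq(2)] pq(3) by (auto simp: extends_abs_def)
    then show False using padic_abs_prime_self[OF prime[OF pq(1)] prime[OF pq(2)]]
        padic_abs_prime_self[OF prime[OF pq(2)] prime[OF pq(2)]] pq(4) by simp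
  qed
  \<comment> \<open>The number 2 tells them apart: its value is 2 at \<open>u\<close> and at most 1
    at a place above a prime.\<close>
  have u_notin: "u \<notin> vp ` PF"
  proof
    assume "u \<in> vp ` PF"
    then obtain p where p: "p \<in> PF" "u = vp p" by auto
    have "padic_abs p (of_int 2) = of_rat \<bar>of_int 2\<bar>"
      using vp(2)[OF p(1)] u(2) p(2) unfolding extends_abs_def by metis
    then show False using padic_abs_of_int_le_1[OF prime[OF p(1)], of 2] by simp
  qed
  define H where "H p = ln (max 1 (vp p \<alpha>))" for p
  define Hu where "Hu = ln (max 1 (u \<alpha>))"
  have sum_le: "Hu + sum H PF \<le> real D * B"
  proof -
    have "(\<Sum>v\<in>insert u (vp ` PF). ln (max 1 (v \<alpha>))) \<le> real (degree_over_rat K) * height_over K x"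
      using finPF u(1) vp(1) by (intro height_over_ge[OF nfK \<alpha> x]) auto
    then have s: "Hu + sum H PF \<le> real (degree_over_rat K) * height_over K x"
      using finPF u_notin sum.reindex[OF inj, of "\<lambda>v. ln (max 1 (v \<alpha>))"] by (simp add: Hu_def H_def)
    \<comment> \<open>Nonnegativity of the height permits replacing the degree of \<open>K\<close>
      by the larger \<open>D\<close>.\<close>
    have "0 \<le> Hu + sum H PF" unfolding Hu_def H_def by (intro add_nonneg_nonneg sum_nonneg) auto
    then have "0 \<le> real (degree_over_rat K) * height_over K x" using s by linarith
    then have h0: "0 \<le> height_over K x" using degree_over_rat_pos[OF nfK] by (simp add: zero_le_mult_iff)
    have "real (degree_over_rat K) * height_over K x \<le> real D * B"
      using degree_over_rat_mono[OF nf K(2)] h0 B D by (intro mult_mono) auto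
    then show ?thesis using s by linarith
  qed
  have padic_bound: "real p ^ multiplicity p (nat c) \<le> exp (H p) ^ D" if p: "p \<in> PF" for p
  proof -
    have pr: "Factorial_Ring.prime p" by (rule prime[OF p])
    have pd: "int p dvd c"
    proof -
      have "p dvd nat c" using p by (auto simp: PF_def)
      then have "int p dvd int (nat c)" by (simp only: int_dvd_int_iff)
      then show ?thesis using c by simp
    qed
    \<comment> \<open>The fraction is reduced, so the p-adic value of \<open>r\<close> is exactly
      the \<open>p\<close>-part of \<open>c\<close>.\<close>
    then have npa: "\<not> int p dvd a"
      using cop pr by (metis coprime_common_divisor prime_nat_int_transfer not_prime_unit)
    have "a \<noteq> 0" using npa by auto
    then have "padic_abs p r = real p powi (int (multiplicity (int p) c) - int (multiplicity (int p) a))"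
      unfolding r using c by (intro padic_abs_frac[OF pr]) auto
    also have "multiplicity (int p) a = 0" using npa by (rule not_dvd_imp_multiplicity_0)
    also have "multiplicity (int p) c = multiplicity p (nat c)"
      using c multiplicity_of_nat_int[of p "nat c"] by simp
    finally have "real p ^ multiplicity p (nat c) = padic_abs p r" by simp
    also have "\<dots> \<le> vp p (of_nat j - \<alpha>) ^ D" by (rule vp(3)[OF p])
    also have "\<dots> \<le> exp (H p) ^ D"
    proof (rule power_mono)
      interpret V: valued_subfield K "vp p" by (rule extends_abs_valued[OF K(1) vp(2)[OF p]])
      have jK: "of_nat j \<in> K" using qK[of "of_nat j"] by simp
      have "vp p (of_nat j + - \<alpha>) \<le> max (vp p (of_nat j)) (vp p (- \<alpha>))"
        by (rule padic_place_ultrametric[OF K(1) pr vp(2)[OF p] jK V.K_closed(6)[OF \<alpha>]])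
      also have "vp p (of_nat j) = padic_abs p (of_int (int j))"
        using vp(2)[OF p] unfolding extends_abs_def by (metis of_int_of_nat_eq of_rat_of_nat_eq)
      also have "vp p (- \<alpha>) = vp p \<alpha>" by (rule V.uminus[OF \<alpha>])
      also have "max (padic_abs p (of_int (int j))) (vp p \<alpha>) \<le> max 1 (vp p \<alpha>)"
        using padic_abs_of_int_le_1[OF pr, of "int j"] by (intro max.mono) auto
      also have "\<dots> = exp (H p)" by (simp add: H_def)
      finally show "vp p (of_nat j - \<alpha>) \<le> exp (H p)" by simp
      show "0 \<le> vp p (of_nat j - \<alpha>)" by (rule V.nonneg[OF V.K_closed(3)[OF jK \<alpha>]])
    qed
    finally show ?thesis .
  qed
  have c_le: "real_of_int c \<le> exp (real D * sum H PF)"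
  proof -
    have "nat c = (\<Prod>p\<in>PF. p ^ multiplicity p (nat c))"
      unfolding PF_def using prime_factorization_nat[of "nat c"] c by simp
    then have "real (nat c) = real (\<Prod>p\<in>PF. p ^ multiplicity p (nat c))" by (rule arg_cong)
    also have "\<dots> = (\<Prod>p\<in>PF. real p ^ multiplicity p (nat c))" by (simp only: of_nat_prod of_nat_power)
    also have "\<dots> \<le> (\<Prod>p\<in>PF. exp (H p) ^ D)"
      using padic_bound by (intro prod_mono) auto
    also have "\<dots> = exp (real D * sum H PF)"
      by (simp add: exp_of_nat_mult[symmetric] exp_sum[OF finPF, symmetric] sum_distrib_left)
    finally show ?thesis using c by simp
  qed
  have r_le: "of_rat \<bar>r\<bar> \<le> (real D + 1) ^ D * exp (real D * Hu)"
  proof -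
    interpret V: valued_subfield K u by (rule extends_abs_valued[OF K(1) u(2)])
    have jK: "of_nat j \<in> K" using qK[of "of_nat j"] by simp
    have "u (of_nat j) = of_rat \<bar>of_nat j\<bar>"
      using u(2) unfolding extends_abs_def by (metis of_rat_of_nat_eq)
    then have uj: "u (of_nat j) = real j" by simp
    have "u (of_nat j - \<alpha>) \<le> real j + u \<alpha>" using V.diff[OF jK \<alpha>] uj by simp
    \<comment> \<open>Because \<open>j < D\<close>, the argument of the polynomial costs at most
      \<open>D\<close> times the maximum, and \<alpha> costs it once more; this is the origin of
      \<open>real D + 1\<close>.\<close>
    also have "\<dots> \<le> real D * max 1 (u \<alpha>) + max 1 (u \<alpha>)"
    proof (intro add_mono)
      have "real j * 1 \<le> real D * max 1 (u \<alpha>)" using j by (intro mult_mono) auto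
      then show "real j \<le> real D * max 1 (u \<alpha>)" by simp
    qed simp
    also have "\<dots> = (real D + 1) * exp Hu" by (simp add: Hu_def distrib_right)
    finally have "u (of_nat j - \<alpha>) ^ D \<le> ((real D + 1) * exp Hu) ^ D"
      using V.nonneg[OF V.K_closed(3)[OF jK \<alpha>]] by (rule power_mono)
    also have "\<dots> = (real D + 1) ^ D * exp (real D * Hu)"
      by (simp add: power_mult_distrib exp_of_nat_mult)
    finally show ?thesis using u(3) by linarith
  qed
  have Hu0: "0 \<le> Hu" by (simp add: Hu_def)
  have D1: "1 \<le> (real D + 1) ^ D" by (intro one_le_power) simp
  have tot: "real D * (Hu + sum H PF) \<le> real D ^ 2 * B"
    using mult_left_mono[OF sum_le, of "real D"] by (simp add: power2_eq_square mult.assoc)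
  have "real D * sum H PF \<le> real D * (Hu + sum H PF)" using Hu0 by (intro mult_left_mono) auto
  then have "exp (real D * sum H PF) \<le> exp (real D ^ 2 * B)" using tot by simp
  also have "\<dots> \<le> (real D + 1) ^ D * exp (real D ^ 2 * B)" using D1 by simp
  finally show "real_of_int c \<le> (real D + 1) ^ D * exp (real D ^ 2 * B)" by (rule order_trans[OF c_le])
  have "r * of_int c = of_int a" using c r by simp
  then have "\<bar>r\<bar> * of_int c = of_int \<bar>a\<bar>" using c by (metis abs_mult abs_of_pos of_int_0_less_iff of_int_abs)
  then have "of_rat (\<bar>r\<bar> * of_int c) = (of_rat (of_int \<bar>a\<bar>) :: real)" by (rule arg_cong)
  \<comment> \<open>The numerator is the value times the denominator, so the archimedean and p-adic
    bounds combine into one exponential of the total sum.\<close>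
  then have "\<bar>real_of_int a\<bar> = of_rat \<bar>r\<bar> * real_of_int c"
    by (simp only: of_rat_mult of_rat_of_int_eq of_int_abs[symmetric])
  also have "\<dots> \<le> ((real D + 1) ^ D * exp (real D * Hu)) * exp (real D * sum H PF)"
    using r_le c_le c by (intro mult_mono) auto
  also have "\<dots> = (real D + 1) ^ D * exp (real D * (Hu + sum H PF))"
    by (simp add: exp_add distrib_left)
  also have "\<dots> \<le> (real D + 1) ^ D * exp (real D ^ 2 * B)" using tot by (intro mult_left_mono) auto
  finally show "\<bar>real_of_int a\<bar> \<le> (real D + 1) ^ D * exp (real D ^ 2 * B)" .
qed

end

text \<open>\<open>K\<close> is quantified because the height of a point is taken over its own field
  of definition. The type argument fixes the length of the coordinate vector.\<close>

definition bounded_elements :: "qbar set \<Rightarrow> 'n::finite itself \<Rightarrow> real \<Rightarrow> qbar set" where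
  "bounded_elements L _ B = {\<alpha>. \<exists>K (x :: qbar ^ 'n). closed_subfield K \<and> K \<subseteq> L \<and> \<alpha> \<in> K \<and>
     range (\<lambda>i. x $ i) = {1, \<alpha>} \<and> height_over K x \<le> B}"

text \<open>The leading terms cancel, and a difference of degree below \<open>n\<close> cannot
  vanish at the \<open>n\<close> distinct elements 0, ..., \<open>n - 1\<close>.\<close>

lemma monic_poly_determined:
  fixes p q :: "'a::field_char_0 poly"
  assumes "Polynomial.degree p = n" "Polynomial.degree q = n" "Polynomial.coeff p n = 1" "Polynomial.coeff q n = 1"
    and eq: "\<And>j. j < n \<Longrightarrow> poly p (of_nat j) = poly q (of_nat j)"
  shows "p = q"
proof (rule ccontr)
  assume "p \<noteq> q"
  then have nz: "p - q \<noteq> 0" by simp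
  have "Polynomial.degree (p - q) \<le> n" using assms by (intro degree_diff_le) auto
  moreover have "Polynomial.degree (p - q) \<noteq> n"
    using nz assms(3,4) by (metis coeff_diff diff_self leading_coeff_0_iff)
  ultimately have deg: "Polynomial.degree (p - q) < n" by simp
  have "card (of_nat ` {..<n} :: 'a set) \<le> card {x. poly (p - q) x = 0}"
    using eq poly_roots_finite[OF nz] by (intro card_mono) auto
  also have "\<dots> \<le> Polynomial.degree (p - q)" by (rule card_poly_roots_bound[OF nz])
  also have "card (of_nat ` {..<n} :: 'a set) = n" by (simp add: card_image inj_on_def)
  finally show False using deg by simp
qed

text \<open>Bounded elements are roots of monic polynomials whose values at 0, ...,
  \<open>D - 1\<close> are reduced fractions with numerator and denominator in a box. The table of
  values determines the polynomial, and each polynomial has at most \<open>D\<close> roots.\<close>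

theorem bounded_elements_card:
  assumes nf: "number_field L"
  obtains C e where "0 < C" "0 \<le> e"
    "\<forall>B\<ge>0. finite (bounded_elements L TYPE('n::finite) B) \<and>
      real (card (bounded_elements L TYPE('n) B)) \<le> C * exp (e * B)"
proof -
  define D where "D = degree_over_rat L"
  obtain b co where "number_field_coordinates L D b co"
    using number_field_coordinates_exist[OF nf] unfolding D_def by blast
  then interpret N: number_field_coordinates L D b co .
  define T where "T B = (real D + 1) ^ D * exp (real D ^ 2 * B)" for B
  define m where "m B = \<lfloor>T B\<rfloor>" for B
  define Box where "Box B = {- m B..m B} \<times> {1..m B}" for B
  define \<P> where "\<P> B = {p :: rat poly. Polynomial.degree p = D \<and> Polynomial.coeff p D = 1 \<and>
      (\<forall>j<D. quotient_of (poly p (of_nat j)) \<in> Box B)}" for B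
  have finBox: "finite (Box B)" for B by (simp add: Box_def)
  let ?f = "\<lambda>p. restrict (\<lambda>j. quotient_of (poly p (of_nat j))) {..<D}"
  have inj: "inj_on ?f (\<P> B)" for B
  proof (rule inj_onI)
    fix p q assume p: "p \<in> \<P> B" and q: "q \<in> \<P> B" and e: "?f p = ?f q"
    have "poly p (of_nat j) = poly q (of_nat j)" if "j < D" for j
      using fun_cong[OF e, of j] that by (auto intro: quotient_of_inject)
    then show "p = q" using p q unfolding \<P>_def by (intro monic_poly_determined[of p D q]) auto
  qed
  have img: "?f ` \<P> B \<subseteq> PiE {..<D} (\<lambda>_. Box B)" for B
  proof (rule image_subsetI)
    fix p assume "p \<in> \<P> B"
    then show "?f p \<in> PiE {..<D} (\<lambda>_. Box B)"
      unfolding restrict_PiE_iff by (simp add: \<P>_def)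
  qed
  have finPi: "finite (PiE {..<D} (\<lambda>_. Box B))" for B using finBox by (intro finite_PiE) auto
  have fin\<P>: "finite (\<P> B)" for B
    using finite_imageD[OF finite_subset[OF img finPi] inj] .
  have card\<P>: "card (\<P> B) \<le> card (Box B) ^ D" for B
  proof -
    have "card (\<P> B) \<le> card (PiE {..<D} (\<lambda>_. Box B))" by (rule card_inj_on_le[OF inj img finPi])
    also have "\<dots> = card (Box B) ^ D" by (subst card_PiE) auto
    finally show ?thesis .
  qed
  have T1: "1 \<le> T B" if "0 \<le> B" for B
  proof -
    have "1 * 1 \<le> (real D + 1) ^ D * exp (real D ^ 2 * B)"
      using that by (intro mult_mono one_le_power) auto
    then show ?thesis by (simp add: T_def)
  qed
  \<comment> \<open>There are \<open>2 * m B + 1\<close> numerators and \<open>m B\<close>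
    denominators; \<open>m B\<close> is at most \<open>T B\<close> and \<open>T B\<close> is at
    least 1, whence the factor 3.\<close>
  have cardBox: "real (card (Box B)) \<le> 3 * T B ^ 2" if "0 \<le> B" for B
  proof -
    have m: "1 \<le> m B" "real_of_int (m B) \<le> T B" using T1[OF that] by (auto simp: m_def le_floor_iff)
    have "card (Box B) = nat (2 * m B + 1) * nat (m B)"
      using m(1) unfolding Box_def card_cartesian_product by (simp add: algebra_simps)
    then have "real (card (Box B)) = (2 * real_of_int (m B) + 1) * real_of_int (m B)"
      using m(1) by simp
    also have "\<dots> \<le> (3 * T B) * T B" using m T1[OF that] by (intro mult_mono) auto
    finally show ?thesis by (simp add: power2_eq_square)
  qed
  let ?Z = "\<lambda>p :: rat poly. {z :: qbar. poly (map_poly of_rat p) z = 0}"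
  have sub: "bounded_elements L TYPE('n) B \<subseteq> (\<Union>p\<in>\<P> B. ?Z p)" for B
  proof
    fix \<alpha> assume "\<alpha> \<in> bounded_elements L TYPE('n) B"
    then obtain K and x :: "qbar ^ 'n" where K: "closed_subfield K" "K \<subseteq> L" "\<alpha> \<in> K"
      "range (\<lambda>i. x $ i) = {1, \<alpha>}" "height_over K x \<le> B" unfolding bounded_elements_def by blast
    have \<alpha>L: "\<alpha> \<in> L" using K by blast
    have "N.chp \<alpha> \<in> \<P> B" unfolding \<P>_def
    proof (intro CollectI conjI allI impI N.chp_monic)
      fix j assume j: "j < D"
      obtain a c where ac: "quotient_of (poly (N.chp \<alpha>) (of_nat j)) = (a, c)" by fastforce
      note bd = N.chp_value_bound[OF K(1,2,3,4,5) j D_def ac]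
      have "c > 0" using quotient_of_denom_pos[OF ac] .
      then show "quotient_of (poly (N.chp \<alpha>) (of_nat j)) \<in> Box B"
        using bd unfolding ac Box_def m_def T_def[symmetric]
        by (auto simp: le_floor_iff abs_le_iff)
           (metis floor_le_iff add.inverse_inverse le_floor_iff minus_le_iff of_int_minus)
    qed
    moreover have "\<alpha> \<in> ?Z (N.chp \<alpha>)" using N.chp_root[OF \<alpha>L] by simp
    ultimately show "\<alpha> \<in> (\<Union>p\<in>\<P> B. ?Z p)" by blast
  qed
  have Z: "finite (?Z p) \<and> card (?Z p) \<le> D" if "p \<in> \<P> B" for p B
  proof -
    have deg: "Polynomial.degree (map_poly of_rat p :: qbar poly) = D"
      using that by (simp add: \<P>_def degree_map_poly)
    have "Polynomial.coeff (map_poly of_rat p :: qbar poly) D = 1"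
      using that by (simp add: \<P>_def coeff_map_poly)
    then have nz: "(map_poly of_rat p :: qbar poly) \<noteq> 0" by auto
    show ?thesis using poly_roots_finite[OF nz] card_poly_roots_bound[OF nz] deg by simp
  qed
  \<comment> \<open>The bound \<open>D\<close> times \<open>(3 * T B ^ 2) ^ D\<close> is split into
    its constant part and its exponential part. As \<open>T B\<close> contains
    \<open>exp (D ^ 2 * B)\<close>, the exponent is \<open>2 * D * D ^ 2\<close>.\<close>
  define C where "C = real D * (3 * ((real D + 1) ^ D) ^ 2) ^ D"
  define e where "e = 2 * real D ^ 3"
  have main: "finite (bounded_elements L TYPE('n) B) \<and>
      real (card (bounded_elements L TYPE('n) B)) \<le> C * exp (e * B)" if B: "0 \<le> B" for B
  proof
    have finU: "finite (\<Union>p\<in>\<P> B. ?Z p)" using fin\<P> Z by blast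
    show "finite (bounded_elements L TYPE('n) B)" by (rule finite_subset[OF sub finU])
    have "card (bounded_elements L TYPE('n) B) \<le> card (\<Union>p\<in>\<P> B. ?Z p)" by (rule card_mono[OF finU sub])
    also have "\<dots> \<le> (\<Sum>p\<in>\<P> B. card (?Z p))" by (rule card_UN_le[OF fin\<P>])
    also have "\<dots> \<le> (\<Sum>p\<in>\<P> B. D)" using Z by (intro sum_mono) auto
    also have "\<dots> = card (\<P> B) * D" by simp
    also have "\<dots> \<le> card (Box B) ^ D * D" using card\<P> by (rule mult_right_mono) simp
    finally have "real (card (bounded_elements L TYPE('n) B)) \<le> real (card (Box B) ^ D * D)"
      by (rule of_nat_mono)
    also have "\<dots> = real D * real (card (Box B)) ^ D" by simp
    also have "\<dots> \<le> real D * (3 * T B ^ 2) ^ D"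
      using cardBox[OF B] by (intro mult_left_mono power_mono) auto
    also have "\<dots> = C * exp (e * B)"
    proof -
      have "exp (real D ^ 2 * B) ^ 2 = exp (2 * (real D ^ 2 * B))" by (simp add: exp_double)
      moreover have "exp (2 * (real D ^ 2 * B)) ^ D = exp (e * B)"
        by (simp add: exp_of_nat_mult[symmetric] e_def power2_eq_square power3_eq_cube mult_ac)
      ultimately show ?thesis unfolding T_def C_def by (simp add: power_mult_distrib)
    qed
    finally show "real (card (bounded_elements L TYPE('n) B)) \<le> C * exp (e * B)" .
  qed
  have "0 < C" unfolding C_def using N.D_pos by simp
  moreover have "0 \<le> e" by (simp add: e_def)
  ultimately show ?thesis using that main by blast
qed

text \<open>The normalised vector chosen in \<open>weil_height\<close> has entries 1 and
  \<open>\<alpha>\<close> in one of two orders, whence the factor 2. Its entries lie in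
  \<open>L\<close>, because it arises from a vector over \<open>L\<close> by dividing by one of its
  coordinates.\<close>

theorem projective_line_bounded_height:
  assumes nf: "number_field L"
  obtains C e where "0 < C" "0 \<le> e"
    "\<forall>B\<ge>0. finite {P :: (qbar, 2) ppoint. (\<exists>u. u \<noteq> 0 \<and> (\<forall>j. u $ j \<in> L) \<and> P = proj_point u) \<and> weil_height P \<le> B} \<and>
      real (card {P :: (qbar, 2) ppoint. (\<exists>u. u \<noteq> 0 \<and> (\<forall>j. u $ j \<in> L) \<and> P = proj_point u) \<and> weil_height P \<le> B})
        \<le> C * exp (e * B)"
proof -
  obtain C e where Ce: "0 < C" "0 \<le> e" "\<forall>B\<ge>0. finite (bounded_elements L TYPE(2) B) \<and>
      real (card (bounded_elements L TYPE(2) B)) \<le> C * exp (e * B)"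
    by (rule bounded_elements_card[OF nf])
  define S where "S B = {P :: (qbar, 2) ppoint. (\<exists>u. u \<noteq> 0 \<and> (\<forall>j. u $ j \<in> L) \<and> P = proj_point u) \<and> weil_height P \<le> B}" for B
  define pt where "pt i \<alpha> = proj_point ((\<chi> k. if k = i then 1 else \<alpha>) :: qbar ^ 2)" for i \<alpha>
  have LF: "closed_subfield L" by (rule number_fieldD(1)[OF nf])
  have sub: "S B \<subseteq> (\<Union>i\<in>UNIV. pt i ` bounded_elements L TYPE(2) B)" for B
  proof
    fix P assume "P \<in> S B"
    then obtain u :: "qbar ^ 2" where u: "u \<noteq> 0" "\<forall>j. u $ j \<in> L" "P = proj_point u" "weil_height P \<le> B"
      by (auto simp: S_def)
    have PS: "P \<in> proj_space" using u by (simp add: proj_point_in_space)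
    have uP: "u \<in> P" using proj_point_self[OF u(1)] u(3) by simp
    obtain i0 where i0: "u $ i0 \<noteq> 0" using u(1) by (auto simp: Finite_Cartesian_Product.vec_eq_iff)
    define x :: "qbar ^ 2" where "x = (SOME x. x \<in> P \<and> (\<exists>i. x $ i = 1))"
    have "\<exists>x. x \<in> P \<and> (\<exists>i. x $ i = 1)"
    proof (intro exI conjI)
      show "inverse (u $ i0) *s u \<in> P"
        unfolding u(3) proj_point_def proj_rel_def using u(1) i0 by (auto simp: Finite_Cartesian_Product.vec_eq_iff)
      show "(inverse (u $ i0) *s u) $ i0 = 1" using i0 by simp
    qed
    then have "x \<in> P \<and> (\<exists>i. x $ i = 1)" unfolding x_def by (rule someI_ex)
    then have x: "x \<in> P" "\<exists>i. x $ i = 1" by blast+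
    from x(2) obtain i where i: "x $ i = 1" by blast
    obtain c where c: "c \<noteq> 0" "x = c *s u" using proj_space_scale[OF PS uP x(1)] by blast
    have "c * u $ i = 1" using i c(2) by simp
    then have "c = inverse (u $ i)" by (metis inverse_unique mult.commute)
    then have cL: "c \<in> L" using u(2) number_fieldD(5)[OF nf] by simp
    have xL: "x $ k \<in> L" for k
      unfolding c(2) using cL u(2) unital_subringD(4)[OF number_fieldD(2)[OF nf]] by simp
    obtain j where j: "j \<noteq> i" "\<And>k. k = i \<or> k = j"
    proof (cases "i = 1")
      case True
      then show ?thesis using that[of 2] exhaust_2 by auto
    next
      case False
      then show ?thesis using that[of 1] exhaust_2 by metis
    qed
    define \<alpha> where "\<alpha> = x $ j"
    have rng: "range (\<lambda>k. x $ k) = {1, \<alpha>}"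
    proof
      show "range (\<lambda>k. x $ k) \<subseteq> {1, \<alpha>}" using j(2) i by (auto simp: \<alpha>_def) metis
      show "{1, \<alpha>} \<subseteq> range (\<lambda>k. x $ k)"
        using rangeI[of "\<lambda>k. x $ k" i] rangeI[of "\<lambda>k. x $ k" j] i by (simp add: \<alpha>_def)
    qed
    let ?K = "generate_field ring_of_type_algebra (range (\<lambda>k. x $ k))"
    have "height_over ?K x \<le> B"
      using u(4) unfolding weil_height_def x_def[symmetric] Let_def .
    moreover have "closed_subfield ?K" by (rule closed_subfield_generate_field)
    moreover have "?K \<subseteq> L" by (rule generate_field_subset[OF LF]) (use xL in auto)
    moreover have "\<alpha> \<in> ?K" by (rule generate_field.incl) (simp add: \<alpha>_def)
    ultimately have "\<alpha> \<in> bounded_elements L TYPE(2) B"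
      unfolding bounded_elements_def using rng by blast
    moreover have "P = pt i \<alpha>"
    proof -
      have "x $ k = (if k = i then 1 else \<alpha>)" for k using j(2)[of k] i by (auto simp: \<alpha>_def)
      then have "x = (\<chi> k. if k = i then 1 else \<alpha>)" by (simp add: Finite_Cartesian_Product.vec_eq_iff)
      then show ?thesis using proj_space_rep(2)[OF PS x(1)] unfolding pt_def by simp
    qed
    ultimately show "P \<in> (\<Union>i\<in>UNIV. pt i ` bounded_elements L TYPE(2) B)" by blast
  qed
  have main: "finite (S B) \<and> real (card (S B)) \<le> (2 * C) * exp (e * B)" if B: "0 \<le> B" for B
  proof
    let ?A = "bounded_elements L TYPE(2) B"
    have A: "finite ?A" "real (card ?A) \<le> C * exp (e * B)" using Ce(3) B by auto
    have finU: "finite (\<Union>i\<in>(UNIV :: 2 set). pt i ` ?A)" using A(1) by simp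
    show "finite (S B)" by (rule finite_subset[OF sub finU])
    have "card (S B) \<le> card (\<Union>i\<in>(UNIV :: 2 set). pt i ` ?A)" by (rule card_mono[OF finU sub])
    also have "\<dots> \<le> (\<Sum>i\<in>(UNIV :: 2 set). card (pt i ` ?A))" by (rule card_UN_le) simp
    also have "\<dots> \<le> (\<Sum>i\<in>(UNIV :: 2 set). card ?A)" by (intro sum_mono card_image_le A(1))
    also have "\<dots> = 2 * card ?A" by simp
    finally have "real (card (S B)) \<le> 2 * real (card ?A)" by linarith
    then show "real (card (S B)) \<le> (2 * C) * exp (e * B)" using A(2) by simp
  qed
  have "0 < 2 * C" using Ce(1) by simp
  then show ?thesis using that[of "2 * C" e] Ce(2) main unfolding S_def by blast
qed


section \<open>The height gap\<close>

text \<open>Every index from \<open>n\<close> on can be lowered by \<open>n - m\<close> without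
  changing the value.\<close>

lemma eventually_periodic_finite_range:
  fixes a :: "nat \<Rightarrow> 'b"
  assumes "m < n" and per: "\<And>i. a (m + i) = a (n + i)"
  shows "finite (range a)"
proof -
  have "a t \<in> a ` {..<n}" for t
  proof (induction t rule: less_induct)
    case (less t)
    show ?case
    proof (cases "t < n")
      case False
      define s where "s = m + (t - n)"
      have "a s = a t" unfolding s_def using per[of "t - n"] False by simp
      moreover have "s < t" unfolding s_def using False assms(1) by linarith
      ultimately show ?thesis using less by metis
    qed auto
  qed
  then have "range a \<subseteq> a ` {..<n}" by blast
  then show ?thesis by (rule finite_subset) simp
qed

text \<open>The windows starting below \<open>M\<close> use only the first \<open>M + k\<close>
  terms, so the hypothesis leaves fewer possible windows than starting points. Two windows coincide
  and by \<open>det\<close> continue alike forever.\<close>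

lemma few_values_finite_range:
  fixes a :: "nat \<Rightarrow> 'b"
  assumes det: "\<And>m n. (\<forall>i<k. a (m + i) = a (n + i)) \<Longrightarrow> (\<forall>i. a (m + i) = a (n + i))"
    and few: "card (a ` {..<M + k}) ^ k < M"
  shows "finite (range a)"
proof -
  let ?W = "\<lambda>n. restrict (\<lambda>i. a (n + i)) {..<k}"
  let ?T = "PiE {..<k} (\<lambda>_. a ` {..<M + k})"
  have "?W ` {..<M} \<subseteq> ?T"
  proof (rule image_subsetI)
    fix n assume "n \<in> {..<M}"
    then show "?W n \<in> ?T" unfolding restrict_PiE_iff by auto
  qed
  moreover have "finite ?T" by (intro finite_PiE) auto
  ultimately have "card (?W ` {..<M}) \<le> card ?T" by (intro card_mono)
  also have "card ?T = card (a ` {..<M + k}) ^ k" by (subst card_PiE) auto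
  finally have "card (?W ` {..<M}) < card {..<M}" using few by simp
  then have "\<not> inj_on ?W {..<M}" by (rule pigeonhole)
  then obtain m n where mn: "m < n" "?W m = ?W n"
    unfolding inj_on_def by (metis linorder_neqE_nat)
  have "\<forall>i<k. a (m + i) = a (n + i)"
  proof (intro allI impI)
    fix i assume "i < k"
    then show "a (m + i) = a (n + i)" using fun_cong[OF mn(2), of i] by simp
  qed
  then show ?thesis using eventually_periodic_finite_range[OF mn(1)] det by blast
qed

text \<open>The first \<open>M\<close> terms take at most a constant times \<open>M\<close> to the
  power \<open>1 / (2 * k)\<close> many values; the \<open>k\<close>-th power of this has only the
  order of the square root of \<open>M\<close>.\<close>

lemma exp_growth_count:
  fixes a :: "nat \<Rightarrow> 'b" and h :: "'b \<Rightarrow> real"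
  assumes C: "0 \<le> C" "0 \<le> e"
    and count: "\<And>B. 0 \<le> B \<Longrightarrow> finite {y \<in> range a. h y \<le> B} \<and> real (card {y \<in> range a. h y \<le> B}) \<le> C * exp (e * B)"
    and small: "\<not> 0 < limsup (\<lambda>n. ereal (h (a n) / ln (real n)))"
    and k: "0 < k"
  shows "\<exists>M. card (a ` {..<M + k}) ^ k < M"
proof -
  \<comment> \<open>The exponent is chosen so that its \<open>k\<close>-fold is one half. In
    \<open>\<epsilon>\<close> the denominator \<open>e + 1\<close> covers the case
    \<open>e = 0\<close> and gives \<open>e * \<epsilon> \<le> q\<close>.\<close>
  define q where "q = 1 / (2 * real k)"
  define \<epsilon> where "\<epsilon> = q / (e + 1)"
  have q: "0 < q" using k by (simp add: q_def)
  have \<epsilon>: "0 < \<epsilon>" "e * \<epsilon> \<le> q" using q C by (auto simp: \<epsilon>_def field_simps)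
  have "limsup (\<lambda>n. ereal (h (a n) / ln (real n))) < ereal \<epsilon>"
    using small \<epsilon>(1) by (metis ereal_less(2) less_le_trans not_less order_le_less_trans)
  then have "eventually (\<lambda>n. ereal (h (a n) / ln (real n)) < ereal \<epsilon>) sequentially"
    by (rule Limsup_lessD)
  then obtain n1 where n1: "\<And>n. n \<ge> n1 \<Longrightarrow> h (a n) / ln (real n) < \<epsilon>"
    unfolding eventually_sequentially by auto
  \<comment> \<open>From 2 on the logarithm is positive; the values at smaller indices are simply
    added to the count.\<close>
  define n0 where "n0 = max n1 2"
  have h_le: "h (a n) \<le> \<epsilon> * ln (real M)" if "n0 \<le> n" "n < M" for n M
  proof -
    have n: "n1 \<le> n" "2 \<le> n" using that(1) by (auto simp: n0_def)
    have ln_pos: "0 < ln (real n)" using n by simp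
    have "h (a n) < \<epsilon> * ln (real n)" using n1[OF n(1)] ln_pos by (simp add: field_simps)
    also have "\<dots> \<le> \<epsilon> * ln (real M)" using \<epsilon>(1) n that(2) by (intro mult_left_mono) auto
    finally show ?thesis by simp
  qed
  have card_le: "real (card (a ` {..<M})) \<le> (real n0 + C) * exp (q * ln (real M))" if M: "1 \<le> M" for M
  proof -
    define B where "B = \<epsilon> * ln (real M)"
    have B: "0 \<le> B" using \<epsilon>(1) M by (simp add: B_def)
    let ?S = "{y \<in> range a. h y \<le> B}"
    have "a ` {..<M} \<subseteq> a ` {..<n0} \<union> ?S"
    proof
      fix y assume "y \<in> a ` {..<M}"
      then obtain n where n: "n < M" "y = a n" by auto
      show "y \<in> a ` {..<n0} \<union> ?S"
        using n h_le[of n M] by (cases "n < n0") (auto simp: B_def)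
    qed
    then have "card (a ` {..<M}) \<le> card (a ` {..<n0} \<union> ?S)" using count[OF B] by (intro card_mono) auto
    also have "\<dots> \<le> card (a ` {..<n0}) + card ?S" by (rule card_Un_le)
    also have "\<dots> \<le> n0 + card ?S" using card_image_le[of "{..<n0}" a] by simp
    finally have "real (card (a ` {..<M})) \<le> real n0 + real (card ?S)" by linarith
    also have "\<dots> \<le> real n0 + C * exp (e * B)" using count[OF B] by simp
    also have "\<dots> \<le> real n0 * exp (q * ln (real M)) + C * exp (q * ln (real M))"
    proof (intro add_mono mult_left_mono)
      have "real n0 * 1 \<le> real n0 * exp (q * ln (real M))" using q M by (intro mult_left_mono) auto
      then show "real n0 \<le> real n0 * exp (q * ln (real M))" by simp
      have "e * B = (e * \<epsilon>) * ln (real M)" by (simp add: B_def)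
      also have "\<dots> \<le> q * ln (real M)" using \<epsilon>(2) M by (intro mult_right_mono) auto
      finally show "exp (e * B) \<le> exp (q * ln (real M))" by simp
    qed (use C in auto)
    finally show ?thesis by (simp add: distrib_right)
  qed
  define G where "G = (real n0 + C) ^ k"
  have G: "0 \<le> G" using C by (simp add: G_def)
  \<comment> \<open>The condition results from squaring \<open>G * sqrt (2 * M) < M\<close>; the
    maximum with \<open>k\<close> in \<open>M\<close> then bounds \<open>M + k\<close> by
    \<open>2 * M\<close>.\<close>
  obtain M0 :: nat where M0: "2 * G ^ 2 < real M0" using reals_Archimedean2 by blast
  define M where "M = max M0 k"
  have M: "2 * G ^ 2 < real M" "k \<le> M" "1 \<le> M" using M0 k by (auto simp: M_def)
  have "real (card (a ` {..<M + k})) \<le> (real n0 + C) * exp (q * ln (real (M + k)))"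
    by (rule card_le) (use M in simp)
  also have "\<dots> \<le> (real n0 + C) * exp (q * ln (2 * real M))"
    using C q M k by (intro mult_left_mono) auto
  finally have "real (card (a ` {..<M + k})) ^ k \<le> ((real n0 + C) * exp (q * ln (2 * real M))) ^ k"
    by (rule power_mono) simp
  also have "\<dots> = G * exp (real k * (q * ln (2 * real M)))"
    by (simp add: power_mult_distrib G_def exp_of_nat_mult)
  also have "real k * (q * ln (2 * real M)) = ln (2 * real M) / 2" using k by (simp add: q_def)
  also have "exp (ln (2 * real M) / 2) = sqrt (2 * real M)"
    using M by (simp add: ln_sqrt[symmetric])
  also have "G * sqrt (2 * real M) < real M"
  proof (rule power2_less_imp_less)
    have "(G * sqrt (2 * real M))\<^sup>2 = (2 * G ^ 2) * real M" by (simp add: power_mult_distrib)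
    also have "\<dots> < real M * real M" using M by (intro mult_strict_right_mono) auto
    finally show "(G * sqrt (2 * real M))\<^sup>2 < (real M)\<^sup>2" by (simp add: power2_eq_square)
  qed simp
  finally have "real (card (a ` {..<M + k}) ^ k) < real M" by simp
  then show ?thesis by (auto simp only: of_nat_less_iff)
qed

theorem theorem1p2:
  fixes V :: "(qbar, 'n::finite) ppoint set"
    and \<Phi> :: "(qbar, 'n, 'n) rat_map"
    and f :: "(qbar, 'n, 2) rat_map"
    and x :: "(qbar, 'n) ppoint"
  assumes "quasi_projective_variety V"
    and "\<Phi> \<in> rational_maps V V"
    and "f \<in> rational_maps V proj_space"
    and "nonconstant_on V f"
    and "x \<in> orbit_defined_for V \<Phi> f"
  shows "finite (rat_app f ` forward_orbit \<Phi> x) \<or>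
    limsup (\<lambda>n. ereal (weil_height (rat_app f ((rat_app \<Phi> ^^ n) x)) / ln (real n))) > 0"
proof (rule disjCI)
  assume small: "\<not> 0 < limsup (\<lambda>n. ereal (weil_height (rat_app f ((rat_app \<Phi> ^^ n) x)) / ln (real n)))"
  define Y where "Y n = (rat_app \<Phi> ^^ n) x" for n
  have x: "x \<in> orbit_defined V \<Phi>" using assms(5) by (simp add: orbit_defined_for_def)
  interpret rational_orbit V \<Phi> Y
    unfolding Y_def by (rule rational_orbit_iterates[OF assms(1,2) x])
  have fdef: "Y n \<notin> indeterminacy V f" for n
    using assms(5) unfolding orbit_defined_for_def forward_orbit_def Y_def by blast
  define a where "a n = rat_app f (Y n)" for n
  obtain k where "\<forall>m n. (\<forall>i<k. a (m + i) = a (n + i)) \<longrightarrow> (\<forall>i. a (m + i) = a (n + i))"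
    using orbit_values_determined[OF assms(3) fdef] unfolding a_def by (elim exE)
  \<comment> \<open>Passing to \<open>Suc k\<close> makes the window length positive, as the
    exponent in the count is obtained by dividing by it.\<close>
  then have det: "(\<forall>i. a (m + i) = a (n + i))" if "\<forall>i<Suc k. a (m + i) = a (n + i)" for m n
    using that by (meson less_SucI)
  obtain C where C: "finite C" "\<forall>K. unital_subring K \<longrightarrow> C \<subseteq> K \<longrightarrow>
    (\<forall>m. \<exists>w. (\<forall>j. w $ j \<in> K) \<and> w \<noteq> 0 \<and> a m = proj_point w)"
    using orbit_field_of_definition[OF assms(3) fdef] unfolding a_def by (elim exE conjE)
  obtain L where L: "number_field L" "C \<subseteq> L" by (rule number_field_containing[OF C(1)])
  have rat: "\<forall>m. \<exists>w. (\<forall>j. w $ j \<in> L) \<and> w \<noteq> 0 \<and> a m = proj_point w"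
    using C(2) number_fieldD(2)[OF L(1)] L(2) by blast
  obtain c e where ce: "0 < c" "0 \<le> e"
    "\<forall>B\<ge>0. finite {P :: (qbar, 2) ppoint. (\<exists>u. u \<noteq> 0 \<and> (\<forall>j. u $ j \<in> L) \<and> P = proj_point u) \<and> weil_height P \<le> B} \<and>
      real (card {P :: (qbar, 2) ppoint. (\<exists>u. u \<noteq> 0 \<and> (\<forall>j. u $ j \<in> L) \<and> P = proj_point u) \<and> weil_height P \<le> B})
        \<le> c * exp (e * B)"
    by (rule projective_line_bounded_height[OF L(1)])
  have count: "finite {y \<in> range a. weil_height y \<le> B} \<and>
      real (card {y \<in> range a. weil_height y \<le> B}) \<le> c * exp (e * B)" if B: "0 \<le> B" for B
  proof -
    let ?S = "{P :: (qbar, 2) ppoint. (\<exists>u. u \<noteq> 0 \<and> (\<forall>j. u $ j \<in> L) \<and> P = proj_point u) \<and> weil_height P \<le> B}"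
    have S: "finite ?S" "real (card ?S) \<le> c * exp (e * B)" using ce(3) B by auto
    have sub: "{y \<in> range a. weil_height y \<le> B} \<subseteq> ?S"
    proof
      fix y assume "y \<in> {y \<in> range a. weil_height y \<le> B}"
      then obtain m where m: "y = a m" "weil_height y \<le> B" by blast
      obtain u :: "qbar ^ 2" where "\<forall>j. u $ j \<in> L" "u \<noteq> 0" "a m = proj_point u" using rat by blast
      then show "y \<in> ?S" using m by blast
    qed
    show ?thesis using finite_subset[OF sub S(1)] card_mono[OF S(1) sub] S(2) by linarith
  qed
  obtain M where "card (a ` {..<M + Suc k}) ^ Suc k < M"
    using exp_growth_count[OF less_imp_le[OF ce(1)] ce(2) count _ zero_less_Suc, of k] small
    unfolding a_def Y_def by blast
  from few_values_finite_range[OF det this] have "finite (range a)" .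
  then show "finite (rat_app f ` forward_orbit \<Phi> x)"
    unfolding forward_orbit_def image_image a_def Y_def .
qed

end
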